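(* Let $n\ge3$ and let $\Lambda$ be a dominant integral weight of level $1$. (1) If $\mathfrak g$ is of type $A_{2n-1}^{(2)}$, then $\displaystyle\Sigma^\Lambda_\Lambda(q)=\frac{1}{(q)_\infty^{\,n}\,(q^2)_\infty}$. (2) If $\mathfrak g$ is of type $D_{n+1}^{(1)}$, then $\displaystyle\Sigma^\Lambda_\Lambda(q)=\frac{1}{(q)_\infty^{\,n+2}}$.
   Context: **Types and weights.** Type $A_{2n-1}^{(2)}$ ($n\ge3$): colors $0,\dots,n$, $\delta=\alpha_0+\alpha_1+2(\alpha_2+\cdots+\alpha_{n-1})+\alpha_n$, level 1 weights $\Lambda\in\{\Lambda_0,\Lambda_1\}$, $\ell=2n-1$. Type $D_{n+1}^{(1)}$ ($n\ge3$): colors $0,\dots,n+1$, $\delta=\alpha_0+\alpha_1+2(\alpha_2+\cdots+\alpha_{n-1})+\alpha_n+\alpha_{n+1}$, level 1 weights $\Lambda\in\{\Lambda_0,\Lambda_1,\Lambda_n,\Lambda_{n+1}\}$, $\ell=n$. **Proper Young walls.** There are infinitely many columns, numbered $1,2,\dots$ from right to left. Each column is a stack of unit-height floors. A floor is either one unit cube of the indicated color, or a "split floor" $\{i,j\}$ made of two half-thickness blocks of colors $i,j$ in two positions called A and B. The floors from bottom to top are, repeated cyclically: for $A_{2n-1}^{(2)}$: $\{0,1\},2,\dots,n-1,n,n-1,\dots,2$; for $D_{n+1}^{(1)}$ with $\Lambda\in\{\Lambda_0,\Lambda_1\}$: $\{0,1\},2,\dots,n-1,\{n,n+1\},n-1,\dots,2$;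 for $D_{n+1}^{(1)}$ with $\Lambda\in\{\Lambda_n,\Lambda_{n+1}\}$: $\{n,n+1\},n-1,\dots,2,\{0,1\},2,\dots,n-1$. On a floor $\{0,1\}$ of column $k$, position A has color $1$ for $k$ odd and $0$ for $k$ even, except that for $\Lambda=\Lambda_1$ this is reversed; on a floor $\{n,n+1\}$ of column $k$, position A has color $n+1$ for $k$ odd and $n$ for $k$ even, except that for $\Lambda=\Lambda_{n+1}$ this is reversed; position B has the other color. The ground state wall $Y_\Lambda$ consists of the A-block of the bottom floor in every column. A Young wall $Y=(y_k)_{k\ge1}$ is obtained by adding finitely many blocks, where a floor may be started only when the floor below it is completely filled, the two blocks of a split floor above the bottom may be added in either order, and there is no free space to the right of any block (if a place is occupied in column $k+1$, the same place is occupied in column $k$). $|y_k|$ is the number of added blocks in column $k$; the top floor of column $k$ is half-filled iff $\ell\mid|y_k|$. A column is full if its top floor is completely filled, i.e. $\ell\nmid|y_k|$. $Y$ is proper if no two full columns have the same height. Equivalently, a proper Young wall is a partition $(|y_k|)_k$ whose parts not divisible by $\ell$ are distinct, with a choice A or B for each positive part divisible by $\ell$ (the position of the top half-block), equal parts having equal choices. $\mathcal Z(\Lambda)$ is the set of proper Young walls, $\mathrm{wt}(Y)=\Lambda-\sum_ik_i\alpha_i$ with $k_i$ the number of added $i$-blocks, and $\mathcal Z(\Lambda)_\lambda=\{Y:\mathrm{wt}(Y)=\lambda\}$. The string function (of the Fock space representation with crystal $\mathcal Z(\Lambda)$) is $\Sigma^\Lambda_\lambda(q)=\sum_{m\ge0}|\mathcal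 Z(\Lambda)_{\lambda-m\delta}|\,q^m$. $(q)_\infty=\prod_{m\ge1}(1-q^m)$, $(q^2)_\infty=\prod_{m\ge1}(1-q^{2m})$. *)

theory Defs
  imports
    "HOL-Analysis.Infinite_Products"
    "HOL-Computational_Algebra.Formal_Power_Series"
    "HOL-Library.Poly_Mapping"
begin

text \<open>
  \<open>A_tw n\<close> is the type $A_{2n-1}^{(2)}$ and \<open>D_aff n\<close> is the type $D_{n+1}^{(1)}$, both meant
  for \<open>n \<ge> 3\<close>.
\<close>

datatype affine_type = A_tw nat | D_aff nat

fun colors :: "affine_type \<Rightarrow> nat set" where
  "colors (A_tw n) = {0..n}"
| "colors (D_aff n) = {0..n+1}"

text \<open>The level 1 dominant integral weights are fundamental weights; they are given by their index.\<close>

fun level_one :: "affine_type \<Rightarrow> nat set" where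
  "level_one (A_tw n) = {0, 1}"
| "level_one (D_aff n) = {0, 1, n, n+1}"

text \<open>
  The affine Cartan matrix $a_{ij} = \langle h_i, \alpha_j\rangle$. In type $A_{2n-1}^{(2)}$ the
  nodes $0$ and $1$ are attached to the chain $2, \ldots, n$ at $2$, and $\alpha_n$ is long; in
  type $D_{n+1}^{(1)}$ the nodes $0, 1$ are attached to the chain $2, \ldots, n-1$ at $2$ and
  the nodes $n, n+1$ are attached to it at $n-1$.
\<close>

fun cartan :: "affine_type \<Rightarrow> nat \<Rightarrow> nat \<Rightarrow> int" where
  "cartan (A_tw n) i j =
    (if i = j then 2
     else if i = n - 1 \<and> j = n then -2
     else if {i, j} = {0, 2} \<or> (\<exists>k\<in>{1..<n}. {i, j} = {k, k+1}) then -1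
     else 0)"
| "cartan (D_aff n) i j =
    (if i = j then 2
     else if {i, j} = {0, 2} \<or> {i, j} = {n - 1, n + 1} \<or> (\<exists>k\<in>{1..<n}. {i, j} = {k, k+1}) then -1
     else 0)"

text \<open>
  The weight lattice $P = \bigoplus_i \mathbb{Z}\Lambda_i \oplus \mathbb{Z}\delta$ as a free
  abelian group, with $\alpha_j = \sum_i a_{ij} \Lambda_i + [j = 0]\, \delta$.
\<close>

datatype weight_basis = Fund nat | Imag

type_synonym weight = "weight_basis \<Rightarrow>\<^sub>0 int"

definition fund :: "nat \<Rightarrow> weight" where
  "fund i = frag_of (Fund i)"

definition simple_root :: "affine_type \<Rightarrow> nat \<Rightarrow> weight" where
  "simple_root X j =
    (\<Sum>i\<in>colors X. frag_cmul (cartan X i j) (fund i)) + (if j = 0 then frag_of Imag else 0)"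

fun null_root :: "affine_type \<Rightarrow> weight" where
  "null_root (A_tw n) =
    simple_root (A_tw n) 0 + simple_root (A_tw n) 1
    + frag_cmul 2 (\<Sum>i = 2..n - 1. simple_root (A_tw n) i) + simple_root (A_tw n) n"
| "null_root (D_aff n) =
    simple_root (D_aff n) 0 + simple_root (D_aff n) 1
    + frag_cmul 2 (\<Sum>i = 2..n - 1. simple_root (D_aff n) i)
    + simple_root (D_aff n) n + simple_root (D_aff n) (n+1)"

text \<open>One period of floors, from bottom to top. \<open>Split i j\<close> is used only with \<open>j = i + 1\<close>.\<close>

datatype floor_kind = Cube nat | Split nat nat

fun floor_cycle :: "affine_type \<Rightarrow> nat \<Rightarrow> floor_kind list" where
  "floor_cycle (A_tw n) \<Lambda> =
    [Split 0 1] @ map Cube [2..<n] @ [Cube n] @ map Cube (rev [2..<n])"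
| "floor_cycle (D_aff n) \<Lambda> =
    (if \<Lambda> \<in> {0, 1}
     then [Split 0 1] @ map Cube [2..<n] @ [Split n (n+1)] @ map Cube (rev [2..<n])
     else [Split n (n+1)] @ map Cube (rev [2..<n]) @ [Split 0 1] @ map Cube [2..<n])"

definition floor_at :: "affine_type \<Rightarrow> nat \<Rightarrow> nat \<Rightarrow> floor_kind" where
  "floor_at X \<Lambda> h = floor_cycle X \<Lambda> ! (h mod length (floor_cycle X \<Lambda>))"

datatype position = Whole | PosA | PosB

fun positions :: "floor_kind \<Rightarrow> position set" where
  "positions (Cube i) = {Whole}"
| "positions (Split i j) = {PosA, PosB}"

text \<open>
  A place is a triple of a column (numbered from 1), a floor (numbered from 0) and a position.
  On a floor \<open>Split i j\<close> position A has color \<open>j\<close> in odd columns and \<open>i\<close> in even columns,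
  reversed if \<open>\<Lambda> = j\<close>.
\<close>

type_synonym place = "nat \<times> nat \<times> position"

fun color_A :: "nat \<Rightarrow> nat \<Rightarrow> nat \<Rightarrow> nat \<Rightarrow> nat" where
  "color_A \<Lambda> k i j = (if odd k \<longleftrightarrow> \<Lambda> \<noteq> j then j else i)"

fun color_B :: "nat \<Rightarrow> nat \<Rightarrow> nat \<Rightarrow> nat \<Rightarrow> nat" where
  "color_B \<Lambda> k i j = (if odd k \<longleftrightarrow> \<Lambda> \<noteq> j then i else j)"

definition color :: "affine_type \<Rightarrow> nat \<Rightarrow> place \<Rightarrow> nat" where
  "color X \<Lambda> = (\<lambda>(k, h, p).
    (case floor_at X \<Lambda> h of
       Cube i \<Rightarrow> i
     | Split i j \<Rightarrow> (if p = PosA then color_A \<Lambda> k i j else color_B \<Lambda> k i j)))"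

definition places :: "affine_type \<Rightarrow> nat \<Rightarrow> place set" where
  "places X \<Lambda> = {(k, h, p). 1 \<le> k \<and> p \<in> positions (floor_at X \<Lambda> h)}"

definition ground :: "place set" where
  "ground = {(k, h, p). 1 \<le> k \<and> h = 0 \<and> p = PosA}"

definition floor_filled :: "affine_type \<Rightarrow> nat \<Rightarrow> place set \<Rightarrow> nat \<Rightarrow> nat \<Rightarrow> bool" where
  "floor_filled X \<Lambda> Y k h \<longleftrightarrow> (\<forall>p\<in>positions (floor_at X \<Lambda> h). (k, h, p) \<in> Y)"

definition young_wall :: "affine_type \<Rightarrow> nat \<Rightarrow> place set \<Rightarrow> bool" where
  "young_wall X \<Lambda> Y \<longleftrightarrow>
     ground \<subseteq> Y \<and> Y \<subseteq> places X \<Lambda> \<and> finite (Y - ground) \<and>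
     (\<forall>k h p. (k, Suc h, p) \<in> Y \<longrightarrow> floor_filled X \<Lambda> Y k h) \<and>
     (\<forall>k h p. 1 \<le> k \<and> (Suc k, h, p) \<in> Y \<longrightarrow> (k, h, p) \<in> Y)"

definition height :: "place set \<Rightarrow> nat \<Rightarrow> nat" where
  "height Y k = card {h. \<exists>p. (k, h, p) \<in> Y}"

definition full :: "affine_type \<Rightarrow> nat \<Rightarrow> place set \<Rightarrow> nat \<Rightarrow> bool" where
  "full X \<Lambda> Y k \<longleftrightarrow> floor_filled X \<Lambda> Y k (height Y k - 1)"

definition proper :: "affine_type \<Rightarrow> nat \<Rightarrow> place set \<Rightarrow> bool" where
  "proper X \<Lambda> Y \<longleftrightarrow> young_wall X \<Lambda> Y \<and>
     (\<forall>k\<ge>1. \<forall>k'\<ge>1. full X \<Lambda> Y k \<and> full X \<Lambda> Y k' \<and> height Y k = height Y k' \<longrightarrow> k = k')"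

definition proper_walls :: "affine_type \<Rightarrow> nat \<Rightarrow> place set set" where
  "proper_walls X \<Lambda> = {Y. proper X \<Lambda> Y}"

definition added :: "affine_type \<Rightarrow> nat \<Rightarrow> place set \<Rightarrow> nat \<Rightarrow> nat" where
  "added X \<Lambda> Y i = card {b \<in> Y - ground. color X \<Lambda> b = i}"

definition wall_weight :: "affine_type \<Rightarrow> nat \<Rightarrow> place set \<Rightarrow> weight" where
  "wall_weight X \<Lambda> Y =
     fund \<Lambda> - (\<Sum>i\<in>colors X. frag_cmul (int (added X \<Lambda> Y i)) (simple_root X i))"

definition proper_walls_of_weight :: "affine_type \<Rightarrow> nat \<Rightarrow> weight \<Rightarrow> place set set" where
  "proper_walls_of_weight X \<Lambda> lam = {Y \<in> proper_walls X \<Lambda>. wall_weight X \<Lambda> Y = lam}"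

definition string_function :: "affine_type \<Rightarrow> nat \<Rightarrow> weight \<Rightarrow> rat fps" where
  "string_function X \<Lambda> lam =
     Abs_fps (\<lambda>m. of_nat (card (proper_walls_of_weight X \<Lambda> (lam - frag_cmul (int m) (null_root X)))))"

text \<open>$(q^d)_\infty = \prod_{m \ge 1} (1 - q^{dm})$, convergent in the $q$-adic topology.\<close>

definition qinf :: "nat \<Rightarrow> rat fps" where
  "qinf d = prodinf (\<lambda>m. 1 - fps_X ^ (d * Suc m))"

lemma qinf_has_prod: assumes "d \<ge> 1" shows "(\<lambda>m. 1 - fps_X ^ (d * Suc m) :: rat fps) has_prod qinf d"
proof -
  let ?f = "\<lambda>m. 1 - fps_X ^ (d * Suc m) :: rat fps"
  let ?P = "\<lambda>n. \<Prod>i\<le>n. ?f i"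
  have st: "fps_nth (?P (Suc n)) k = fps_nth (?P n) k" if "k \<le> n" for n k
  proof -
    have "k < 1 * Suc (Suc n)" using that by simp
    also have "\<dots> \<le> d * Suc (Suc n)" using assms by (rule mult_le_mono1)
    finally have "k < d * Suc (Suc n)" .
    then show ?thesis by (simp add: algebra_simps fps_X_power_mult_nth del: mult_Suc_right mult_Suc power_Suc)
  qed
  have st2: "fps_nth (?P n) k = fps_nth (?P k) k" if "k \<le> n" for n k
    using that by (induction n rule: dec_induct) (use st in auto)
  have "?P \<longlonglongrightarrow> Abs_fps (\<lambda>k. fps_nth (?P k) k)"
  proof (rule tendsto_fpsI)
    fix k show "\<forall>\<^sub>F n in sequentially. fps_nth (?P n) k = fps_nth (Abs_fps (\<lambda>k. fps_nth (?P k) k)) k"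
      unfolding fps_nth_Abs_fps by (rule eventually_sequentiallyI[of k]) (rule st2)
  qed
  moreover have "fps_nth (?P 0) 0 = 1" using assms by (simp)
  hence "fps_nth (Abs_fps (\<lambda>k. fps_nth (?P k) k)) 0 \<noteq> 0" by simp
  hence "Abs_fps (\<lambda>k. fps_nth (?P k) k) \<noteq> 0" by (rule contrapos_nn) (simp only: fps_zero_nth)
  ultimately have "raw_has_prod ?f 0 (Abs_fps (\<lambda>k. fps_nth (?P k) k))" by (simp add: raw_has_prod_def)
  hence hp: "?f has_prod (Abs_fps (\<lambda>k. fps_nth (?P k) k))" by (simp add: has_prod_def)
  then have "?f has_prod prodinf ?f" by (simp only: has_prod_unique[OF hp, symmetric])
  thus ?thesis by (simp add: qinf_def)
qed

end

theory Submission
  imports Defs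
begin

text \<open>
  On a split floor, call \<open>+\<close> the color of position A in odd columns and \<open>-\<close> the other color.
  Columns of equal height whose top floor is half-filled form a run. All of them use the same
  position, and the color of a position alternates with the parity of the column, so the colors
  of the top half blocks of a run read $+,-,+,-,\ldots$ or $-,+,-,+,\ldots$. Hence a proper wall
  amounts to the set \<open>F\<close> of floors that are the top of a full column (at most one column each,
  by properness) and, for every split floor above the bottom one, the length and the first color
  of its run (\<open>bij_betw_wall_of\<close>). This description no longer mentions the parity of columns.

  As the simple roots are linearly independent, the weight is $\Lambda - m\delta$ iff the number
  of added \<open>i\<close>-blocks is \<open>m\<close> times the coefficient of $\alpha_i$ in $\delta$. Put $g = n - 1$; the
  floors repeat with period $2g$, and apart from the two floors at residues \<open>0\<close> and \<open>g\<close> their colors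
  form a palindrome. Differences of the conditions for neighboring colors decouple
  (\<open>content_balance\<close>): full tops at residue $\rho$ and at residue $2g - 1 - \rho$ are equally many, for
  each $\rho < g$; on the split floors at residue \<open>g\<close> there are as many top half blocks of color \<open>+\<close> as
  of color \<open>-\<close>; at residue \<open>0\<close> the same holds up to one missing \<open>-\<close>, which the ground state supplies
  when the number of columns is odd. What remains says that an additive energy equals \<open>m\<close>.

  Split each run into neighboring pairs \<open>+-\<close>, up to at most one extra \<open>+\<close> and one extra \<open>-\<close>. The
  extra half blocks and the full tops then become independent pairs $(S, T)$ of finite sets of
  numbers with $|S| = |T|$ and weight $\sum_{a \in S} (a + 1) + \sum_{b \in T} b$: there are $g$
  of them from the full tops, one from residue \<open>0\<close> and, if the floors at residue \<open>g\<close> are split, one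
  from residue \<open>g\<close>. These are Frobenius coordinates of partitions, so each contributes
  $1/(q)_\infty$ (\<open>has_gf_frob_pairs\<close>). The numbers of pairs \<open>+-\<close> on the split floors are free. A pair
  on the $t$-th split floor above the bottom has energy $2t$ in type $A_{2n-1}^{(2)}$ and $t$ in
  type $D_{n+1}^{(1)}$, which gives the factor $1/(q^2)_\infty$ or $1/(q)_\infty$
  (\<open>has_gf_part_mults\<close>). In total there are $n$ factors $1/(q)_\infty$ and one $1/(q^2)_\infty$ in
  type $A_{2n-1}^{(2)}$, and $(n + 1) + 1$ factors $1/(q)_\infty$ in type $D_{n+1}^{(1)}$.
\<close>

section \<open>Generating functions of weighted sets\<close>

text \<open>
  Finiteness of the graded pieces is part of the notion: the cardinality of an infinite set is
  \<open>0\<close>, and products would otherwise fail.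
\<close>

definition has_gf :: "'a set \<Rightarrow> ('a \<Rightarrow> nat) \<Rightarrow> rat fps \<Rightarrow> bool" where
  "has_gf A w f \<longleftrightarrow>
     (\<forall>m. finite {a \<in> A. w a = m} \<and> fps_nth f m = of_nat (card {a \<in> A. w a = m}))"

lemma has_gf_bij:
  assumes "has_gf A w f" and bij: "bij_betw h A B" and w: "\<And>a. a \<in> A \<Longrightarrow> v (h a) = w a"
  shows "has_gf B v f"
  unfolding has_gf_def
proof
  fix m
  have "{b \<in> B. v b = m} = h ` {a \<in> A. w a = m}"
    using bij w by (auto simp: bij_betw_def)
  moreover have "inj_on h {a \<in> A. w a = m}"
    using bij by (auto simp: bij_betw_def inj_on_def)
  ultimately show "finite {b \<in> B. v b = m} \<and> fps_nth f m = of_nat (card {b \<in> B. v b = m})"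
    using assms(1) by (simp add: has_gf_def card_image)
qed

lemma has_gf_Times:
  assumes "has_gf A w f" "has_gf B v g"
  shows "has_gf (A \<times> B) (\<lambda>(a, b). w a + v b) (f * g)"
  unfolding has_gf_def
proof
  fix m
  let ?A = "\<lambda>i. {a \<in> A. w a = i}" and ?B = "\<lambda>i. {b \<in> B. v b = i}"
  have fin: "finite (?A i)" "finite (?B i)" for i using assms by (auto simp: has_gf_def)
  have eq: "{x \<in> A \<times> B. (case x of (a, b) \<Rightarrow> w a + v b) = m} = (\<Union>i\<in>{0..m}. ?A i \<times> ?B (m - i))"
    by auto
  have "card (\<Union>i\<in>{0..m}. ?A i \<times> ?B (m - i)) = (\<Sum>i=0..m. card (?A i \<times> ?B (m - i)))"
    by (rule card_UN_disjoint) (auto intro: fin)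
  then have "of_nat (card (\<Union>i\<in>{0..m}. ?A i \<times> ?B (m - i))) = fps_nth (f * g) m"
    using assms by (simp add: has_gf_def fps_mult_nth card_cartesian_product)
  then show "finite {x \<in> A \<times> B. (case x of (a, b) \<Rightarrow> w a + v b) = m} \<and>
      fps_nth (f * g) m = of_nat (card {x \<in> A \<times> B. (case x of (a, b) \<Rightarrow> w a + v b) = m})"
    unfolding eq by (auto intro!: fin)
qed

lemma has_gf_singleton: "has_gf {a} (\<lambda>_. 0) 1"
proof -
  have "{b \<in> {a}. (0::nat) = m} = (if m = 0 then {a} else {})" for m by auto
  then show ?thesis by (auto simp: has_gf_def)
qed

lemma has_gf_PiE:
  assumes "finite I" "\<And>i. i \<in> I \<Longrightarrow> has_gf (A i) (w i) (f i)"
  shows "has_gf (PiE I A) (\<lambda>x. \<Sum>i\<in>I. w i (x i)) (\<Prod>i\<in>I. f i)"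
  using assms
proof (induction I rule: finite_induct)
  case empty
  show ?case by (simp add: has_gf_singleton)
next
  case (insert j I)
  have "has_gf (A j \<times> PiE I A) (\<lambda>(y, x). w j y + (\<Sum>i\<in>I. w i (x i))) (f j * (\<Prod>i\<in>I. f i))"
    using insert by (intro has_gf_Times) auto
  moreover have "bij_betw (\<lambda>(y, x). x(j := y)) (A j \<times> PiE I A) (PiE (insert j I) A)"
    using inj_combinator[OF insert.hyps(2), of A]
    by (simp add: bij_betw_def PiE_insert_eq)
  ultimately have "has_gf (PiE (insert j I) A) (\<lambda>x. w j (x j) + (\<Sum>i\<in>I. w i (x i))) (f j * (\<Prod>i\<in>I. f i))"
  proof (rule has_gf_bij, clarify)
    fix y x assume "x \<in> PiE I A"
    have "(\<Sum>i\<in>I. w i ((x(j := y)) i)) = (\<Sum>i\<in>I. w i (x i))"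
      using insert.hyps(2) by (intro sum.cong) auto
    then show "w j ((x(j := y)) j) + (\<Sum>i\<in>I. w i ((x(j := y)) i)) = w j y + (\<Sum>i\<in>I. w i (x i))"
      by simp
  qed
  then show ?case using insert.hyps by simp
qed

definition agree :: "nat \<Rightarrow> rat fps \<Rightarrow> rat fps \<Rightarrow> bool" where
  "agree M f g \<longleftrightarrow> (\<forall>k<M. fps_nth f k = fps_nth g k)"

lemma agree_refl [simp]: "agree M f f" by (simp add: agree_def)

lemma agree_sym: "agree M f g \<Longrightarrow> agree M g f" by (simp add: agree_def)

lemma agree_trans: "agree M f g \<Longrightarrow> agree M g h \<Longrightarrow> agree M f h" by (simp add: agree_def)

lemma agree_mult: "agree M f f' \<Longrightarrow> agree M g g' \<Longrightarrow> agree M (f * g) (f' * g')"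
  by (auto simp: agree_def fps_mult_nth intro!: sum.cong)

lemma agree_cancel:
  assumes "agree M (f * h) (g * h)" "fps_nth h 0 \<noteq> 0"
  shows "agree M f g"
proof -
  have h: "h * inverse h = 1" using assms(2) by (metis inverse_mult_eq_1 mult.commute)
  have "agree M ((f * h) * inverse h) ((g * h) * inverse h)"
    by (rule agree_mult[OF assms(1) agree_refl])
  then show ?thesis by (simp only: mult.assoc h mult_1_right)
qed

text \<open>
  A generating function is determined by its truncations, so an infinite set may be replaced, for
  each bound \<open>M\<close>, by a simpler one that has the same elements of weight below
  \<open>M\<close>.
\<close>

lemma has_gf_truncated:
  assumes "\<And>M. \<exists>B f'. has_gf B w f' \<and> {a \<in> A. w a < M} = {a \<in> B. w a < M} \<and> agree M f f'"
  shows "has_gf A w f"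
  unfolding has_gf_def
proof
  fix m
  obtain B f' where B: "has_gf B w f'" "{a \<in> A. w a < Suc m} = {a \<in> B. w a < Suc m}" "agree (Suc m) f f'"
    using assms by blast
  have "{a \<in> A. w a = m} = {a \<in> B. w a = m}" using B(2) by auto
  then show "finite {a \<in> A. w a = m} \<and> fps_nth f m = of_nat (card {a \<in> A. w a = m})"
    using B(1,3) by (simp add: has_gf_def agree_def)
qed

text \<open>
  The partial products of $(q^d)_\infty$.
\<close>

definition qpoch :: "nat \<Rightarrow> nat \<Rightarrow> rat fps" where
  "qpoch d K = (\<Prod>m<K. 1 - fps_X ^ (d * Suc m))"

lemma qpoch_0 [simp]: "qpoch d 0 = 1" by (simp add: qpoch_def)
lemma qpoch_Suc: "qpoch d (Suc K) = qpoch d K * (1 - fps_X ^ (d * Suc K))" by (simp add: qpoch_def)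

lemma qpoch_nth_0: "d \<ge> 1 \<Longrightarrow> fps_nth (qpoch d K) 0 = 1"
  by (induction K) (auto simp: qpoch_Suc)

lemma qpoch_nonzero: "d \<ge> 1 \<Longrightarrow> qpoch d K \<noteq> 0"
  using qpoch_nth_0[of d K] by auto

lemma agree_qpoch:
  assumes "d \<ge> 1" "M \<le> K" "M \<le> K'"
  shows "agree M (qpoch d K) (qpoch d K')"
proof -
  have step: "agree M (qpoch d N) (qpoch d M)" if "M \<le> N" for N
    using that
  proof (induction N rule: dec_induct)
    case (step N)
    have "M < 1 * Suc N" using step(1) by simp
    also have "\<dots> \<le> d * Suc N" by (rule mult_le_mono1[OF assms(1)])
    finally have "M < d * Suc N" .
    then have "agree M (1 - fps_X ^ (d * Suc N)) 1"
      unfolding agree_def by (simp add: fps_X_power_nth del: mult_Suc_right)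
    then have "agree M (qpoch d N * (1 - fps_X ^ (d * Suc N))) (qpoch d M * 1)"
      using step by (intro agree_mult) auto
    then show ?case by (simp add: qpoch_Suc del: power_Suc mult_Suc_right)
  qed simp
  show ?thesis using step assms by (meson agree_sym agree_trans)
qed

lemma agree_qinf:
  assumes "d \<ge> 1"
  shows "agree M (qinf d) (qpoch d M)"
  unfolding agree_def
proof (intro allI impI)
  fix k assume "k < M"
  have "(\<lambda>m. 1 - fps_X ^ (d * Suc m) :: rat fps) has_prod qinf d" by (rule qinf_has_prod[OF assms])
  then have "qpoch d \<longlonglongrightarrow> qinf d"
    unfolding qpoch_def by (rule has_prod_imp_tendsto')
  then have "\<forall>\<^sub>F N in sequentially. fps_nth (qpoch d N) k = fps_nth (qinf d) k"
    unfolding tendsto_fps_iff by blast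
  then obtain N0 where N0: "\<And>N. N \<ge> N0 \<Longrightarrow> fps_nth (qpoch d N) k = fps_nth (qinf d) k"
    by (auto simp: eventually_sequentially)
  have "fps_nth (qinf d) k = fps_nth (qpoch d (max N0 M)) k"
    using N0[of "max N0 M"] by simp
  also have "\<dots> = fps_nth (qpoch d M) k"
    using agree_qpoch[OF assms, of M "max N0 M" M] \<open>k < M\<close> by (simp add: agree_def)
  finally show "fps_nth (qinf d) k = fps_nth (qpoch d M) k" .
qed

lemma qinf_nth_0: "d \<ge> 1 \<Longrightarrow> fps_nth (qinf d) 0 = 1"
  using agree_qinf[of d 1] by (simp add: agree_def qpoch_nth_0)

text \<open>
  Below degree \<open>M\<close> the factors $1 - q^{dm}$ with $m > M$ are invisible, so it
  suffices to invert the finite product.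
\<close>

lemma agree_inverse_qinf:
  assumes "d \<ge> 1" "agree M (f * qpoch d M) 1"
  shows "agree M (inverse (qinf d)) f"
proof -
  have "agree M (f * qinf d) 1"
    using agree_trans[OF agree_mult[OF agree_refl agree_qinf[OF assms(1)]] assms(2)] .
  moreover have "inverse (qinf d) * qinf d = 1"
    using qinf_nth_0[OF assms(1)] by (simp add: inverse_mult_eq_1)
  ultimately have "agree M (inverse (qinf d) * qinf d) (f * qinf d)"
    by (metis agree_sym)
  then show ?thesis by (rule agree_cancel) (simp add: qinf_nth_0[OF assms(1)])
qed

lemma support_subset:
  fixes M :: nat
  assumes "\<And>a. a > M \<Longrightarrow> p a = (0::nat)"
  shows "{a. p a \<noteq> 0} \<subseteq> {..M}"
proof
  fix a assume "a \<in> {a. p a \<noteq> 0}"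
  with assms[of a] show "a \<in> {..M}" by (cases "a > M") auto
qed

text \<open>
  A partition given by the multiplicities of its parts, where \<open>p a\<close> counts the parts
  $d(a + 1)$.
\<close>

definition part_mults :: "(nat \<Rightarrow> nat) set" where "part_mults = {p. finite {a. p a \<noteq> 0}}"
definition part_weight :: "nat \<Rightarrow> (nat \<Rightarrow> nat) \<Rightarrow> nat" where
  "part_weight d p = (\<Sum>a | p a \<noteq> 0. d * Suc a * p a)"

lemma part_weight_eq: "finite A \<Longrightarrow> {a. p a \<noteq> 0} \<subseteq> A \<Longrightarrow> part_weight d p = (\<Sum>a\<in>A. d * Suc a * p a)"
  unfolding part_weight_def by (intro sum.mono_neutral_left) auto

lemma has_gf_multiples:
  assumes "e \<ge> 1"
  shows "has_gf UNIV (\<lambda>c. e * c) (inverse (1 - fps_X ^ e))"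
proof -
  let ?f = "Abs_fps (\<lambda>m. if e dvd m then 1 else 0) :: rat fps"
  have "?f * (1 - fps_X ^ e) = 1"
  proof (rule fps_ext)
    fix k
    show "fps_nth (?f * (1 - fps_X ^ e)) k = fps_nth 1 k"
      using assms by (auto simp: right_diff_distrib fps_X_power_mult_right_nth dvd_minus_self dest: dvd_imp_le)
  qed
  then have f: "inverse (1 - fps_X ^ e) = ?f"
    by (metis fps_inverse_unique mult.commute)
  have *: "{a. e * a = m} = (if e dvd m then {m div e} else {})" for m using assms by auto
  show ?thesis unfolding has_gf_def f
    by (auto simp: *)
qed

text \<open>
  Euler's product, one geometric series for each admissible part.
\<close>

lemma has_gf_part_mults_bounded:
  assumes "d \<ge> 1"
  shows "has_gf {p. \<forall>a\<ge>M. p a = 0} (part_weight d) (inverse (qpoch d M))"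
proof (induction M)
  case 0
  have "{p. \<forall>a\<ge>0. p a = 0} = {\<lambda>_::nat. 0::nat}" by auto
  moreover have "has_gf {\<lambda>_::nat. 0::nat} (part_weight d) 1"
    by (rule has_gf_bij[OF has_gf_singleton[of "\<lambda>_::nat. 0::nat"], where h = id]) (auto simp: part_weight_def)
  ultimately show ?case by simp
next
  case (Suc M)
  let ?P = "\<lambda>M. {p :: nat \<Rightarrow> nat. \<forall>a\<ge>M. p a = 0}"
  have "has_gf (?P M \<times> UNIV) (\<lambda>(p, c). part_weight d p + (d * Suc M) * c)
      (inverse (qpoch d M) * inverse (1 - fps_X ^ (d * Suc M)))"
    using assms by (intro has_gf_Times Suc has_gf_multiples) auto
  moreover have "bij_betw (\<lambda>(p, c). p(M := c)) (?P M \<times> UNIV) (?P (Suc M))"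
    by (rule bij_betw_byWitness[where f' = "\<lambda>p. (p(M := 0), p M)"]) (auto simp: fun_eq_iff le_Suc_eq)
  moreover have "part_weight d (p(M := c)) = part_weight d p + (d * Suc M) * c" if "p \<in> ?P M" for p c
  proof -
    have p0: "p a = 0" if "a \<ge> M" for a using \<open>p \<in> ?P M\<close> that by auto
    have sub: "{a. (p(M := c)) a \<noteq> 0} \<subseteq> {..M}" "{a. p a \<noteq> 0} \<subseteq> {..M}"
      by (rule support_subset; simp add: p0)+
    have "part_weight d (p(M := c)) = (\<Sum>a\<le>M. d * Suc a * (p(M := c)) a)"
      "part_weight d p = (\<Sum>a\<le>M. d * Suc a * p a)"
      by (rule part_weight_eq[OF finite_atMost sub(1)], rule part_weight_eq[OF finite_atMost sub(2)])
    moreover have "p M = 0" using that by auto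
    ultimately show ?thesis by (simp flip: lessThan_Suc_atMost)
  qed
  ultimately have "has_gf (?P (Suc M)) (part_weight d) (inverse (qpoch d M) * inverse (1 - fps_X ^ (d * Suc M)))"
    by (elim has_gf_bij) auto
  then show ?case by (simp only: qpoch_Suc fps_inverse_mult)
qed

lemma has_gf_part_mults:
  assumes "d \<ge> 1"
  shows "has_gf part_mults (part_weight d) (inverse (qinf d))"
proof (rule has_gf_truncated)
  fix M
  let ?B = "{p :: nat \<Rightarrow> nat. \<forall>a\<ge>M. p a = 0}"
  have 1: "p a = 0" if "p \<in> part_mults" "part_weight d p < M" "a \<ge> M" for p a
  proof (rule ccontr)
    assume "p a \<noteq> 0"
    then have "d * Suc a * p a \<le> part_weight d p"
      unfolding part_weight_def using that(1) by (intro member_le_sum) (auto simp: part_mults_def)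
    moreover have "a < 1 * Suc a * 1" by simp
    moreover have "1 * Suc a * 1 \<le> d * Suc a * p a"
      using assms \<open>p a \<noteq> 0\<close> by (intro mult_le_mono) auto
    ultimately have "a < part_weight d p" by (meson less_le_trans)
    then show False using that by simp
  qed
  have 2: "p \<in> part_mults" if "p \<in> ?B" for p
  proof -
    have "{a. p a \<noteq> 0} \<subseteq> {..M}" by (rule support_subset) (use that in auto)
    then show ?thesis by (auto simp: part_mults_def intro: finite_subset)
  qed
  have "{p \<in> part_mults. part_weight d p < M} = {p \<in> ?B. part_weight d p < M}"
    using 1 2 by auto
  moreover have "agree M (inverse (qinf d)) (inverse (qpoch d M))"
    by (rule agree_inverse_qinf[OF assms]) (simp add: inverse_mult_eq_1 qpoch_nth_0[OF assms])
  ultimately show "\<exists>B f'. has_gf B (part_weight d) f' \<and> {p \<in> part_mults. part_weight d p < M} = {p \<in> B. part_weight d p < M}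
      \<and> agree M (inverse (qinf d)) f'"
    using has_gf_part_mults_bounded[OF assms, of M] by blast
qed

section \<open>Frobenius coordinates and the q-binomial coefficients\<close>

lemma has_gf_Un:
  assumes "has_gf A w f" "has_gf B w g" "A \<inter> B = {}"
  shows "has_gf (A \<union> B) w (f + g)"
  unfolding has_gf_def
proof
  fix m
  have "{a \<in> A \<union> B. w a = m} = {a \<in> A. w a = m} \<union> {a \<in> B. w a = m}" by auto
  moreover have "{a \<in> A. w a = m} \<inter> {a \<in> B. w a = m} = {}" using assms(3) by auto
  ultimately show "finite {a \<in> A \<union> B. w a = m} \<and>
      fps_nth (f + g) m = of_nat (card {a \<in> A \<union> B. w a = m})"
    using assms(1,2) by (simp add: has_gf_def card_Un_disjoint)
qed

lemma has_gf_shift: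
  assumes "has_gf A w f" and bij: "bij_betw h A B" and w: "\<And>a. a \<in> A \<Longrightarrow> v (h a) = w a + e"
  shows "has_gf B v (fps_X ^ e * f)"
proof -
  have "has_gf A (\<lambda>a. w a + e) (fps_X ^ e * f)"
    unfolding has_gf_def
  proof
    fix m
    have "{a \<in> A. w a + e = m} = (if m < e then {} else {a \<in> A. w a = m - e})" by auto
    then show "finite {a \<in> A. w a + e = m} \<and>
        fps_nth (fps_X ^ e * f) m = of_nat (card {a \<in> A. w a + e = m})"
      using assms(1) by (simp add: has_gf_def fps_X_power_mult_nth)
  qed
  then show ?thesis by (rule has_gf_bij[OF _ bij]) (rule w)
qed

text \<open>
  The Gaussian binomial coefficients, through their Pascal recursion.
\<close>

fun qbin :: "nat \<Rightarrow> nat \<Rightarrow> rat fps" where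
  "qbin n 0 = 1"
| "qbin 0 (Suc k) = 0"
| "qbin (Suc n) (Suc k) = qbin n k + fps_X ^ Suc k * qbin n (Suc k)"

lemma qbin_eq_0: "n < k \<Longrightarrow> qbin n k = 0"
  by (induction n k rule: qbin.induct) auto

lemma qbin_self: "qbin n n = 1"
  by (induction n) (auto simp: qbin_eq_0)

lemma qbin_qpoch: "qbin (a + b) a * qpoch 1 a * qpoch 1 b = qpoch 1 (a + b)"
proof (induction a arbitrary: b)
  case (Suc a)
  note IHa = Suc.IH
  show ?case
  proof (induction b)
    case 0
    show ?case by (simp add: qbin_self del: qbin.simps)
  next
    case (Suc b)
    let ?N = "Suc a + b" and ?X = "fps_X :: rat fps"
    have 1: "qbin ?N a * qpoch 1 a * qpoch 1 (Suc b) = qpoch 1 ?N"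
      using IHa[of "Suc b"] by simp
    have 2: "qbin ?N (Suc a) * qpoch 1 (Suc a) * qpoch 1 b = qpoch 1 ?N"
      by (rule Suc)
    have qs: "qpoch 1 (Suc k) = qpoch 1 k * (1 - ?X ^ Suc k)" for k
      by (simp add: qpoch_Suc)
    have "qbin (Suc a + Suc b) (Suc a) * qpoch 1 (Suc a) * qpoch 1 (Suc b)
        = (qbin ?N a + ?X ^ Suc a * qbin ?N (Suc a)) * qpoch 1 (Suc a) * qpoch 1 (Suc b)"
      by simp
    also have "\<dots> = (qbin ?N a * qpoch 1 a * qpoch 1 (Suc b)) * (1 - ?X ^ Suc a)
        + ?X ^ Suc a * ((qbin ?N (Suc a) * qpoch 1 (Suc a) * qpoch 1 b) * (1 - ?X ^ Suc b))"
      by (subst (2) qs[of b], subst qs[of a]) (simp only: algebra_simps qs)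
    also have "\<dots> = qpoch 1 ?N * (1 - ?X ^ Suc a * ?X ^ Suc b)"
      unfolding 1 2 by (simp only: algebra_simps mult_1)
    also have "\<dots> = qpoch 1 (Suc ?N)"
      by (simp only: qs power_add [symmetric]) simp
    finally show ?case by simp
  qed
qed simp

text \<open>
  The mirrored Pascal recursion, obtained by cancelling in the product formula.
\<close>

lemma qbin_Suc_Suc':
  assumes "k \<le> n"
  shows "qbin (Suc n) (Suc k) = qbin n (Suc k) + fps_X ^ (n - k) * qbin n k"
proof -
  obtain b where n: "n = k + b" using assms le_Suc_ex by blast
  show ?thesis
  proof (cases b)
    case 0
    then show ?thesis using n by (simp only: qbin_self qbin_eq_0) (simp add: qbin_eq_0 qbin_self)
  next
    case (Suc b')
    let ?X = "fps_X :: rat fps" and ?D = "qpoch 1"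
    have qs: "?D (Suc k) = ?D k * (1 - ?X ^ Suc k)" for k
      by (simp add: qpoch_Suc)
    have N: "Suc k + b' = n" using n Suc by simp
    have 1: "qbin n (Suc k) * ?D (Suc k) * ?D b' = ?D n"
      using qbin_qpoch[of "Suc k" b'] unfolding N .
    have 2: "qbin n k * ?D k * ?D b = ?D n"
      using qbin_qpoch[of k b] unfolding n .
    have 3: "qbin (Suc n) (Suc k) * ?D (Suc k) * ?D b = ?D (Suc n)"
      using qbin_qpoch[of "Suc k" b] unfolding n by simp
    have "(qbin n (Suc k) + ?X ^ b * qbin n k) * ?D (Suc k) * ?D b
        = (qbin n (Suc k) * ?D (Suc k) * ?D b') * (1 - ?X ^ b)
          + ?X ^ b * ((qbin n k * ?D k * ?D b) * (1 - ?X ^ Suc k))"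
      unfolding Suc by (simp only: qs algebra_simps)
    also have "\<dots> = ?D n * (1 - ?X ^ b * ?X ^ Suc k)"
      unfolding 1 2 by (simp only: algebra_simps mult_1)
    also have "\<dots> = ?D (Suc n)"
      by (simp only: qs power_add [symmetric] n) (simp add: add.commute)
    finally have "(qbin n (Suc k) + ?X ^ b * qbin n k) * (?D (Suc k) * ?D b)
        = qbin (Suc n) (Suc k) * (?D (Suc k) * ?D b)" using 3 by (simp only: mult.assoc)
    moreover have "?D (Suc k) * ?D b \<noteq> 0" by (simp add: qpoch_nonzero)
    ultimately show ?thesis using n by (metis add_diff_cancel_left' mult_right_cancel)
  qed
qed

text \<open>
  Frobenius coordinates: a partition with \<open>k\<close> boxes on the diagonal of its diagram
  corresponds to the sets of arm and leg lengths of these boxes, and its size is the weight below.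
\<close>

definition frob_pairs :: "(nat set \<times> nat set) set" where
  "frob_pairs = {(S, T). finite S \<and> finite T \<and> card S = card T}"

text \<open>
  Bounded sets with a prescribed excess \<open>c\<close>. The excess has to vary because adding an
  element to \<open>T\<close> changes it.
\<close>

definition frob_pairs_in :: "nat \<Rightarrow> nat \<Rightarrow> nat \<Rightarrow> (nat set \<times> nat set) set" where
  "frob_pairs_in A B c = {(S, T). S \<subseteq> {..<A} \<and> T \<subseteq> {..<B} \<and> card S = card T + c}"

definition frob_weight :: "nat set \<times> nat set \<Rightarrow> nat" where
  "frob_weight = (\<lambda>(S, T). (\<Sum>a\<in>S. Suc a) + \<Sum>T)"

definition triangular :: "nat \<Rightarrow> nat" where "triangular c = (\<Sum>i\<le>c. i)"

lemma triangular_simps [simp]: "triangular 0 = 0" "triangular (Suc c) = triangular c + Suc c"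
  by (simp_all add: triangular_def)

lemma frob_pairs_in_fst_Suc:
  "frob_pairs_in (Suc A) 0 (Suc c) =
     frob_pairs_in A 0 (Suc c) \<union> (\<lambda>(S, T). (insert A S, T)) ` frob_pairs_in A 0 c" (is "?l = ?r \<union> ?i")
proof
  show "?l \<subseteq> ?r \<union> ?i"
  proof
    fix x assume "x \<in> ?l"
    then obtain S where x: "x = (S, {})" and S: "S \<subseteq> {..<Suc A}" "card S = Suc c"
      by (auto simp: frob_pairs_in_def)
    show "x \<in> ?r \<union> ?i"
    proof (cases "A \<in> S")
      case True
      then have "x = (\<lambda>(S, T). (insert A S, T)) (S - {A}, {})" using x by auto
      moreover have "(S - {A}, {}) \<in> frob_pairs_in A 0 c"
        using S True finite_subset[OF S(1)] by (auto simp: frob_pairs_in_def less_Suc_eq)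
      ultimately show ?thesis by blast
    next
      case False
      then have "S \<subseteq> {..<A}" using S(1) by (force simp: less_Suc_eq)
      then show ?thesis using x S(2) by (auto simp: frob_pairs_in_def)
    qed
  qed
  have "card (insert A S) = Suc (card S)" if "S \<subseteq> {..<A}" for S
    using that finite_subset[OF that] by (subst card_insert_disjoint) auto
  then show "?r \<union> ?i \<subseteq> ?l"
    by (auto simp: frob_pairs_in_def)
qed

lemma frob_pairs_in_snd_Suc:
  "frob_pairs_in A (Suc B) c =
     frob_pairs_in A B c \<union> (\<lambda>(S, T). (S, insert B T)) ` frob_pairs_in A B (Suc c)" (is "?l = ?r \<union> ?i")
proof
  show "?l \<subseteq> ?r \<union> ?i"
  proof
    fix x assume "x \<in> ?l"
    obtain S T where x: "x = (S, T)" by (cases x)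
    have S: "S \<subseteq> {..<A}" "T \<subseteq> {..<Suc B}" "card S = card T + c"
      using \<open>x \<in> ?l\<close> unfolding x frob_pairs_in_def mem_Collect_eq split by blast+
    show "x \<in> ?r \<union> ?i"
    proof (cases "B \<in> T")
      case True
      have "card T = Suc (card (T - {B}))"
        by (rule card.remove[OF finite_subset[OF S(2) finite_lessThan] True])
      then have "(S, T - {B}) \<in> frob_pairs_in A B (Suc c)"
        using S True by (auto simp: frob_pairs_in_def less_Suc_eq)
      moreover have "x = (\<lambda>(S, T). (S, insert B T)) (S, T - {B})" using x True by auto
      ultimately show ?thesis by blast
    next
      case False
      then have "T \<subseteq> {..<B}" using S(2) by (force simp: less_Suc_eq)
      then show ?thesis using x S by (auto simp: frob_pairs_in_def)
    qed
  qed
  have "card (insert B T) = Suc (card T)" if "T \<subseteq> {..<B}" for T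
    using that finite_subset[OF that] by (subst card_insert_disjoint) auto
  then show "?r \<union> ?i \<subseteq> ?l"
    by (auto simp: frob_pairs_in_def)
qed

text \<open>
  Without \<open>T\<close> this is the q-binomial theorem: whether \<open>A\<close> belongs to
  \<open>S\<close> gives the mirrored Pascal recursion.
\<close>

lemma has_gf_frob_pairs_in_0: "has_gf (frob_pairs_in A 0 c) frob_weight (fps_X ^ triangular c * qbin A c)"
proof (induction A arbitrary: c)
  case 0
  show ?case
  proof (cases c)
    case 0
    have "frob_pairs_in 0 0 0 = {({}, {})}" by (auto simp: frob_pairs_in_def)
    moreover have "has_gf {({}, {})} frob_weight 1"
      by (rule has_gf_bij[OF has_gf_singleton[of "({}, {})"], where h = id]) (auto simp: frob_weight_def)
    ultimately show ?thesis using 0 by simp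
  next
    case (Suc c')
    then have "frob_pairs_in 0 0 c = {}" by (auto simp: frob_pairs_in_def)
    then show ?thesis using Suc by (simp add: has_gf_def)
  qed
next
  case (Suc A)
  show ?case
  proof (cases c)
    case 0
    have "frob_pairs_in (Suc A) 0 0 = frob_pairs_in A 0 0"
      by (auto simp: frob_pairs_in_def dest: finite_subset)
    then show ?thesis using Suc[of 0] 0 by simp
  next
    case (Suc c')
    let ?h = "\<lambda>(S, T::nat set). (insert A S, T)"
    have notin: "A \<notin> S" if "(S, T) \<in> frob_pairs_in A 0 k" for S T k
      using that by (auto simp: frob_pairs_in_def)
    have bij: "bij_betw ?h (frob_pairs_in A 0 c') (?h ` frob_pairs_in A 0 c')"
      unfolding bij_betw_def
      by (auto intro!: inj_onI dest!: notin)
    have wt: "frob_weight (?h x) = frob_weight x + Suc A" if "x \<in> frob_pairs_in A 0 c'" for x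
    proof -
      obtain S T where x: "x = (S, T)" by fastforce
      have "A \<notin> S" "finite S" using that x by (auto simp: frob_pairs_in_def dest: finite_subset)
      then show ?thesis by (simp add: x frob_weight_def)
    qed
    have "has_gf (?h ` frob_pairs_in A 0 c') frob_weight (fps_X ^ Suc A * (fps_X ^ triangular c' * qbin A c'))"
      by (rule has_gf_shift[OF Suc.IH bij wt])
    moreover have "has_gf (frob_pairs_in A 0 (Suc c')) frob_weight (fps_X ^ triangular (Suc c') * qbin A (Suc c'))"
      by (rule Suc.IH)
    moreover have "frob_pairs_in A 0 (Suc c') \<inter> ?h ` frob_pairs_in A 0 c' = {}"
      by (auto dest: notin)
    ultimately have "has_gf (frob_pairs_in (Suc A) 0 (Suc c')) frob_weight
        (fps_X ^ triangular (Suc c') * qbin A (Suc c') + fps_X ^ Suc A * (fps_X ^ triangular c' * qbin A c'))"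
      unfolding frob_pairs_in_fst_Suc by (intro has_gf_Un)
    moreover have "fps_X ^ triangular (Suc c') * qbin A (Suc c') + fps_X ^ Suc A * (fps_X ^ triangular c' * qbin A c')
        = fps_X ^ triangular (Suc c') * qbin (Suc A) (Suc c')"
    proof (cases "c' \<le> A")
      case True
      have e: "triangular c' + Suc c' + (A - c') = Suc A + triangular c'" using True by simp
      have "fps_X ^ triangular (Suc c') * qbin (Suc A) (Suc c')
          = fps_X ^ triangular (Suc c') * qbin A (Suc c') + fps_X ^ (triangular c' + Suc c' + (A - c')) * qbin A c'"
        unfolding qbin_Suc_Suc'[OF True] by (simp only: triangular_simps distrib_left power_add mult.assoc)
      then show ?thesis unfolding e by (simp only: power_add mult.assoc)
    next
      case False
      then show ?thesis by (simp add: qbin_eq_0)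
    qed
    ultimately show ?thesis using Suc by simp
  qed
qed

text \<open>
  Whether \<open>B\<close> belongs to \<open>T\<close> gives the Pascal recursion in the row
  \<open>A + B\<close>, since the exponents of the prefactors for the excesses \<open>c\<close>
  and \<open>Suc c\<close> differ by \<open>Suc c\<close>.
\<close>

lemma has_gf_frob_pairs_in: "has_gf (frob_pairs_in A B c) frob_weight (fps_X ^ triangular c * qbin (A + B) (B + c))"
proof (induction B arbitrary: c)
  case 0
  show ?case using has_gf_frob_pairs_in_0 by simp
next
  case (Suc B)
  let ?h = "\<lambda>(S::nat set, T). (S, insert B T)"
  have notin: "B \<notin> T" if "(S, T) \<in> frob_pairs_in A B k" for S T k
    using that by (auto simp: frob_pairs_in_def)
  have bij: "bij_betw ?h (frob_pairs_in A B (Suc c)) (?h ` frob_pairs_in A B (Suc c))"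
    unfolding bij_betw_def
    by (auto intro!: inj_onI dest!: notin)
  have wt: "frob_weight (?h x) = frob_weight x + B" if "x \<in> frob_pairs_in A B (Suc c)" for x
  proof -
    obtain S T where x: "x = (S, T)" by fastforce
    have "B \<notin> T" "finite T" using that x by (auto simp: frob_pairs_in_def dest: finite_subset)
    then show ?thesis by (simp add: x frob_weight_def)
  qed
  have "has_gf (?h ` frob_pairs_in A B (Suc c)) frob_weight
      (fps_X ^ B * (fps_X ^ triangular (Suc c) * qbin (A + B) (B + Suc c)))"
    by (rule has_gf_shift[OF Suc.IH bij wt])
  moreover have "frob_pairs_in A B c \<inter> ?h ` frob_pairs_in A B (Suc c) = {}"
    by (auto dest: notin)
  ultimately have "has_gf (frob_pairs_in A (Suc B) c) frob_weight
      (fps_X ^ triangular c * qbin (A + B) (B + c) + fps_X ^ B * (fps_X ^ triangular (Suc c) * qbin (A + B) (B + Suc c)))"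
    unfolding frob_pairs_in_snd_Suc by (intro has_gf_Un Suc.IH)
  also have "fps_X ^ triangular c * qbin (A + B) (B + c) + fps_X ^ B * (fps_X ^ triangular (Suc c) * qbin (A + B) (B + Suc c))
      = fps_X ^ triangular c * qbin (A + Suc B) (Suc B + c)"
    by (simp add: power_add algebra_simps)
  finally show ?case .
qed

text \<open>
  Let the bounds tend to infinity: the central q-binomial coefficient times $(q)_M$ is the
  quotient of $(q)_{2M}$ by $(q)_M$, which is \<open>1\<close> below degree \<open>M\<close>.
\<close>

lemma has_gf_frob_pairs: "has_gf frob_pairs frob_weight (inverse (qinf 1))"
proof (rule has_gf_truncated)
  fix M
  have bound: "S \<subseteq> {..<M} \<and> T \<subseteq> {..<M}" if x: "(S, T) \<in> frob_pairs" "frob_weight (S, T) < M" for S T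
  proof -
    have fin: "finite S" "finite T" and card: "card S = card T" using x by (auto simp: frob_pairs_def)
    have S: "Suc a \<le> (\<Sum>a\<in>S. Suc a)" if "a \<in> S" for a
      using that fin by (intro member_le_sum) auto
    have T: "a \<le> \<Sum>T" if "a \<in> T" for a
      using that fin by (intro member_le_sum) auto
    have "frob_weight (S, T) = (\<Sum>a\<in>S. Suc a) + \<Sum>T" by (simp only: frob_weight_def split)
    then have "a < M" if "a \<in> S \<or> a \<in> T" for a
      using that S[of a] T[of a] x(2) by linarith
    then show ?thesis by blast
  qed
  have "{x \<in> frob_pairs. frob_weight x < M} = {x \<in> frob_pairs_in M M 0. frob_weight x < M}"
    using bound by (auto simp: frob_pairs_def frob_pairs_in_def dest: finite_subset)
  moreover have "agree M (inverse (qinf 1)) (qbin (M + M) M)"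
  proof (rule agree_inverse_qinf)
    have "agree M (qpoch 1 (M + M)) (qpoch 1 M)" by (rule agree_qpoch) auto
    then have "agree M (qbin (M + M) M * qpoch 1 M * qpoch 1 M) (1 * qpoch 1 M)"
      by (simp only: qbin_qpoch mult_1)
    then show "agree M (qbin (M + M) M * qpoch 1 M) 1"
      by (rule agree_cancel) (simp add: qpoch_nth_0)
  qed simp
  moreover have "has_gf (frob_pairs_in M M 0) frob_weight (qbin (M + M) M)"
    using has_gf_frob_pairs_in[of M M 0] by simp
  ultimately show "\<exists>B f'. has_gf B frob_weight f' \<and>
      {x \<in> frob_pairs. frob_weight x < M} = {x \<in> B. frob_weight x < M} \<and> agree M (inverse (qinf 1)) f'"
    by blast
qed

section \<open>Proper Young walls as full tops and runs\<close>

definition started :: "place set \<Rightarrow> nat \<Rightarrow> nat \<Rightarrow> bool" where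
  "started Y k h \<longleftrightarrow> (\<exists>p. (k, h, p) \<in> Y)"

definition split_floor :: "affine_type \<Rightarrow> nat \<Rightarrow> nat \<Rightarrow> bool" where
  "split_floor X \<Lambda> h \<longleftrightarrow> positions (floor_at X \<Lambda> h) = {PosA, PosB}"

lemma positions_cases:
  "positions (floor_at X \<Lambda> h) = (if split_floor X \<Lambda> h then {PosA, PosB} else {Whole})"
  by (cases "floor_at X \<Lambda> h") (auto simp: split_floor_def)

lemma initial_segment:
  assumes "finite K" "\<And>k. k \<in> K \<Longrightarrow> 1 \<le> k" "\<And>k. 1 \<le> k \<Longrightarrow> Suc k \<in> K \<Longrightarrow> k \<in> K"
  shows "K = {1..card K}"
proof (cases "K = {}")
  case False
  have down: "m \<in> K" if "k \<in> K" "1 \<le> m" "m \<le> k" for m k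
    using that(3,1,2)
  proof (induction rule: inc_induct)
    case (step n)
    then show ?case using assms(3)[of n] by simp
  qed
  have "K = {1..Max K}"
  proof (rule set_eqI)
    fix m show "m \<in> K \<longleftrightarrow> m \<in> {1..Max K}"
      using assms(1,2) down[OF Max_in[OF assms(1) False], of m] Max_ge[OF assms(1), of m] by auto
  qed
  then show ?thesis by (metis card_atLeastAtMost diff_Suc_1)
qed simp

lemma young_wall_heights:
  assumes "young_wall X \<Lambda> Y" "1 \<le> k"
  shows "{h. started Y k h} = {..<height Y k}" and "1 \<le> height Y k"
proof -
  \<comment> \<open>Floors are numbered from \<open>0\<close>, but initial segments start at \<open>1\<close>.\<close>
  let ?K = "Suc ` {h. started Y k h}"
  have "{h. started Y k h} \<subseteq> insert 0 ((fst \<circ> snd) ` (Y - ground))"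
    by (force simp: started_def ground_def image_iff)
  then have fin: "finite {h. started Y k h}"
    using assms(1) by (auto simp: young_wall_def intro: finite_subset)
  have "?K = {1..card ?K}"
  proof (rule initial_segment)
    fix h assume "1 \<le> h" "Suc h \<in> ?K"
    then obtain h' where h': "h = Suc h'" "started Y k (Suc h')" by (cases h) auto
    then have "floor_filled X \<Lambda> Y k h'"
      using assms(1) by (auto simp: young_wall_def started_def)
    then have "started Y k h'"
      by (auto simp: floor_filled_def started_def positions_cases split: if_splits)
    then show "h \<in> ?K" using h'(1) by auto
  qed (use fin in auto)
  moreover have c: "card ?K = height Y k"
    by (simp add: card_image height_def started_def)
  ultimately have K: "?K = {1..height Y k}" by simp
  have "started Y k h \<longleftrightarrow> h < height Y k" for h
  proof -
    have "started Y k h \<longleftrightarrow> Suc h \<in> ?K" by auto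
    then show ?thesis unfolding K by auto
  qed
  then show H: "{h. started Y k h} = {..<height Y k}" by auto
  have "started Y k 0"
  proof -
    have "(k, 0, PosA) \<in> ground" using assms(2) by (simp add: ground_def)
    then show ?thesis using assms(1) unfolding young_wall_def started_def by blast
  qed
  then have "0 \<in> {..<height Y k}" using H by blast
  then show "1 \<le> height Y k" by simp
qed

text \<open>
  The top floor of a column is the one that is started while the next one is not, so properness
  can be read off floor by floor without mentioning heights.
\<close>

lemma proper_iff:
  assumes Y: "young_wall X \<Lambda> Y"
  shows "proper X \<Lambda> Y \<longleftrightarrow>
    (\<forall>h k k'. 1 \<le> k \<and> 1 \<le> k' \<and> floor_filled X \<Lambda> Y k h \<and> \<not> started Y k (Suc h) \<and>
        floor_filled X \<Lambda> Y k' h \<and> \<not> started Y k' (Suc h) \<longrightarrow> k = k')"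
proof -
  have top: "full X \<Lambda> Y k \<and> height Y k = Suc h \<longleftrightarrow> floor_filled X \<Lambda> Y k h \<and> \<not> started Y k (Suc h)"
    if "1 \<le> k" for k h
  proof -
    have st: "started Y k h' \<longleftrightarrow> h' < height Y k" for h'
      using young_wall_heights(1)[OF Y that] by auto
    have "floor_filled X \<Lambda> Y k h \<Longrightarrow> started Y k h"
      by (auto simp: floor_filled_def started_def positions_cases split: if_splits)
    moreover have "height Y k = Suc h \<longleftrightarrow> started Y k h \<and> \<not> started Y k (Suc h)"
      unfolding st by auto
    ultimately show ?thesis by (auto simp: full_def)
  qed
  have hS: "\<exists>h. height Y k = Suc h" if "1 \<le> k" for k
    using young_wall_heights(2)[OF Y that] by (cases "height Y k") auto
  show ?thesis
  proof
    assume "proper X \<Lambda> Y"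
    then have "\<forall>k\<ge>1. \<forall>k'\<ge>1. full X \<Lambda> Y k \<and> full X \<Lambda> Y k' \<and> height Y k = height Y k' \<longrightarrow> k = k'"
      by (simp add: proper_def)
    then show "\<forall>h k k'. 1 \<le> k \<and> 1 \<le> k' \<and> floor_filled X \<Lambda> Y k h \<and> \<not> started Y k (Suc h) \<and>
        floor_filled X \<Lambda> Y k' h \<and> \<not> started Y k' (Suc h) \<longrightarrow> k = k'"
      using top by metis
  next
    assume "\<forall>h k k'. 1 \<le> k \<and> 1 \<le> k' \<and> floor_filled X \<Lambda> Y k h \<and> \<not> started Y k (Suc h) \<and>
        floor_filled X \<Lambda> Y k' h \<and> \<not> started Y k' (Suc h) \<longrightarrow> k = k'"
    then have "k = k'" if "1 \<le> k" "1 \<le> k'" "full X \<Lambda> Y k" "full X \<Lambda> Y k'" "height Y k = height Y k'" for k k'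
      using that top hS by metis
    then show "proper X \<Lambda> Y" using Y by (auto simp: proper_def)
  qed
qed

text \<open>
  The number of columns whose floor \<open>h\<close> is completely filled, in terms of the set
  \<open>F\<close> of tops of full columns and the run lengths \<open>r\<close>: these are the
  columns that end higher, or at \<open>h\<close> with a full top.
\<close>

definition filled_cols :: "nat set \<Rightarrow> (nat \<Rightarrow> nat) \<Rightarrow> nat \<Rightarrow> nat" where
  "filled_cols F r h = card (F \<inter> {h..}) + (\<Sum>h' | h < h' \<and> r h' \<noteq> 0. r h')"

text \<open>
  The position of the half blocks in the run on floor \<open>h\<close>. The run starts in column
  \<open>filled_cols F r h + 1\<close>, and \<open>h \<in> Q\<close> means that its first color is
  the one of position B in odd columns.
\<close>

definition run_side :: "nat set \<Rightarrow> (nat \<Rightarrow> nat) \<Rightarrow> nat set \<Rightarrow> nat \<Rightarrow> position" where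
  "run_side F r Q h = (if even (filled_cols F r h) \<longleftrightarrow> h \<notin> Q then PosA else PosB)"

definition wall_of :: "affine_type \<Rightarrow> nat \<Rightarrow> nat set \<times> (nat \<Rightarrow> nat) \<times> nat set \<Rightarrow> place set" where
  "wall_of X \<Lambda> = (\<lambda>(F, r, Q).
     {(k, h, p). 1 \<le> k \<and> p \<in> positions (floor_at X \<Lambda> h) \<and>
        (k \<le> filled_cols F r h \<or>
         k \<le> filled_cols F r h + r h \<and> p = run_side F r Q h \<or>
         h = 0 \<and> p = PosA)})"

text \<open>
  \<open>Q\<close> is restricted to nonempty runs, so that the data is determined by the wall.
\<close>

definition wall_data :: "affine_type \<Rightarrow> nat \<Rightarrow> (nat set \<times> (nat \<Rightarrow> nat) \<times> nat set) set" where
  "wall_data X \<Lambda> = {(F, r, Q). finite F \<and> finite {h. r h \<noteq> 0} \<and>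
     (\<forall>h. r h \<noteq> 0 \<longrightarrow> 1 \<le> h \<and> split_floor X \<Lambda> h) \<and> Q \<subseteq> {h. r h \<noteq> 0}}"

lemma filled_cols_Suc:
  assumes "finite F" "finite {h. r h \<noteq> 0}"
  shows "filled_cols F r h = filled_cols F r (Suc h) + r (Suc h) + of_bool (h \<in> F)"
proof -
  have "F \<inter> {h..} = (if h \<in> F then insert h (F \<inter> {Suc h..}) else F \<inter> {Suc h..})"
    by (auto simp: Suc_le_eq order.order_iff_strict)
  then have 1: "card (F \<inter> {h..}) = card (F \<inter> {Suc h..}) + of_bool (h \<in> F)"
    using assms(1) by simp
  have fin: "finite {h'. Suc h < h' \<and> r h' \<noteq> 0}"
    using assms(2) by (rule rev_finite_subset) auto
  have "{h'. h < h' \<and> r h' \<noteq> 0} = {h'. Suc h < h' \<and> r h' \<noteq> 0} \<union> (if r (Suc h) = 0 then {} else {Suc h})"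
  proof (intro set_eqI)
    fix x
    show "x \<in> {h'. h < h' \<and> r h' \<noteq> 0} \<longleftrightarrow>
        x \<in> {h'. Suc h < h' \<and> r h' \<noteq> 0} \<union> (if r (Suc h) = 0 then {} else {Suc h})"
      by (cases "x = Suc h") auto
  qed
  then have 2: "(\<Sum>h' | h < h' \<and> r h' \<noteq> 0. r h') = (\<Sum>h' | Suc h < h' \<and> r h' \<noteq> 0. r h') + r (Suc h)"
    using fin by simp
  show ?thesis unfolding filled_cols_def 1 2 by simp
qed

lemma filled_cols_bound:
  assumes "finite F" "finite {h. r h \<noteq> 0}"
  obtains H where "\<And>h. h \<ge> H \<Longrightarrow> filled_cols F r h = 0" "\<And>h. h \<ge> H \<Longrightarrow> r h = 0"
proof -
  define H where "H = Suc (Max (insert 0 (F \<union> {h. r h \<noteq> 0})))"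
  have bd: "h < H" if "h \<in> F \<or> r h \<noteq> 0" for h
    using that assms unfolding H_def less_Suc_eq_le by (intro Max_ge) auto
  then have r: "r h = 0" if "h \<ge> H" for h using that by (meson linorder_not_less)
  moreover have "filled_cols F r h = 0" if "h \<ge> H" for h
  proof -
    have "F \<inter> {h..} = {}" using bd that by force
    moreover have "{h'. h < h' \<and> r h' \<noteq> 0} = {}" using bd that by force
    ultimately show ?thesis by (simp add: filled_cols_def)
  qed
  ultimately show ?thesis using that by blast
qed

lemma filled_cols_antimono:
  assumes "finite F" "finite {h. r h \<noteq> 0}" "h \<le> h'"
  shows "filled_cols F r h' \<le> filled_cols F r h"
  using assms(3)
proof (induction h' rule: dec_induct)
  case (step n)
  then show ?case using filled_cols_Suc[OF assms(1,2), of n] by linarith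
qed simp

context
  fixes X :: affine_type and \<Lambda> :: nat and F :: "nat set" and r :: "nat \<Rightarrow> nat" and Q :: "nat set"
  assumes split_0: "split_floor X \<Lambda> 0"
    and data: "(F, r, Q) \<in> wall_data X \<Lambda>"
begin

lemma wall_data_finite: "finite F" "finite {h. r h \<noteq> 0}" and run_bottom: "r 0 = 0"
  and run_cube: "\<And>h. \<not> split_floor X \<Lambda> h \<Longrightarrow> r h = 0"
  using data by (auto simp: wall_data_def)

lemma started_wall_of:
  assumes "1 \<le> k" "1 \<le> h"
  shows "started (wall_of X \<Lambda> (F, r, Q)) k h \<longleftrightarrow> k \<le> filled_cols F r h + r h"
  using assms run_cube[of h]
  by (auto simp: started_def wall_of_def positions_cases run_side_def)

lemma filled_wall_of:
  assumes "1 \<le> k"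
  shows "floor_filled X \<Lambda> (wall_of X \<Lambda> (F, r, Q)) k h \<longleftrightarrow> k \<le> filled_cols F r h"
  using assms run_cube[of h] run_bottom split_0
  by (auto simp: floor_filled_def wall_of_def positions_cases run_side_def split: if_splits)

lemma young_wall_wall_of: "young_wall X \<Lambda> (wall_of X \<Lambda> (F, r, Q))"
proof -
  let ?Y = "wall_of X \<Lambda> (F, r, Q)" and ?V = "filled_cols F r"
  obtain H where H: "\<And>h. h \<ge> H \<Longrightarrow> ?V h = 0" "\<And>h. h \<ge> H \<Longrightarrow> r h = 0"
    using filled_cols_bound[OF wall_data_finite] by blast
  have V: "?V h = ?V (Suc h) + r (Suc h) + of_bool (h \<in> F)" for h
    by (rule filled_cols_Suc[OF wall_data_finite])
  have le: "?V h + r h \<le> ?V 0" for h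
  proof (cases h)
    case (Suc h')
    then show ?thesis using V[of h'] filled_cols_antimono[OF wall_data_finite, of 0 h'] by simp
  qed (use run_bottom in simp)
  have "?Y - ground \<subseteq> {..?V 0} \<times> {..<H} \<times> {Whole, PosA, PosB}"
  proof (rule subsetI)
    fix b assume b: "b \<in> ?Y - ground"
    obtain k h p where bk: "b = (k, h, p)" by (cases b) auto
    have k: "1 \<le> k" "k \<le> ?V h + r h" using b unfolding bk by (auto simp: wall_of_def ground_def)
    moreover have "h < H" using k H[of h] by (cases "h < H") auto
    moreover have "p \<in> {Whole, PosA, PosB}" by (cases p) auto
    ultimately show "b \<in> {..?V 0} \<times> {..<H} \<times> {Whole, PosA, PosB}"
      using le[of h] unfolding bk by auto
  qed
  then have finY: "finite (?Y - ground)" by (rule finite_subset) auto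
  have "ground \<subseteq> ?Y" using split_0 by (auto simp: ground_def wall_of_def split_floor_def)
  moreover have "?Y \<subseteq> places X \<Lambda>" by (auto simp: wall_of_def places_def)
  moreover have "floor_filled X \<Lambda> ?Y k h" if "(k, Suc h, p) \<in> ?Y" for k h p
  proof -
    have "1 \<le> k" using that by (auto simp: wall_of_def)
    moreover have "started ?Y k (Suc h)" using that by (auto simp: started_def)
    ultimately show ?thesis
      using V[of h] by (simp add: started_wall_of filled_wall_of)
  qed
  moreover have "(k, h, p) \<in> ?Y" if "1 \<le> k" "(Suc k, h, p) \<in> ?Y" for k h p
    using that by (auto simp: wall_of_def)
  ultimately show ?thesis using finY unfolding young_wall_def by blast
qed

lemma proper_wall_of: "proper X \<Lambda> (wall_of X \<Lambda> (F, r, Q))"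
  unfolding proper_iff[OF young_wall_wall_of]
proof (intro allI impI)
  fix h k k'
  assume "1 \<le> k \<and> 1 \<le> k' \<and> floor_filled X \<Lambda> (wall_of X \<Lambda> (F, r, Q)) k h \<and>
    \<not> started (wall_of X \<Lambda> (F, r, Q)) k (Suc h) \<and>
    floor_filled X \<Lambda> (wall_of X \<Lambda> (F, r, Q)) k' h \<and> \<not> started (wall_of X \<Lambda> (F, r, Q)) k' (Suc h)"
  then show "k = k'"
    using filled_cols_Suc[OF wall_data_finite, of h]
    by (auto simp: started_wall_of filled_wall_of of_bool_def split: if_splits)
qed

end

lemma inj_on_wall_of:
  assumes s0: "split_floor X \<Lambda> 0"
  shows "inj_on (wall_of X \<Lambda>) (wall_data X \<Lambda>)"
proof (rule inj_onI)
  fix x x'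
  assume x: "x \<in> wall_data X \<Lambda>" "x' \<in> wall_data X \<Lambda>" "wall_of X \<Lambda> x = wall_of X \<Lambda> x'"
  obtain F r Q F' r' Q' where xx: "x = (F, r, Q)" "x' = (F', r', Q')" by (cases x, cases x') auto
  note d = x(1)[unfolded xx] and d' = x(2)[unfolded xx] and eq = x(3)[unfolded xx]
  let ?V = "filled_cols F r" and ?V' = "filled_cols F' r'"
  have V: "?V h = ?V' h" for h
  proof -
    have "k \<le> ?V h \<longleftrightarrow> k \<le> ?V' h" if "1 \<le> k" for k
      using filled_wall_of[OF s0 d that] filled_wall_of[OF s0 d' that] unfolding eq by simp
    from this[of "?V h"] this[of "?V' h"] show ?thesis by linarith
  qed
  have r: "r h = r' h" for h
  proof (cases "h = 0")
    case False
    have "k \<le> ?V h + r h \<longleftrightarrow> k \<le> ?V' h + r' h" if "1 \<le> k" for k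
      using started_wall_of[OF s0 d that, of h] started_wall_of[OF s0 d' that, of h] False unfolding eq by simp
    from this[of "?V h + r h"] this[of "?V' h + r' h"] show ?thesis using V[of h] by linarith
  qed (use run_bottom[OF s0 d] run_bottom[OF s0 d'] in simp)
  have "h \<in> F \<longleftrightarrow> h \<in> F'" for h
  proof -
    have "of_bool (h \<in> F) = (of_bool (h \<in> F') :: nat)"
      using filled_cols_Suc[OF wall_data_finite[OF s0 d], of h] filled_cols_Suc[OF wall_data_finite[OF s0 d'], of h]
        V[of h] V[of "Suc h"] r[of "Suc h"] by linarith
    then show ?thesis by (simp add: of_bool_def split: if_splits)
  qed
  moreover have "h \<in> Q \<longleftrightarrow> h \<in> Q'" for h
  proof (cases "r h = 0")
    case True
    then show ?thesis using d d' r by (auto simp: wall_data_def)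
  next
    case False
    then have h: "1 \<le> h" "split_floor X \<Lambda> h" using d by (auto simp: wall_data_def)
    have "(Suc (?V h), h, PosA) \<in> wall_of X \<Lambda> (F, r, Q) \<longleftrightarrow> run_side F r Q h = PosA"
      "(Suc (?V' h), h, PosA) \<in> wall_of X \<Lambda> (F', r', Q') \<longleftrightarrow> run_side F' r' Q' h = PosA"
      using False r[of h] h by (auto simp: wall_of_def positions_cases)
    then have "run_side F r Q h = PosA \<longleftrightarrow> run_side F' r' Q' h = PosA" unfolding eq V by simp
    then show ?thesis by (auto simp: run_side_def V split: if_splits)
  qed
  ultimately show "x = x'" unfolding xx using r by auto
qed

text \<open>
  In each floor and position the occupied columns form an initial segment. Its lengths determine
  the wall; properness says that from a filled floor to the next started one they drop by at most
  one, and in a half-filled stretch the longer of the two segments tells the position.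
\<close>

lemma wall_of_surj:
  assumes s0: "split_floor X \<Lambda> 0" and Y: "proper X \<Lambda> Y"
  shows "Y \<in> wall_of X \<Lambda> ` wall_data X \<Lambda>"
proof -
  have yw: "young_wall X \<Lambda> Y" using Y by (simp add: proper_def)
  have ground: "ground \<subseteq> Y" and places: "Y \<subseteq> places X \<Lambda>" and finY: "finite (Y - ground)"
    and below: "\<And>k h p. (k, Suc h, p) \<in> Y \<Longrightarrow> floor_filled X \<Lambda> Y k h"
    and right: "\<And>k h p. 1 \<le> k \<Longrightarrow> (Suc k, h, p) \<in> Y \<Longrightarrow> (k, h, p) \<in> Y"
    using yw unfolding young_wall_def by blast+
  have col: "1 \<le> k" and pos: "p \<in> positions (floor_at X \<Lambda> h)" if "(k, h, p) \<in> Y" for k h p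
    using places that by (auto simp: places_def)
  have right': "(m, h, p) \<in> Y" if "(k, h, p) \<in> Y" "1 \<le> m" "m \<le> k" for k m h p
    using that(3,1,2)
  proof (induction rule: inc_induct)
    case (step n)
    then show ?case using right[of n h p] by simp
  qed
  let ?fill = "\<lambda>h. {k. 1 \<le> k \<and> floor_filled X \<Lambda> Y k h}"
  let ?start = "\<lambda>h. {k. 1 \<le> k \<and> started Y k h}"
  define v where "v h = card (?fill h)" for h
  define u where "u h = card (?start h)" for h
  have ground_iff: "(k, h, p) \<in> ground \<longleftrightarrow> 1 \<le> k \<and> h = 0 \<and> p = PosA" for k h p
    by (simp add: ground_def)
  have start: "?start h = {1..u h}" if "1 \<le> h" for h
    unfolding u_def
  proof (rule initial_segment)
    have "?start h \<subseteq> fst ` (Y - ground)"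
      using that by (force simp: started_def ground_iff image_iff)
    then show "finite (?start h)" using finY by (auto intro: finite_subset)
  next
    fix k assume "1 \<le> k" "Suc k \<in> ?start h"
    then show "k \<in> ?start h" unfolding started_def using right by blast
  qed simp
  have fill: "?fill h = {1..v h}" for h
    unfolding v_def
  proof (rule initial_segment)
    have "?fill h \<subseteq> fst ` (Y - ground)"
    proof
      fix k assume "k \<in> ?fill h"
      then have "(k, h, if split_floor X \<Lambda> h then PosB else Whole) \<in> Y - ground"
        by (auto simp: floor_filled_def positions_cases ground_iff)
      then show "k \<in> fst ` (Y - ground)" by force
    qed
    then show "finite (?fill h)" using finY by (auto intro: finite_subset)
  next
    fix k assume "1 \<le> k" "Suc k \<in> ?fill h"
    then show "k \<in> ?fill h" unfolding floor_filled_def using right by blast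
  qed simp
  have fill_iff: "floor_filled X \<Lambda> Y k h \<longleftrightarrow> k \<le> v h" if "1 \<le> k" for k h
    using fill[of h] that by (auto simp: set_eq_iff)
  have start_iff: "started Y k h \<longleftrightarrow> k \<le> u h" if "1 \<le> k" "1 \<le> h" for k h
    using start[OF that(2)] that(1) by (auto simp: set_eq_iff)
  have fill_start: "started Y k h" if "floor_filled X \<Lambda> Y k h" for k h
    using that by (auto simp: floor_filled_def started_def positions_cases split: if_splits)
  have uv: "v h \<le> u h" if "1 \<le> h" for h
    using fill_iff[of "v h" h] start_iff[of "v h" h] fill_start[of "v h" h] that by (cases "v h") auto
  have vu: "u (Suc h) \<le> v h" for h
    using fill_iff[of "u (Suc h)" h] start_iff[of "u (Suc h)" "Suc h"] below
    by (cases "u (Suc h)") (auto simp: started_def)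
  have vu': "v h \<le> Suc (u (Suc h))" for h
  proof (rule ccontr)
    assume "\<not> v h \<le> Suc (u (Suc h))"
    then have "1 \<le> v h" "1 \<le> v h - 1" "\<not> v h \<le> u (Suc h)" "\<not> v h - 1 \<le> u (Suc h)" by linarith+
    then have "v h = v h - 1"
      using Y[unfolded proper_iff[OF yw], rule_format, of "v h" "v h - 1" h]
      by (simp add: fill_iff start_iff)
    then show False using \<open>\<not> v h \<le> Suc (u (Suc h))\<close> by simp
  qed
  obtain H where H: "\<And>h. h \<ge> H \<Longrightarrow> v h = 0" "\<And>h. h \<ge> H \<Longrightarrow> u h = 0"
  proof
    fix h assume h: "h \<ge> height Y 1"
    have "1 \<le> h" using h young_wall_heights(2)[OF yw, of 1] by simp
    have "h \<notin> {..<height Y 1}" using h by simp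
    then have "\<not> started Y 1 h" using young_wall_heights(1)[OF yw, of 1] by blast
    then show "u h = 0" using start_iff[of 1 h] \<open>1 \<le> h\<close> by simp
    then show "v h = 0" using uv[OF \<open>1 \<le> h\<close>] by simp
  qed
  define F where "F = {h. v h \<noteq> u (Suc h)}"
  define r where "r h = (if h = 0 then 0 else u h - v h)" for h
  define Q where "Q = {h. r h \<noteq> 0 \<and> \<not> ((Suc (v h), h, PosA) \<in> Y \<longleftrightarrow> even (v h))}"
  have Fb: "h < H" if "h \<in> F" for h
    by (rule ccontr) (use H(1)[of h] H(2)[of "Suc h"] that in \<open>simp add: F_def\<close>)
  have rb: "h < H" if "r h \<noteq> 0" for h
    by (rule ccontr) (use H(2)[of h] that in \<open>simp add: r_def split: if_splits\<close>)
  have fins: "finite F" "finite {h. r h \<noteq> 0}"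
    using Fb rb by (auto intro!: finite_subset[of _ "{..<H}"])
  have above: "filled_cols F r h = 0" if "H \<le> h" for h
  proof -
    have "F \<inter> {h..} = {}" using that by (auto dest: Fb)
    moreover have "{h'. h < h' \<and> r h' \<noteq> 0} = {}" using that rb by fastforce
    ultimately show ?thesis by (simp only: filled_cols_def) simp
  qed
  have split: "split_floor X \<Lambda> h" if "r h \<noteq> 0" for h
  proof (rule ccontr)
    assume "\<not> split_floor X \<Lambda> h"
    then have "started Y k h \<longleftrightarrow> floor_filled X \<Lambda> Y k h" for k
      using pos[of k h] by (auto simp: started_def floor_filled_def positions_cases)
    then show False using that by (auto simp: u_def v_def r_def split: if_splits)
  qed
  have data: "(F, r, Q) \<in> wall_data X \<Lambda>"
    using fins split by (auto simp: wall_data_def Q_def r_def)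
  have V: "filled_cols F r h = v h" for h
  proof (cases "h \<le> H")
    case True
    then show ?thesis
    proof (induction h rule: inc_induct)
      case base
      show ?case using H above by simp
    next
      case (step h)
      then show ?case
        using filled_cols_Suc[OF fins, of h] vu[of h] vu'[of h] uv[of "Suc h"]
        by (auto simp: F_def r_def of_bool_def)
    qed
  next
    case False
    then show ?thesis using H above by simp
  qed
  have side: "(k, h, p) \<in> Y \<longleftrightarrow> p = run_side F r Q h"
    if k: "v h < k" "k \<le> v h + r h" and h: "1 \<le> h" and p: "p \<in> positions (floor_at X \<Lambda> h)" for k h p
  proof -
    let ?k = "Suc (v h)"
    have rh: "r h \<noteq> 0" using k by simp
    have sp: "split_floor X \<Lambda> h" using split[OF rh] .
    have A: "(?k, h, PosA) \<in> Y \<longleftrightarrow> run_side F r Q h = PosA"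
      using rh by (auto simp: run_side_def V Q_def)
    have nf: "\<not> ((?k, h, PosA) \<in> Y \<and> (?k, h, PosB) \<in> Y)"
      using fill_iff[of ?k h] sp by (auto simp: floor_filled_def positions_cases)
    have "started Y k h" using k h uv[OF h] start_iff[of k h] by (auto simp: r_def)
    then have st: "(k, h, PosA) \<in> Y \<or> (k, h, PosB) \<in> Y"
      using pos[of k h] sp by (auto simp: started_def positions_cases)
    have mono: "(k, h, p) \<in> Y \<Longrightarrow> (?k, h, p) \<in> Y" for p
      using right'[of k h p ?k] k by simp
    have sides: "run_side F r Q h = PosA \<or> run_side F r Q h = PosB" by (simp add: run_side_def)
    show ?thesis using p sp A nf st mono[of PosA] mono[of PosB] sides
      by (auto simp: positions_cases)
  qed
  have "Y = wall_of X \<Lambda> (F, r, Q)"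
  proof (rule set_eqI)
    fix b :: place
    obtain k h p where b: "b = (k, h, p)" by (cases b) auto
    show "b \<in> Y \<longleftrightarrow> b \<in> wall_of X \<Lambda> (F, r, Q)"
    proof (cases "1 \<le> k \<and> p \<in> positions (floor_at X \<Lambda> h)")
      case False
      then show ?thesis using col pos unfolding b by (auto simp: wall_of_def)
    next
      case True
      then have k: "1 \<le> k" and p: "p \<in> positions (floor_at X \<Lambda> h)" by auto
      have W: "b \<in> wall_of X \<Lambda> (F, r, Q) \<longleftrightarrow>
          k \<le> v h \<or> k \<le> v h + r h \<and> p = run_side F r Q h \<or> h = 0 \<and> p = PosA"
        using k p unfolding b by (simp add: wall_of_def V)
      show ?thesis
      proof (cases "k \<le> v h")
        case True
        then have "b \<in> Y" using fill_iff[OF k, of h] p unfolding b by (auto simp: floor_filled_def)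
        then show ?thesis using W True by simp
      next
        case nf: False
        show ?thesis
        proof (cases "h = 0")
          case True
          have A: "(k, 0, PosA) \<in> Y" using ground k by (auto simp: ground_def)
          then have "(k, 0, PosB) \<notin> Y"
            using nf fill_iff[OF k, of 0] s0 True by (auto simp: floor_filled_def positions_cases)
          then show ?thesis using W A p s0 nf True unfolding b
            by (auto simp: r_def positions_cases)
        next
          case False
          then have h: "1 \<le> h" by simp
          show ?thesis
          proof (cases "k \<le> v h + r h")
            case True
            then show ?thesis using W side[OF _ True h p] nf False unfolding b by auto
          next
            case nr: False
            have "\<not> started Y k h" using nr start_iff[OF k h] uv[OF h] h by (auto simp: r_def)
            then show ?thesis using W nf nr False unfolding b by (auto simp: started_def)
          qed
        qed
      qed
    qed
  qed
  then show ?thesis using data by blast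
qed

lemma bij_betw_wall_of:
  assumes "split_floor X \<Lambda> 0"
  shows "bij_betw (wall_of X \<Lambda>) (wall_data X \<Lambda>) (proper_walls X \<Lambda>)"
  unfolding bij_betw_def proper_walls_def
  using inj_on_wall_of[OF assms] wall_of_surj[OF assms] proper_wall_of[OF assms] by auto

section \<open>Counting the added blocks\<close>

definition floor_count :: "affine_type \<Rightarrow> nat \<Rightarrow> place set \<Rightarrow> nat \<Rightarrow> nat \<Rightarrow> nat" where
  "floor_count X \<Lambda> Y i h = card {(k, p). (k, h, p) \<in> Y - ground \<and> color X \<Lambda> (k, h, p) = i}"

lemma added_eq_sum_floor_count:
  assumes "finite (Y - ground)" "\<And>k h p. (k, h, p) \<in> Y - ground \<Longrightarrow> h < H"
  shows "added X \<Lambda> Y i = (\<Sum>h<H. floor_count X \<Lambda> Y i h)"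
proof -
  let ?S = "\<lambda>h. {(k, p). (k, h, p) \<in> Y - ground \<and> color X \<Lambda> (k, h, p) = i}"
  let ?f = "\<lambda>h (k, p). (k, h, p) :: place"
  have inj: "inj_on (?f h) A" for h A by (auto intro: inj_onI)
  have eq: "{b \<in> Y - ground. color X \<Lambda> b = i} = (\<Union>h\<in>{..<H}. ?f h ` ?S h)"
  proof (rule set_eqI)
    fix b :: place
    obtain k h p where b: "b = (k, h, p)" by (cases b) auto
    show "b \<in> {b \<in> Y - ground. color X \<Lambda> b = i} \<longleftrightarrow> b \<in> (\<Union>h\<in>{..<H}. ?f h ` ?S h)"
      unfolding b using assms(2)[of k h p] by force
  qed
  have sub: "?f h ` ?S h \<subseteq> Y - ground" for h by auto
  have "card (\<Union>h\<in>{..<H}. ?f h ` ?S h) = (\<Sum>h<H. card (?f h ` ?S h))"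
  proof (rule card_UN_disjoint)
    show "\<forall>h\<in>{..<H}. finite (?f h ` ?S h)" using finite_subset[OF sub assms(1)] by blast
    show "\<forall>h\<in>{..<H}. \<forall>h'\<in>{..<H}. h \<noteq> h' \<longrightarrow> ?f h ` ?S h \<inter> ?f h' ` ?S h' = {}" by fastforce
  qed simp
  then show ?thesis unfolding added_def floor_count_def eq by (simp add: card_image inj)
qed

lemma card_even_lessThan: "card {t. t < j \<and> (b \<longleftrightarrow> even t)} = (j + of_bool b) div 2"
proof (induction j)
  case (Suc j)
  have "{t. t < Suc j \<and> (b \<longleftrightarrow> even t)} =
      (if b \<longleftrightarrow> even j then insert j {t. t < j \<and> (b \<longleftrightarrow> even t)} else {t. t < j \<and> (b \<longleftrightarrow> even t)})"
    by (auto simp: less_Suc_eq)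
  then show ?case using Suc by (cases b; cases "even j") auto
qed simp

text \<open>
  Used for the colors of a run: those equal to the first one occur \<open>(j + 1) div 2\<close>
  times among \<open>j\<close> alternating entries.
\<close>

lemma card_alternating_run:
  "card {k. V < k \<and> k \<le> V + j \<and> (b \<longleftrightarrow> even (k - Suc V))} = (j + of_bool b) div 2"
proof -
  have "{k. V < k \<and> k \<le> V + j \<and> (b \<longleftrightarrow> even (k - Suc V))}
      = (\<lambda>t. Suc V + t) ` {t. t < j \<and> (b \<longleftrightarrow> even t)}" (is "?l = ?r")
  proof
    show "?l \<subseteq> ?r"
    proof
      fix k assume k: "k \<in> ?l"
      then have "k = Suc V + (k - Suc V)" by simp
      moreover have "k - Suc V \<in> {t. t < j \<and> (b \<longleftrightarrow> even t)}" using k by auto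
      ultimately show "k \<in> ?r" by (rule image_eqI)
    qed
  qed auto
  moreover have "inj_on (\<lambda>t. Suc V + t) A" for A by (simp add: inj_on_def)
  ultimately show ?thesis by (simp only: card_image card_even_lessThan)
qed

text \<open>
  Named by its place in the odd columns, a color of a split floor enters the later arguments only
  through its sign, whatever $\Lambda$ is.
\<close>

definition plus_color :: "affine_type \<Rightarrow> nat \<Rightarrow> nat \<Rightarrow> nat" where
  "plus_color X \<Lambda> h = color X \<Lambda> (1, h, PosA)"

definition minus_color :: "affine_type \<Rightarrow> nat \<Rightarrow> nat \<Rightarrow> nat" where
  "minus_color X \<Lambda> h = color X \<Lambda> (1, h, PosB)"

lemma color_split_floor:
  assumes "floor_at X \<Lambda> h = Split i j"
  shows "color X \<Lambda> (k, h, PosA) = (if odd k then plus_color X \<Lambda> h else minus_color X \<Lambda> h)"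
    and "color X \<Lambda> (k, h, PosB) = (if odd k then minus_color X \<Lambda> h else plus_color X \<Lambda> h)"
    and "{plus_color X \<Lambda> h, minus_color X \<Lambda> h} = {i, j}"
    and "i \<noteq> j \<Longrightarrow> plus_color X \<Lambda> h \<noteq> minus_color X \<Lambda> h"
  using assms by (auto simp: color_def plus_color_def minus_color_def)

text \<open>
  By alternation, the first color of a run gets the larger half.
\<close>

definition run_plus :: "(nat \<Rightarrow> nat) \<Rightarrow> nat set \<Rightarrow> nat \<Rightarrow> nat" where
  "run_plus r Q h = (r h + of_bool (h \<notin> Q)) div 2"

definition run_minus :: "(nat \<Rightarrow> nat) \<Rightarrow> nat set \<Rightarrow> nat \<Rightarrow> nat" where
  "run_minus r Q h = (r h + of_bool (h \<in> Q)) div 2"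

lemma run_plus_minus: "r h = run_plus r Q h + run_minus r Q h"
  unfolding run_plus_def run_minus_def by (cases "h \<in> Q"; simp; presburger)

context
  fixes X :: affine_type and \<Lambda> :: nat and F :: "nat set" and r :: "nat \<Rightarrow> nat" and Q :: "nat set"
  assumes split_0: "split_floor X \<Lambda> 0"
    and data: "(F, r, Q) \<in> wall_data X \<Lambda>"
begin

lemma floor_count_cube:
  assumes "floor_at X \<Lambda> h = Cube c"
  shows "floor_count X \<Lambda> (wall_of X \<Lambda> (F, r, Q)) i h = (if i = c then filled_cols F r h else 0)"
proof -
  have nsp: "\<not> split_floor X \<Lambda> h" using assms by (simp add: split_floor_def)
  have "h \<noteq> 0" using nsp split_0 by metis
  have "{(k, p). (k, h, p) \<in> wall_of X \<Lambda> (F, r, Q) - ground \<and> color X \<Lambda> (k, h, p) = i}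
      = (if i = c then (\<lambda>k. (k, Whole)) ` {1..filled_cols F r h} else {})"
    using run_cube[OF split_0 data nsp] \<open>h \<noteq> 0\<close> assms nsp
    by (auto simp: wall_of_def ground_def color_def positions_cases)
  then show ?thesis by (simp add: floor_count_def card_image inj_on_def)
qed

text \<open>
  A filled floor contributes one block of each color in every column; in the run only the parity
  of the column relative to its start matters.
\<close>

lemma floor_count_split:
  assumes fl: "floor_at X \<Lambda> h = Split c d" and cd: "c \<noteq> d" and h: "1 \<le> h"
  shows "floor_count X \<Lambda> (wall_of X \<Lambda> (F, r, Q)) i h =
     (if i = plus_color X \<Lambda> h then filled_cols F r h + run_plus r Q h
      else if i = minus_color X \<Lambda> h then filled_cols F r h + run_minus r Q h else 0)"
proof -
  let ?V = "filled_cols F r h"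
  define B where "B = wall_of X \<Lambda> (F, r, Q) - ground"
  let ?run = "\<lambda>b. {k. ?V < k \<and> k \<le> ?V + r h \<and> (b \<longleftrightarrow> even (k - Suc ?V))}"
  have sp: "split_floor X \<Lambda> h" using fl by (simp add: split_floor_def)
  note col = color_split_floor[OF fl]
  have pos: "(k, h, p) \<in> B \<longleftrightarrow> 1 \<le> k \<and> p \<in> {PosA, PosB} \<and>
      (k \<le> ?V \<or> k \<le> ?V + r h \<and> p = run_side F r Q h)" for k p
    using sp h by (auto simp: B_def wall_of_def ground_def positions_cases)
  have par: "even (k - Suc ?V) \<longleftrightarrow> (odd k \<longleftrightarrow> even ?V)" if "?V < k" for k
    using that by (auto simp: even_diff_nat Suc_le_eq)
  have count: "card {(k, p). (k, h, p) \<in> B \<and> p = (if odd k \<longleftrightarrow> s then PosA else PosB)}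
      = ?V + (r h + of_bool (h \<in> Q \<longleftrightarrow> \<not> s)) div 2" (is "card ?S = _") for s
  proof -
    let ?K = "{1..?V} \<union> ?run (h \<in> Q \<longleftrightarrow> \<not> s)"
    let ?f = "\<lambda>k :: nat. (k, if odd k \<longleftrightarrow> s then PosA else PosB)"
    have "(k, p) \<in> ?S \<longleftrightarrow> (k, p) \<in> ?f ` ?K" for k p
    proof (cases "p = (if odd k \<longleftrightarrow> s then PosA else PosB)")
      case True
      have "(k, p) \<in> ?S \<longleftrightarrow> k \<in> ?K"
      proof (cases "k \<le> ?V")
        case False
        then show ?thesis using True par[of k] by (auto simp: pos run_side_def)
      qed (use True in \<open>auto simp: pos\<close>)
      then show ?thesis using True by auto
    qed auto
    then have "?S = ?f ` ?K" by auto
    then have "card ?S = card ?K" by (simp add: card_image inj_on_def)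
    also have "\<dots> = card {1..?V} + card (?run (h \<in> Q \<longleftrightarrow> \<not> s))"
      by (rule card_Un_disjoint) auto
    finally show ?thesis by (simp only: card_alternating_run card_atLeastAtMost diff_Suc_1)
  qed
  have pm: "plus_color X \<Lambda> h \<noteq> minus_color X \<Lambda> h" using col(4)[OF cd] .
  consider "i = plus_color X \<Lambda> h" | "i = minus_color X \<Lambda> h" | "i \<noteq> plus_color X \<Lambda> h" "i \<noteq> minus_color X \<Lambda> h"
    by blast
  then show ?thesis
  proof cases
    case 1
    have "(k, h, p) \<in> B \<and> color X \<Lambda> (k, h, p) = i \<longleftrightarrow>
        (k, h, p) \<in> B \<and> p = (if odd k \<longleftrightarrow> True then PosA else PosB)" for k p
      using pos[of k p] col(1,2)[of k] pm 1 by (cases "odd k") auto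
    then have "{(k, p). (k, h, p) \<in> B \<and> color X \<Lambda> (k, h, p) = i} =
        {(k, p). (k, h, p) \<in> B \<and> p = (if odd k \<longleftrightarrow> True then PosA else PosB)}"
      by (simp only:)
    then show ?thesis unfolding floor_count_def B_def [symmetric] using count[of True] 1 by (simp add: run_plus_def)
  next
    case 2
    have "(k, h, p) \<in> B \<and> color X \<Lambda> (k, h, p) = i \<longleftrightarrow>
        (k, h, p) \<in> B \<and> p = (if odd k \<longleftrightarrow> False then PosA else PosB)" for k p
      using pos[of k p] col(1,2)[of k] pm 2 by (cases "odd k") auto
    then have "{(k, p). (k, h, p) \<in> B \<and> color X \<Lambda> (k, h, p) = i} =
        {(k, p). (k, h, p) \<in> B \<and> p = (if odd k \<longleftrightarrow> False then PosA else PosB)}"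
      by (simp only:)
    then show ?thesis unfolding floor_count_def B_def [symmetric] using count[of False] 2 pm by (simp add: run_minus_def)
  next
    case 3
    then have e: "{(k, p). (k, h, p) \<in> B \<and> color X \<Lambda> (k, h, p) = i} = {}"
      using col(1,2) unfolding pos by (auto split: if_splits)
    show ?thesis unfolding floor_count_def B_def [symmetric] e using 3 by simp
  qed
qed

text \<open>
  On the bottom floor only position B is added, with the color \<open>-\<close> in the first
  column.
\<close>

lemma floor_count_bottom:
  assumes fl: "floor_at X \<Lambda> 0 = Split c d" and cd: "c \<noteq> d"
  shows "floor_count X \<Lambda> (wall_of X \<Lambda> (F, r, Q)) i 0 =
     (if i = plus_color X \<Lambda> 0 then filled_cols F r 0 div 2
      else if i = minus_color X \<Lambda> 0 then (filled_cols F r 0 + 1) div 2 else 0)"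
proof -
  let ?V = "filled_cols F r 0"
  define B where "B = wall_of X \<Lambda> (F, r, Q) - ground"
  note col = color_split_floor[OF fl]
  have pm: "plus_color X \<Lambda> 0 \<noteq> minus_color X \<Lambda> 0" using col(4)[OF cd] .
  have pos: "(k, 0, p) \<in> B \<longleftrightarrow> 1 \<le> k \<and> k \<le> ?V \<and> p = PosB" for k p
    using split_0 run_bottom[OF split_0 data] by (auto simp: B_def wall_of_def ground_def positions_cases)
  let ?run = "\<lambda>b. {k. 0 < k \<and> k \<le> 0 + ?V \<and> (b \<longleftrightarrow> even (k - Suc 0))}"
  have "inj_on (\<lambda>k. (k, PosB)) A" for A :: "nat set" by (rule inj_onI) simp
  then have count: "card ((\<lambda>k. (k, PosB)) ` ?run b) = (?V + of_bool b) div 2" for b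
    by (simp only: card_alternating_run card_image)
  consider "i = plus_color X \<Lambda> 0" | "i = minus_color X \<Lambda> 0" | "i \<noteq> plus_color X \<Lambda> 0" "i \<noteq> minus_color X \<Lambda> 0"
    by blast
  then show ?thesis
  proof cases
    case 1
    have "(k, 0, p) \<in> B \<and> color X \<Lambda> (k, 0, p) = i \<longleftrightarrow> (k, p) \<in> (\<lambda>k. (k, PosB)) ` ?run False" for k p
      using pos[of k p] col(1,2)[of k] pm 1 by (cases k) (auto split: if_splits)
    then have "{(k, p). (k, 0, p) \<in> B \<and> color X \<Lambda> (k, 0, p) = i} = (\<lambda>k. (k, PosB)) ` ?run False"
      by (intro set_eqI) (simp only: mem_Collect_eq case_prod_unfold prod.collapse)
    then show ?thesis unfolding floor_count_def B_def [symmetric] using count[of False] 1 by simp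
  next
    case 2
    have "(k, 0, p) \<in> B \<and> color X \<Lambda> (k, 0, p) = i \<longleftrightarrow> (k, p) \<in> (\<lambda>k. (k, PosB)) ` ?run True" for k p
      using pos[of k p] col(1,2)[of k] pm 2 by (cases k) (auto split: if_splits)
    then have "{(k, p). (k, 0, p) \<in> B \<and> color X \<Lambda> (k, 0, p) = i} = (\<lambda>k. (k, PosB)) ` ?run True"
      by (intro set_eqI) (simp only: mem_Collect_eq case_prod_unfold prod.collapse)
    then show ?thesis unfolding floor_count_def B_def [symmetric] using count[of True] 2 pm by simp
  next
    case 3
    then have e: "{(k, p). (k, 0, p) \<in> B \<and> color X \<Lambda> (k, 0, p) = i} = {}"
      using col(1,2) unfolding pos by (auto split: if_splits)
    show ?thesis unfolding floor_count_def B_def [symmetric] e using 3 by simp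
  qed
qed

end

lemma sum_by_residue:
  fixes f :: "nat \<Rightarrow> 'a::comm_monoid_add"
  shows "(\<Sum>h<L * M. f h) = (\<Sum>\<rho><L. \<Sum>a<M. f (L * a + \<rho>))"
proof -
  have "(\<Sum>h<M * L. f h) = (\<Sum>a<M. sum f {a * L..<a * L + L})" by (rule sum.nat_group [symmetric])
  also have "\<dots> = (\<Sum>a<M. \<Sum>\<rho><L. f (L * a + \<rho>))"
  proof (rule sum.cong)
    fix a
    show "sum f {a * L..<a * L + L} = (\<Sum>\<rho><L. f (L * a + \<rho>))"
      using sum.shift_bounds_nat_ivl[of f 0 "a * L" L]
      by (simp add: atLeast0LessThan add.commute mult.commute)
  qed simp
  also have "\<dots> = (\<Sum>\<rho><L. \<Sum>a<M. f (L * a + \<rho>))" by (rule sum.swap)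
  finally show ?thesis by (simp add: mult.commute)
qed

text \<open>
  The linear algebra of the content. \<open>Z \<rho>\<close> is the number of filled floors at
  residue \<open>\<rho>\<close>, \<open>x \<rho>\<close> the number of full tops there,
  \<open>p0\<close>, \<open>m0\<close> and \<open>p1\<close>, \<open>m1\<close> the numbers of
  half blocks of both signs at residues \<open>0\<close> and \<open>g\<close>, and
  \<open>v\<close> the number of nonempty columns. Neighboring colors of the chain use neighboring
  residues, so the difference of their counts is \<open>x \<rho> - x (2 * g - 1 - \<rho>)\<close>.
\<close>

lemma content_balance:
  fixes Z x :: "nat \<Rightarrow> nat"
  assumes g: "2 \<le> g"
    and Z: "\<And>\<rho>. Suc \<rho> < 2 * g \<Longrightarrow> Suc \<rho> \<noteq> g \<Longrightarrow> Z \<rho> = Z (Suc \<rho>) + x \<rho>"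
    and Zg: "Z (g - 1) = Z g + x (g - 1) + p1 + m1"
    and ZL: "Z (2 * g - 1) + v = Z 0 + x (2 * g - 1) + p0 + m0"
    and cp: "cp + (v + 1) div 2 = Z 0 + p0" and cm: "cm + v div 2 = Z 0 + m0"
  shows "cp = m \<and> cm = m \<and> (\<forall>\<rho>\<in>{1..<g}. Z \<rho> + Z (2 * g - \<rho>) = 2 * m) \<and> Z g + p1 = m \<and> Z g + m1 = m
    \<longleftrightarrow> (\<forall>\<rho><g. x \<rho> = x (2 * g - 1 - \<rho>)) \<and> p0 = m0 + v mod 2 \<and> p1 = m1 \<and> Z g + p1 = m"
    (is "?lhs \<longleftrightarrow> ?rhs")
proof -
  define W where "W \<rho> = Z \<rho> + Z (2 * g - \<rho>)" for \<rho>
  have W: "W \<rho> + x (2 * g - 1 - \<rho>) = W (Suc \<rho>) + x \<rho>" if "1 \<le> \<rho>" "Suc \<rho> < g" for \<rho>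
  proof -
    have e: "Suc (2 * g - 1 - \<rho>) = 2 * g - \<rho>" "2 * g - Suc \<rho> = 2 * g - 1 - \<rho>"
      using that by linarith+
    have 1: "Z \<rho> = Z (Suc \<rho>) + x \<rho>"
      by (rule Z) (use that in linarith)+
    have 2: "Z (2 * g - 1 - \<rho>) = Z (2 * g - \<rho>) + x (2 * g - 1 - \<rho>)"
      unfolding e(1) [symmetric] by (rule Z) (use that in linarith)+
    show ?thesis unfolding W_def e(2) using 1 2 by linarith
  qed
  have Wg: "W (g - 1) + x g = 2 * Z g + p1 + m1 + x (g - 1)"
  proof -
    have e: "2 * g - (g - 1) = Suc g" using g by linarith
    have "Z g = Z (Suc g) + x g" by (rule Z) (use g in linarith)+
    then show ?thesis unfolding W_def e using Zg by linarith
  qed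
  have W1: "Z 0 + p0 + Z 0 + m0 + x (2 * g - 1) = W 1 + v + x 0"
  proof -
    have "Z 0 = Z (Suc 0) + x 0" by (rule Z) (use g in linarith)+
    then show ?thesis unfolding W_def One_nat_def using ZL unfolding One_nat_def by linarith
  qed
  have v: "(v + 1) div 2 = v div 2 + v mod 2" "v = 2 * (v div 2) + v mod 2" by presburger+
  show ?thesis
  proof
    assume l: ?lhs
    have Wm: "W \<rho> = 2 * m" if "1 \<le> \<rho>" "\<rho> < g" for \<rho> using l that by (simp add: W_def)
    have "x \<rho> = x (2 * g - 1 - \<rho>)" if \<rho>: "\<rho> < g" for \<rho>
    proof -
      consider "\<rho> = 0" | "1 \<le> \<rho>" "Suc \<rho> < g" | "\<rho> = g - 1" "1 \<le> \<rho>" using \<rho> by linarith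
      then show ?thesis
      proof cases
        case 1
        have "W 1 = 2 * m" by (rule Wm) (use g in linarith)+
        moreover have "cp = m" "cm = m" using l by blast+
        ultimately have "x 0 = x (2 * g - 1)" using W1 cp cm v by linarith
        then show ?thesis using 1 by simp
      next
        case 2
        have "W \<rho> = 2 * m" "W (Suc \<rho>) = 2 * m" by (rule Wm; use 2 in linarith)+
        then show ?thesis using W[OF 2] by linarith
      next
        case 3
        have e: "2 * g - 1 - (g - 1) = g" using g by linarith
        have "W (g - 1) = 2 * m" by (rule Wm) (use g in linarith)+
        moreover have "Z g + p1 = m" "Z g + m1 = m" using l by blast+
        ultimately show ?thesis unfolding 3(1) e using Wg by linarith
      qed
    qed
    moreover have "p0 = m0 + v mod 2" using l cp cm v by linarith
    ultimately show ?rhs using l by auto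
  next
    assume r: ?rhs
    have xs: "x \<rho> = x (2 * g - 1 - \<rho>)" if "\<rho> < g" for \<rho> using r that by blast
    have Wm: "W \<rho> = 2 * m" if "1 \<le> \<rho>" "\<rho> \<le> g - 1" for \<rho>
      using that(2,1)
    proof (induction rule: inc_induct)
      case base
      have e: "2 * g - 1 - (g - 1) = g" using g by linarith
      have "x (g - 1) = x g" using xs[of "g - 1"] g unfolding e by linarith
      moreover have "p1 = m1" "Z g + p1 = m" using r by blast+
      ultimately show ?case using Wg by linarith
    next
      case (step \<rho>)
      then have "W (Suc \<rho>) = 2 * m" by linarith
      moreover have "x \<rho> = x (2 * g - 1 - \<rho>)" by (rule xs) (use step in linarith)
      moreover have "W \<rho> + x (2 * g - 1 - \<rho>) = W (Suc \<rho>) + x \<rho>"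
        by (rule W) (use step in linarith)+
      ultimately show ?case by linarith
    qed
    have "cp = cm" using r cp cm v by linarith
    moreover have "cp + cm = 2 * m"
    proof -
      have "W 1 = 2 * m" by (rule Wm) (use g in linarith)+
      moreover have "x 0 = x (2 * g - 1)" using xs[of 0] g by simp
      ultimately show ?thesis using W1 cp cm v by linarith
    qed
    ultimately have "cp = m" "cm = m" by linarith+
    moreover have "Z \<rho> + Z (2 * g - \<rho>) = 2 * m" if "\<rho> \<in> {1..<g}" for \<rho>
    proof -
      have "\<rho> \<le> g - 1" "1 \<le> \<rho>" using that by auto
      then show ?thesis using Wm[of \<rho>] unfolding W_def by blast
    qed
    ultimately show ?lhs using r by metis
  qed
qed

section \<open>Content of a wall over a palindromic floor pattern\<close>

text \<open>
  The conditions of weight $\Lambda - m\delta$ that do not involve \<open>m\<close>. The parity of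
  the number of nonempty columns enters because their ground state blocks alternate in color and
  hence are unbalanced exactly when this number is odd.
\<close>

definition balanced :: "nat \<Rightarrow> nat set \<times> (nat \<Rightarrow> nat) \<times> nat set \<Rightarrow> bool" where
  "balanced g = (\<lambda>(F, r, Q).
     (\<forall>\<rho><g. card {h \<in> F. h mod (2 * g) = \<rho>} = card {h \<in> F. h mod (2 * g) = 2 * g - 1 - \<rho>}) \<and>
     (\<Sum>h | r h \<noteq> 0 \<and> h mod (2 * g) = 0. run_plus r Q h) =
       (\<Sum>h | r h \<noteq> 0 \<and> h mod (2 * g) = 0. run_minus r Q h) + filled_cols F r 0 mod 2 \<and>
     (\<Sum>h | r h \<noteq> 0 \<and> h mod (2 * g) = g. run_plus r Q h) =
       (\<Sum>h | r h \<noteq> 0 \<and> h mod (2 * g) = g. run_minus r Q h))"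

text \<open>
  The multiple of $\delta$ carried by balanced data: the number of floors at residue
  \<open>g\<close> that are filled, plus the half blocks of color \<open>+\<close> on these
  floors.
\<close>

definition energy :: "nat \<Rightarrow> nat set \<times> (nat \<Rightarrow> nat) \<times> nat set \<Rightarrow> nat" where
  "energy g = (\<lambda>(F, r, Q).
     (\<Sum>h\<in>F. (h + g) div (2 * g)) + (\<Sum>h | r h \<noteq> 0. r h * (h div (2 * g))) +
     (\<Sum>h | r h \<noteq> 0 \<and> h mod (2 * g) = g. run_plus r Q h))"

lemma sum_residue_class:
  fixes f :: "nat \<Rightarrow> nat"
  assumes "\<rho> < L" "\<And>h. h \<in> A \<Longrightarrow> h < L * M" "\<And>h. h \<notin> A \<Longrightarrow> f h = 0"
  shows "(\<Sum>a<M. f (L * a + \<rho>)) = (\<Sum>h\<in>{h \<in> A. h mod L = \<rho>}. f h)"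
proof -
  have inj: "inj_on (\<lambda>a. L * a + \<rho>) {..<M}" using assms(1) by (auto simp: inj_on_def)
  have "(\<Sum>a<M. f (L * a + \<rho>)) = sum f ((\<lambda>a. L * a + \<rho>) ` {..<M})"
    by (simp add: sum.reindex[OF inj])
  also have "\<dots> = (\<Sum>h\<in>{h \<in> A. h mod L = \<rho>}. f h)"
  proof (rule sum.mono_neutral_right)
    show "{h \<in> A. h mod L = \<rho>} \<subseteq> (\<lambda>a. L * a + \<rho>) ` {..<M}"
    proof
      fix h assume h: "h \<in> {h \<in> A. h mod L = \<rho>}"
      then have "h < L * M" using assms(2) by blast
      then have "h div L < M" by (simp add: less_mult_imp_div_less mult.commute)
      moreover have "h = L * (h div L) + \<rho>" using h mult_div_mod_eq[of L h] by simp
      ultimately show "h \<in> (\<lambda>a. L * a + \<rho>) ` {..<M}" by blast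
    qed
    show "\<forall>h\<in>(\<lambda>a. L * a + \<rho>) ` {..<M} - {h \<in> A. h mod L = \<rho>}. f h = 0"
    proof
      fix h assume h: "h \<in> (\<lambda>a. L * a + \<rho>) ` {..<M} - {h \<in> A. h mod L = \<rho>}"
      then have "h mod L = \<rho>" using assms(1) by auto
      then have "h \<notin> A" using h by blast
      then show "f h = 0" by (rule assms(3))
    qed
  qed simp
  finally show ?thesis .
qed

text \<open>
  All cases of the theorem have this shape: a split bottom floor, a chain of cubes that is
  traversed upwards and then downwards, and between the two passages a floor that is a cube or
  split.
\<close>

locale wall_pattern =
  fixes X :: affine_type and \<Lambda> g bot c :: nat and \<kappa> :: "nat \<Rightarrow> nat" and mid :: floor_kind
  assumes g: "2 \<le> g"
    and floor_at_eq: "\<And>h. floor_at X \<Lambda> h =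
      (if h mod (2 * g) = 0 then Split bot (Suc bot) else if h mod (2 * g) = g then mid
       else if h mod (2 * g) < g then Cube (\<kappa> (h mod (2 * g))) else Cube (\<kappa> (2 * g - h mod (2 * g))))"
    and mid: "mid = Cube c \<or> mid = Split c (Suc c)"
    and inj_\<kappa>: "inj_on \<kappa> {1..<g}"
    and \<kappa>_fresh: "\<And>\<rho>. \<rho> \<in> {1..<g} \<Longrightarrow> \<kappa> \<rho> \<notin> {bot, Suc bot, c, Suc c}"
    and bot_fresh: "{bot, Suc bot} \<inter> {c, Suc c} = {}"
begin

abbreviation "L \<equiv> 2 * g"

lemma floor_bot: "h mod L = 0 \<Longrightarrow> floor_at X \<Lambda> h = Split bot (Suc bot)"
  by (simp only: floor_at_eq if_True simp_thms)

lemma floor_mid: "h mod L = g \<Longrightarrow> floor_at X \<Lambda> h = mid"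
proof -
  assume "h mod L = g"
  moreover have "g \<noteq> 0" using g by linarith
  ultimately show ?thesis by (simp only: floor_at_eq if_True if_False simp_thms)
qed

lemma floor_chain:
  assumes "h mod L \<noteq> 0" "h mod L \<noteq> g"
  shows "floor_at X \<Lambda> h = Cube (\<kappa> (if h mod L < g then h mod L else L - h mod L))"
  using assms by (cases "h mod L < g") (simp_all only: floor_at_eq if_True if_False simp_thms)

lemma split_floor_iff:
  "split_floor X \<Lambda> h \<longleftrightarrow> h mod L = 0 \<or> h mod L = g \<and> mid \<noteq> Cube c"
proof -
  consider "h mod L = 0" | "h mod L = g" | "h mod L \<noteq> 0" "h mod L \<noteq> g" by blast
  then show ?thesis
  proof cases
    case 1
    then show ?thesis by (simp add: split_floor_def floor_bot)
  next
    case 2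
    moreover have "g \<noteq> 0" using g by linarith
    moreover have "positions mid = {PosA, PosB} \<longleftrightarrow> mid \<noteq> Cube c"
    proof -
      have "{Whole} \<noteq> {PosA, PosB}" by blast
      from mid this show ?thesis by (elim disjE) (simp_all only: positions.simps floor_kind.distinct simp_thms)
    qed
    ultimately show ?thesis unfolding split_floor_def floor_mid[OF 2] by metis
  next
    case 3
    then show ?thesis unfolding split_floor_def floor_chain[OF 3] by simp
  qed
qed

lemma split_floor_0: "split_floor X \<Lambda> 0" by (simp add: split_floor_iff)

lemma color_cong: "floor_at X \<Lambda> h = floor_at X \<Lambda> h' \<Longrightarrow> color X \<Lambda> (k, h, p) = color X \<Lambda> (k, h', p)"
  by (simp add: color_def)

lemma plus_minus_bot:
  "{plus_color X \<Lambda> 0, minus_color X \<Lambda> 0} = {bot, Suc bot}"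
  "plus_color X \<Lambda> 0 \<noteq> minus_color X \<Lambda> 0"
proof -
  have fl: "floor_at X \<Lambda> 0 = Split bot (Suc bot)" by (rule floor_bot) simp
  show "{plus_color X \<Lambda> 0, minus_color X \<Lambda> 0} = {bot, Suc bot}"
    by (rule color_split_floor(3)[OF fl])
  show "plus_color X \<Lambda> 0 \<noteq> minus_color X \<Lambda> 0"
    by (rule color_split_floor(4)[OF fl]) simp
qed

lemma floor_at_g: "floor_at X \<Lambda> g = mid"
  by (rule floor_mid) (use g in simp)

lemma plus_minus_mid:
  "{plus_color X \<Lambda> g, minus_color X \<Lambda> g} = (if mid = Cube c then {c} else {c, Suc c})"
proof (cases "mid = Cube c")
  case True
  then show ?thesis by (simp add: plus_color_def minus_color_def color_def floor_at_g)
next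
  case False
  then have "floor_at X \<Lambda> g = Split c (Suc c)" using mid floor_at_g by metis
  from color_split_floor(3)[OF this] show ?thesis using False by (simp only: if_False)
qed

context
  fixes F :: "nat set" and r :: "nat \<Rightarrow> nat" and Q :: "nat set"
  assumes data: "(F, r, Q) \<in> wall_data X \<Lambda>"
begin

abbreviation "V \<equiv> filled_cols F r"
abbreviation "W \<equiv> wall_of X \<Lambda> (F, r, Q)"

text \<open>
  If the middle floor is a cube, both of its signs denote the color of the cube and all runs there
  are empty, so one formula covers both kinds of pattern.
\<close>

lemma floor_count_eq:
  assumes "h \<noteq> 0"
  shows "floor_count X \<Lambda> W i h =
    (if h mod L = 0 then
       (if i = plus_color X \<Lambda> 0 then V h + run_plus r Q h
        else if i = minus_color X \<Lambda> 0 then V h + run_minus r Q h else 0)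
     else if h mod L = g then
       (if i = plus_color X \<Lambda> g then V h + run_plus r Q h
        else if i = minus_color X \<Lambda> g then V h + run_minus r Q h else 0)
     else if i = \<kappa> (if h mod L < g then h mod L else L - h mod L) then V h else 0)"
proof -
  have g0: "g \<noteq> 0" using g by linarith
  consider "h mod L = 0" | "h mod L = g" "mid = Cube c" | "h mod L = g" "mid = Split c (Suc c)"
    | "h mod L \<noteq> 0" "h mod L \<noteq> g" using mid by blast
  then show ?thesis
  proof cases
    case 1
    note fl = floor_bot[OF 1]
    have "floor_at X \<Lambda> h = floor_at X \<Lambda> 0" unfolding fl by (rule floor_bot [symmetric]) simp
    then have "plus_color X \<Lambda> h = plus_color X \<Lambda> 0" "minus_color X \<Lambda> h = minus_color X \<Lambda> 0"
      unfolding plus_color_def minus_color_def by (rule color_cong)+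
    then show ?thesis using floor_count_split[OF split_floor_0 data fl, of i] assms unfolding 1 by simp
  next
    case 2
    have fl: "floor_at X \<Lambda> h = Cube c" using floor_mid[OF 2(1)] 2(2) by simp
    have r: "r h = 0"
      by (rule run_cube[OF split_floor_0 data]) (simp add: split_floor_def fl)
    moreover have pm: "plus_color X \<Lambda> g = c" "minus_color X \<Lambda> g = c"
      using plus_minus_mid 2(2) by auto
    show ?thesis using floor_count_cube[OF split_floor_0 data fl, of i] g0 unfolding 2(1)
      by (simp add: pm run_plus_def r)
  next
    case 3
    have fl: "floor_at X \<Lambda> h = Split c (Suc c)" using floor_mid[OF 3(1)] 3(2) by simp
    have "floor_at X \<Lambda> h = floor_at X \<Lambda> g" unfolding floor_mid[OF 3(1)] floor_at_g ..
    then have "plus_color X \<Lambda> h = plus_color X \<Lambda> g" "minus_color X \<Lambda> h = minus_color X \<Lambda> g"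
      unfolding plus_color_def minus_color_def by (rule color_cong)+
    then show ?thesis using floor_count_split[OF split_floor_0 data fl, of i] assms g0 unfolding 3(1) by simp
  next
    case 4
    from floor_count_cube[OF split_floor_0 data floor_chain[OF 4], of i] show ?thesis
      using 4 by (simp only: if_False)
  qed
qed

lemma floor_count_0:
  "floor_count X \<Lambda> W i 0 =
     (if i = plus_color X \<Lambda> 0 then V 0 div 2
      else if i = minus_color X \<Lambda> 0 then (V 0 + 1) div 2 else 0)"
  by (rule floor_count_bottom[OF split_floor_0 data floor_bot]) simp_all

text \<open>
  Sum the floor counts over a whole number of periods above which the wall is empty and apply
  \<open>content_balance\<close>. The energy comes from exchanging the sum over the floors at
  residue \<open>g\<close> with the sum over the columns, each of which is known by its top.
\<close>

lemma content_iff: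
  "added X \<Lambda> W (plus_color X \<Lambda> 0) = m \<and> added X \<Lambda> W (minus_color X \<Lambda> 0) = m \<and>
   (\<forall>\<rho>\<in>{1..<g}. added X \<Lambda> W (\<kappa> \<rho>) = 2 * m) \<and>
   added X \<Lambda> W (plus_color X \<Lambda> g) = m \<and> added X \<Lambda> W (minus_color X \<Lambda> g) = m
   \<longleftrightarrow> balanced g (F, r, Q) \<and> energy g (F, r, Q) = m"
proof -
  note fins = wall_data_finite[OF split_floor_0 data] and r0 = run_bottom[OF split_floor_0 data]
  obtain H where H: "\<And>h. h \<ge> H \<Longrightarrow> V h = 0" "\<And>h. h \<ge> H \<Longrightarrow> r h = 0"
    using filled_cols_bound[OF fins] by blast
  \<comment> \<open>At least one period, so that the bottom floor is among the summed ones.\<close>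
  define M where "M = Suc H"
  have "1 * M \<le> L * M" using g by (intro mult_le_mono1) simp
  then have "H \<le> L * M" by (simp add: M_def)
  then have top: "V h = 0" "r h = 0" if "h \<ge> L * M" for h using H that by simp_all
  have yw: "young_wall X \<Lambda> W" by (rule young_wall_wall_of[OF split_floor_0 data])
  have below: "h < L * M" if "(k, h, p) \<in> W - ground" for k h p
  proof (rule ccontr)
    assume "\<not> h < L * M"
    then have "V h = 0" "r h = 0" using top by simp_all
    then show False using that by (auto simp: wall_of_def ground_def)
  qed
  have added: "added X \<Lambda> W i = (\<Sum>\<rho><L. \<Sum>a<M. floor_count X \<Lambda> W i (L * a + \<rho>))" for i
    unfolding sum_by_residue [symmetric]
    by (rule added_eq_sum_floor_count) (use yw below in \<open>auto simp: young_wall_def\<close>)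
  define Z where "Z \<rho> = (\<Sum>a<M. V (L * a + \<rho>))" for \<rho>
  define x where "x \<rho> = (\<Sum>a<M. of_bool (L * a + \<rho> \<in> F) :: nat)" for \<rho>
  define RP where "RP \<rho> = (\<Sum>a<M. run_plus r Q (L * a + \<rho>))" for \<rho>
  define RM where "RM \<rho> = (\<Sum>a<M. run_minus r Q (L * a + \<rho>))" for \<rho>
  have Lpos: "0 < L" "g < L" using g by auto
  have mod: "(L * a + \<rho>) mod L = \<rho>" if "\<rho> < L" for a \<rho> using that by simp
  have step: "V h = V (Suc h) + r (Suc h) + of_bool (h \<in> F)" for h
    by (rule filled_cols_Suc[OF fins])
  have Z_Suc: "Z \<rho> = Z (Suc \<rho>) + x \<rho> + RP (Suc \<rho>) + RM (Suc \<rho>)" for \<rho>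
  proof -
    have "V (L * a + \<rho>) = V (L * a + Suc \<rho>) + of_bool (L * a + \<rho> \<in> F)
        + run_plus r Q (L * a + Suc \<rho>) + run_minus r Q (L * a + Suc \<rho>)" for a
      using step[of "L * a + \<rho>"] run_plus_minus[of r "L * a + Suc \<rho>" Q] by simp
    then have "Z \<rho> = (\<Sum>a<M. V (L * a + Suc \<rho>) + of_bool (L * a + \<rho> \<in> F)
        + run_plus r Q (L * a + Suc \<rho>) + run_minus r Q (L * a + Suc \<rho>))"
      unfolding Z_def by (intro sum.cong refl)
    then show ?thesis by (simp only: sum.distrib Z_def x_def RP_def RM_def)
  qed
  have no_run: "RP \<rho> = 0 \<and> RM \<rho> = 0" if "\<rho> < L" "\<rho> \<noteq> 0" "\<rho> \<noteq> g" for \<rho>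
  proof -
    have "r (L * a + \<rho>) = 0" for a
      by (rule run_cube[OF split_floor_0 data]) (simp add: split_floor_iff mod that)
    then show ?thesis by (simp add: RP_def RM_def run_plus_def run_minus_def)
  qed
  \<comment> \<open>Residue \<open>L\<close> is residue \<open>0\<close> of the next period, so only the bottom floor is lost.\<close>
  have wrap: "(\<Sum>a<M. f (L * a + L)) + f 0 = (\<Sum>a<M. f (L * a)) + f (L * M)" for f :: "nat \<Rightarrow> nat"
  proof -
    have "(\<Sum>a<Suc M. f (L * a)) = f 0 + (\<Sum>a<M. f (L * a + L))"
      by (simp add: sum.lessThan_Suc_shift del: sum.lessThan_Suc) (simp add: algebra_simps)
    then show ?thesis by simp
  qed
  have ZL: "Z L + V 0 = Z 0" "RP L = RP 0" "RM L = RM 0"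
    using wrap[of V] wrap[of "run_plus r Q"] wrap[of "run_minus r Q"] top[of "L * M"] r0
    by (simp_all add: Z_def RP_def RM_def run_plus_def run_minus_def)
  have only: "added X \<Lambda> W i = (\<Sum>\<rho>\<in>R. \<Sum>a<M. floor_count X \<Lambda> W i (L * a + \<rho>))"
    if "R \<subseteq> {..<L}" "\<And>\<rho> a. \<rho> < L \<Longrightarrow> \<rho> \<notin> R \<Longrightarrow> floor_count X \<Lambda> W i (L * a + \<rho>) = 0" for i R
    unfolding added using that by (intro sum.mono_neutral_right) auto
  have bots: "plus_color X \<Lambda> 0 \<in> {bot, Suc bot}" "minus_color X \<Lambda> 0 \<in> {bot, Suc bot}"
    using plus_minus_bot(1) by auto
  have mids: "plus_color X \<Lambda> g \<in> {c, Suc c}" "minus_color X \<Lambda> g \<in> {c, Suc c}"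
    using plus_minus_mid by (auto split: if_splits)
  have chain: "(if \<rho> < g then \<rho> else L - \<rho>) \<in> {1..<g}" if "\<rho> < L" "\<rho> \<noteq> 0" "\<rho> \<noteq> g" for \<rho>
    using that by auto
  have fc: "floor_count X \<Lambda> W i (L * a + \<rho>) =
      (if \<rho> = g then
       (if i = plus_color X \<Lambda> g then V (L * a + \<rho>) + run_plus r Q (L * a + \<rho>)
        else if i = minus_color X \<Lambda> g then V (L * a + \<rho>) + run_minus r Q (L * a + \<rho>) else 0)
      else if i = \<kappa> (if \<rho> < g then \<rho> else L - \<rho>) then V (L * a + \<rho>) else 0)"
    if "\<rho> < L" "\<rho> \<noteq> 0" for i a \<rho>
    using floor_count_eq[of "L * a + \<rho>" i] that unfolding mod[OF that(1)] by simp
  have fc0: "floor_count X \<Lambda> W i (L * a) = 0"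
    if "i \<noteq> plus_color X \<Lambda> 0" "i \<noteq> minus_color X \<Lambda> 0" for i a
    using floor_count_0[of i] floor_count_eq[of "L * a" i] that g by (cases "a = 0") auto
  have bot_only: "added X \<Lambda> W i = (\<Sum>a<M. floor_count X \<Lambda> W i (L * a))" if i: "i \<in> {bot, Suc bot}" for i
  proof -
    have "added X \<Lambda> W i = (\<Sum>\<rho>\<in>{0}. \<Sum>a<M. floor_count X \<Lambda> W i (L * a + \<rho>))"
    proof (rule only)
      fix \<rho> a assume \<rho>: "\<rho> < L" "\<rho> \<notin> {0}"
      have "i \<notin> {c, Suc c}" using i bot_fresh by blast
      moreover have "i \<noteq> \<kappa> (if \<rho> < g then \<rho> else L - \<rho>)" if "\<rho> \<noteq> g"
      proof -
        have "\<kappa> (if \<rho> < g then \<rho> else L - \<rho>) \<notin> {bot, Suc bot, c, Suc c}"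
          by (rule \<kappa>_fresh[OF chain]) (use \<rho> that in auto)
        then show ?thesis using i by blast
      qed
      ultimately show "floor_count X \<Lambda> W i (L * a + \<rho>) = 0"
        using fc[of \<rho> i a] \<rho> mids by auto
    qed (use g in simp)
    then show ?thesis by simp
  qed
  have cp: "added X \<Lambda> W (plus_color X \<Lambda> 0) + (V 0 + 1) div 2 = Z 0 + RP 0"
  proof -
    have "(\<Sum>a<M. floor_count X \<Lambda> W (plus_color X \<Lambda> 0) (L * a)) + (V 0 + 1) div 2
        = (\<Sum>a<M. V (L * a) + run_plus r Q (L * a))"
      unfolding M_def sum.lessThan_Suc_shift
      using floor_count_0[of "plus_color X \<Lambda> 0"] floor_count_eq[of _ "plus_color X \<Lambda> 0"] Lpos r0
      by (simp add: run_plus_def)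
    then show ?thesis using bot_only[OF bots(1)] by (simp add: Z_def RP_def sum.distrib)
  qed
  have cm: "added X \<Lambda> W (minus_color X \<Lambda> 0) + V 0 div 2 = Z 0 + RM 0"
  proof -
    have "(\<Sum>a<M. floor_count X \<Lambda> W (minus_color X \<Lambda> 0) (L * a)) + V 0 div 2
        = (\<Sum>a<M. V (L * a) + run_minus r Q (L * a))"
      unfolding M_def sum.lessThan_Suc_shift
      using floor_count_0[of "minus_color X \<Lambda> 0"] floor_count_eq[of _ "minus_color X \<Lambda> 0"] Lpos r0
        plus_minus_bot(2)
      by (simp add: run_minus_def)
    then show ?thesis using bot_only[OF bots(2)] by (simp add: Z_def RM_def sum.distrib)
  qed
  have mid_only: "added X \<Lambda> W i = (\<Sum>a<M. floor_count X \<Lambda> W i (L * a + g))" if i: "i \<in> {c, Suc c}" for i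
  proof -
    have "added X \<Lambda> W i = (\<Sum>\<rho>\<in>{g}. \<Sum>a<M. floor_count X \<Lambda> W i (L * a + \<rho>))"
    proof (rule only)
      fix \<rho> a assume \<rho>: "\<rho> < L" "\<rho> \<notin> {g}"
      have "i \<notin> {bot, Suc bot}" using i bot_fresh by blast
      then have "floor_count X \<Lambda> W i (L * a) = 0" using fc0[of i a] bots by blast
      moreover have "i \<noteq> \<kappa> (if \<rho> < g then \<rho> else L - \<rho>)" if "\<rho> \<noteq> 0"
      proof -
        have "\<kappa> (if \<rho> < g then \<rho> else L - \<rho>) \<notin> {bot, Suc bot, c, Suc c}"
          by (rule \<kappa>_fresh[OF chain]) (use \<rho> that in auto)
        then show ?thesis using i by blast
      qed
      ultimately show "floor_count X \<Lambda> W i (L * a + \<rho>) = 0"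
        using fc[of \<rho> i a] \<rho> by (cases "\<rho> = 0") auto
    qed (use g in simp)
    then show ?thesis by simp
  qed
  have mp: "added X \<Lambda> W (plus_color X \<Lambda> g) = Z g + RP g"
    unfolding mid_only[OF mids(1)] using fc[of g] g by (simp add: Z_def RP_def sum.distrib)
  have mm: "added X \<Lambda> W (minus_color X \<Lambda> g) = Z g + RM g"
  proof (cases "mid = Cube c")
    case True
    then have "minus_color X \<Lambda> g = plus_color X \<Lambda> g" using plus_minus_mid by (simp add: doubleton_eq_iff)
    moreover have "r (L * a + g) = 0" for a
      by (rule run_cube[OF split_floor_0 data]) (use g True in \<open>simp add: split_floor_iff\<close>)
    then have "RP g = 0" "RM g = 0" by (simp_all add: RP_def RM_def run_plus_def run_minus_def)
    ultimately show ?thesis using mp by simp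
  next
    case False
    then have "minus_color X \<Lambda> g \<noteq> plus_color X \<Lambda> g" using plus_minus_mid by auto
    then show ?thesis
      unfolding mid_only[OF mids(2)] using fc[of g] g by (simp add: Z_def RM_def sum.distrib)
  qed
  have ch: "added X \<Lambda> W (\<kappa> \<rho>) = Z \<rho> + Z (L - \<rho>)" if \<rho>: "\<rho> \<in> {1..<g}" for \<rho>
  proof -
    have fresh: "\<kappa> \<rho> \<notin> {bot, Suc bot, c, Suc c}" using \<kappa>_fresh \<rho> by blast
    have eq: "\<kappa> \<rho> = \<kappa> (if \<sigma> < g then \<sigma> else L - \<sigma>) \<longleftrightarrow> \<sigma> \<in> {\<rho>, L - \<rho>}"
      if "\<sigma> < L" "\<sigma> \<noteq> 0" "\<sigma> \<noteq> g" for \<sigma>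
      using inj_on_eq_iff[OF inj_\<kappa> \<rho> chain[OF that]] that \<rho> by auto
    have "added X \<Lambda> W (\<kappa> \<rho>) = (\<Sum>\<sigma>\<in>{\<rho>, L - \<rho>}. \<Sum>a<M. floor_count X \<Lambda> W (\<kappa> \<rho>) (L * a + \<sigma>))"
    proof (rule only)
      fix \<sigma> a assume \<sigma>: "\<sigma> < L" "\<sigma> \<notin> {\<rho>, L - \<rho>}"
      have "\<kappa> \<rho> \<noteq> plus_color X \<Lambda> 0" "\<kappa> \<rho> \<noteq> minus_color X \<Lambda> 0" using bots fresh by auto
      then have "floor_count X \<Lambda> W (\<kappa> \<rho>) (L * a) = 0" by (rule fc0)
      moreover have "floor_count X \<Lambda> W (\<kappa> \<rho>) (L * a + \<sigma>) = 0" if "\<sigma> \<noteq> 0"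
      proof (cases "\<sigma> = g")
        case True
        have "\<kappa> \<rho> \<noteq> plus_color X \<Lambda> g" "\<kappa> \<rho> \<noteq> minus_color X \<Lambda> g" using mids fresh by auto
        then show ?thesis unfolding fc[OF \<sigma>(1) that] using True by (simp only: if_True if_False simp_thms)
      next
        case False
        then have "\<kappa> \<rho> \<noteq> \<kappa> (if \<sigma> < g then \<sigma> else L - \<sigma>)" using eq[of \<sigma>] \<sigma> that by blast
        then show ?thesis unfolding fc[OF \<sigma>(1) that] using False by (simp only: if_False)
      qed
      ultimately show "floor_count X \<Lambda> W (\<kappa> \<rho>) (L * a + \<sigma>) = 0" by (cases "\<sigma> = 0") simp_all
    qed (use \<rho> in auto)
    also have "\<dots> = (\<Sum>\<sigma>\<in>{\<rho>, L - \<rho>}. Z \<sigma>)"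
    proof (rule sum.cong)
      fix \<sigma> assume \<sigma>: "\<sigma> \<in> {\<rho>, L - \<rho>}"
      then have *: "\<sigma> < L" "\<sigma> \<noteq> 0" "\<sigma> \<noteq> g" using \<rho> by auto
      show "(\<Sum>a<M. floor_count X \<Lambda> W (\<kappa> \<rho>) (L * a + \<sigma>)) = Z \<sigma>"
      proof -
        have "\<kappa> \<rho> = \<kappa> (if \<sigma> < g then \<sigma> else L - \<sigma>)" using eq[OF *] \<sigma> by blast
        then show ?thesis unfolding Z_def fc[OF *(1,2)] using *(3) by (simp only: if_False if_True simp_thms)
      qed
    qed simp
    also have "\<dots> = Z \<rho> + Z (L - \<rho>)"
    proof -
      have "\<rho> \<noteq> L - \<rho>" using \<rho> by auto
      then show ?thesis by simp
    qed
    finally show ?thesis .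
  qed
  let ?S = "{h. r h \<noteq> 0}"
  have FS: "h < L * M" if "h \<in> F" for h
    using step[of h] top(1)[of h] that by (cases "h < L * M") auto
  have SS: "h < L * M" if "h \<in> ?S" for h
    using top(2)[of h] that by (cases "h < L * M") auto
  have x: "x \<rho> = card {h \<in> F. h mod L = \<rho>}" if "\<rho> < L" for \<rho>
  proof -
    have "x \<rho> = (\<Sum>h\<in>{h \<in> F. h mod L = \<rho>}. of_bool (h \<in> F))"
      unfolding x_def by (rule sum_residue_class[OF that]) (auto intro: FS)
    also have "\<dots> = (\<Sum>h\<in>{h \<in> F. h mod L = \<rho>}. 1)" by (rule sum.cong) auto
    finally show ?thesis by simp
  qed
  have S: "{h. r h \<noteq> 0 \<and> h mod L = \<rho>} = {h \<in> ?S. h mod L = \<rho>}" for \<rho> by auto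
  have RP: "RP \<rho> = (\<Sum>h | r h \<noteq> 0 \<and> h mod L = \<rho>. run_plus r Q h)" if "\<rho> < L" for \<rho>
    unfolding RP_def S by (rule sum_residue_class[OF that SS]) (auto simp: run_plus_def)
  have RM: "RM \<rho> = (\<Sum>h | r h \<noteq> 0 \<and> h mod L = \<rho>. run_minus r Q h)" if "\<rho> < L" for \<rho>
    unfolding RM_def S by (rule sum_residue_class[OF that SS]) (auto simp: run_minus_def)
  have Zg: "Z g = (\<Sum>h\<in>F. (h + g) div L) + (\<Sum>h\<in>?S. r h * (h div L))"
  proof -
    have V: "V t = (\<Sum>h\<in>F. of_bool (t \<le> h)) + (\<Sum>h\<in>?S. r h * of_bool (t < h))" for t
    proof -
      have "card (F \<inter> {t..}) = (\<Sum>h\<in>F. of_bool (t \<le> h))"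
        using fins(1) by (simp add: sum_of_bool_eq Int_def)
      moreover have "(\<Sum>h | t < h \<and> r h \<noteq> 0. r h) = (\<Sum>h\<in>?S. r h * of_bool (t < h))"
        using fins(2) by (intro sum.mono_neutral_cong_left) auto
      ultimately show ?thesis by (simp add: filled_cols_def)
    qed
    have countF: "(\<Sum>a<M. of_bool (L * a + g \<le> h)) = (h + g) div L" if "h < L * M" for h
    proof -
      have iff: "L * a + g \<le> h \<longleftrightarrow> a < (h + g) div L" for a
      proof -
        have "a < (h + g) div L \<longleftrightarrow> Suc a * L \<le> h + g"
          unfolding Suc_le_eq [symmetric] by (rule less_eq_div_iff_mult_less_eq[OF Lpos(1)])
        moreover have "Suc a * L = L * a + g + g" by simp
        ultimately show ?thesis by linarith
      qed
      have le: "(h + g) div L \<le> M"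
      proof -
        have "Suc M * L = L * M + g + g" by simp
        then have "h + g < Suc M * L" using that Lpos by linarith
        then have "(h + g) div L < Suc M" by (rule less_mult_imp_div_less)
        then show ?thesis by simp
      qed
      have "(\<Sum>a<M. of_bool (L * a + g \<le> h)) = (\<Sum>a<(h + g) div L. 1 :: nat)"
        unfolding iff using le by (intro sum.mono_neutral_cong_right) auto
      then show ?thesis by simp
    qed
    have countS: "(\<Sum>a<M. of_bool (L * a + g < h)) = h div L" if "h < L * M" "h mod L = 0 \<or> h mod L = g" for h
    proof -
      have h: "h = L * (h div L) + h mod L" by simp
      have iff: "L * a + g < h \<longleftrightarrow> a < h div L" for a
      proof
        assume "a < h div L"
        then have "L * Suc a \<le> L * (h div L)" by (intro mult_le_mono2) simp
        moreover have "L * Suc a = L * a + g + g" by simp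
        ultimately show "L * a + g < h" using h Lpos by linarith
      next
        assume a: "L * a + g < h"
        then have "L * a < L * (h div L)" using h that(2) by linarith
        then show "a < h div L" by simp
      qed
      have "h < M * L" using that(1) by (simp only: mult.commute)
      then have le: "h div L < M" by (rule less_mult_imp_div_less)
      have "(\<Sum>a<M. of_bool (L * a + g < h)) = (\<Sum>a<h div L. 1 :: nat)"
        unfolding iff using le by (intro sum.mono_neutral_cong_right) auto
      then show ?thesis by simp
    qed
    have "Z g = (\<Sum>h\<in>F. \<Sum>a<M. of_bool (L * a + g \<le> h)) + (\<Sum>h\<in>?S. r h * (\<Sum>a<M. of_bool (L * a + g < h)))"
      unfolding Z_def V sum.distrib sum_distrib_left by (intro arg_cong2[where f = "(+)"] sum.swap)
    also have "\<dots> = (\<Sum>h\<in>F. (h + g) div L) + (\<Sum>h\<in>?S. r h * (h div L))"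
    proof (intro arg_cong2[where f = "(+)"] sum.cong refl)
      fix h assume "h \<in> F"
      then show "(\<Sum>a<M. of_bool (L * a + g \<le> h)) = (h + g) div L" by (intro countF FS)
    next
      fix h assume h: "h \<in> ?S"
      then have "split_floor X \<Lambda> h" using run_cube[OF split_floor_0 data, of h] by auto
      then have "h mod L = 0 \<or> h mod L = g" by (auto simp: split_floor_iff)
      then show "r h * (\<Sum>a<M. of_bool (L * a + g < h)) = r h * (h div L)" using countS[OF SS[OF h]] by simp
    qed
    finally show ?thesis .
  qed
  have "balanced g (F, r, Q) \<longleftrightarrow>
      (\<forall>\<rho><g. x \<rho> = x (2 * g - 1 - \<rho>)) \<and> RP 0 = RM 0 + V 0 mod 2 \<and> RP g = RM g"
    unfolding balanced_def using Lpos by (auto simp: x RP RM)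
  moreover have "energy g (F, r, Q) = Z g + RP g"
    unfolding energy_def Zg using Lpos by (simp add: RP)
  moreover have "added X \<Lambda> W (plus_color X \<Lambda> 0) = m \<and> added X \<Lambda> W (minus_color X \<Lambda> 0) = m \<and>
      (\<forall>\<rho>\<in>{1..<g}. Z \<rho> + Z (2 * g - \<rho>) = 2 * m) \<and> Z g + RP g = m \<and> Z g + RM g = m \<longleftrightarrow>
      (\<forall>\<rho><g. x \<rho> = x (2 * g - 1 - \<rho>)) \<and> RP 0 = RM 0 + V 0 mod 2 \<and> RP g = RM g \<and> Z g + RP g = m"
  proof (rule content_balance[OF g])
    show "Z \<rho> = Z (Suc \<rho>) + x \<rho>" if "Suc \<rho> < 2 * g" "Suc \<rho> \<noteq> g" for \<rho>
      using Z_Suc[of \<rho>] no_run[of "Suc \<rho>"] that by simp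
    show "Z (g - 1) = Z g + x (g - 1) + RP g + RM g"
      using Z_Suc[of "g - 1"] g by simp
    show "Z (2 * g - 1) + V 0 = Z 0 + x (2 * g - 1) + RP 0 + RM 0"
      using Z_Suc[of "2 * g - 1"] ZL g by simp
  qed (fact cp cm)+
  ultimately show ?thesis using mp mm ch by auto
qed

end

end

section \<open>Splitting balanced data into independent parts\<close>

text \<open>
  The parity in the balance of the bottom half blocks leaves only two possible excesses.
\<close>

lemma even_offset_cases:
  "(a :: nat) = b + (a + b) mod 2 \<longleftrightarrow> a = b \<or> a = b + 1"
  by presburger

definition full_tops :: "nat \<Rightarrow> nat set set" where
  "full_tops g = {F. finite F \<and>
     (\<forall>\<rho><g. card {h \<in> F. h mod (2 * g) = \<rho>} = card {h \<in> F. h mod (2 * g) = 2 * g - 1 - \<rho>})}"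

definition bottom_nodes :: "nat \<Rightarrow> nat set" where
  "bottom_nodes g = {h. 1 \<le> h \<and> h mod (2 * g) = 0}"

definition middle_nodes :: "nat \<Rightarrow> nat \<Rightarrow> nat set" where
  "middle_nodes st g = {h. st dvd h \<and> h mod (2 * g) = g}"

text \<open>
  \<open>P\<close> and \<open>Q\<close> are the floors whose run has an extra \<open>+\<close> and
  an extra \<open>-\<close>, respectively.
\<close>

definition bottom_runs :: "nat \<Rightarrow> (nat set \<times> nat set) set" where
  "bottom_runs g = {(P, Q). finite P \<and> finite Q \<and> P \<subseteq> bottom_nodes g \<and> Q \<subseteq> bottom_nodes g \<and> (card P = card Q \<or> card P = card Q + 1)}"

definition middle_runs :: "nat \<Rightarrow> nat \<Rightarrow> (nat set \<times> nat set) set" where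
  "middle_runs st g = {(P, Q). finite P \<and> finite Q \<and> P \<subseteq> middle_nodes st g \<and> Q \<subseteq> middle_nodes st g \<and> card P = card Q}"

text \<open>
  The summand of \<open>h\<close> is the number of floors at residue \<open>g\<close> up to and
  including \<open>h\<close>.
\<close>

definition full_weight :: "nat \<Rightarrow> nat set \<Rightarrow> nat" where
  "full_weight g F = (\<Sum>h\<in>F. (h + g) div (2 * g))"

definition run_weight :: "nat \<Rightarrow> nat set \<times> nat set \<Rightarrow> nat" where
  "run_weight g = (\<lambda>(P, Q). (\<Sum>h\<in>P. (h + g) div (2 * g)) + (\<Sum>h\<in>Q. h div (2 * g)))"

text \<open>
  \<open>p a\<close> is the number of pairs of opposite half blocks on the split floor \<open>st *
  Suc a\<close>. The bottom floor has no run.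
\<close>

definition run_pairs :: "nat \<Rightarrow> (nat \<Rightarrow> nat) \<Rightarrow> nat \<Rightarrow> nat" where
  "run_pairs st p h = (if 1 \<le> h \<and> st dvd h then p (h div st - 1) else 0)"

text \<open>
  A run that starts with \<open>-\<close> always counts as having an extra \<open>-\<close>; then
  an even length means an extra \<open>+\<close> as well. In this way the first color is recorded
  by membership in \<open>Q\<close>, and the run has exactly \<open>run_pairs\<close> plus the
  extra half blocks of either sign.
\<close>

definition run_lengths :: "nat \<Rightarrow> nat set \<Rightarrow> nat set \<Rightarrow> (nat \<Rightarrow> nat) \<Rightarrow> nat \<Rightarrow> nat" where
  "run_lengths st P Q p h = 2 * run_pairs st p h + of_bool (h \<in> P) + of_bool (h \<in> Q)"

definition assemble :: "nat \<Rightarrow> nat set \<times> (nat set \<times> nat set) \<times> (nat set \<times> nat set) \<times> (nat \<Rightarrow> nat)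
    \<Rightarrow> nat set \<times> (nat \<Rightarrow> nat) \<times> nat set" where
  "assemble st = (\<lambda>(F, (P, Q), (P', Q'), p). (F, run_lengths st (P \<union> P') (Q \<union> Q') p, Q \<union> Q'))"

text \<open>
  Recovers the runs with an extra \<open>+\<close>.
\<close>

definition odd_part :: "(nat \<Rightarrow> nat) \<Rightarrow> nat set \<Rightarrow> nat set" where
  "odd_part r Q = {h. odd (r h - of_bool (h \<in> Q))}"

definition disassemble :: "nat \<Rightarrow> nat \<Rightarrow> nat set \<times> (nat \<Rightarrow> nat) \<times> nat set
    \<Rightarrow> nat set \<times> (nat set \<times> nat set) \<times> (nat set \<times> nat set) \<times> (nat \<Rightarrow> nat)" where
  "disassemble st g = (\<lambda>(F, r, Q).
     (F, (odd_part r Q \<inter> bottom_nodes g, Q \<inter> bottom_nodes g),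
         (odd_part r Q \<inter> middle_nodes st g, Q \<inter> middle_nodes st g),
         \<lambda>a. (r (st * Suc a) - of_bool (st * Suc a \<in> Q)) div 2))"

lemma run_plus_lengths: "run_plus (run_lengths st P Q p) Q h = run_pairs st p h + of_bool (h \<in> P)"
  by (auto simp: run_plus_def run_lengths_def)

lemma run_minus_lengths: "run_minus (run_lengths st P Q p) Q h = run_pairs st p h + of_bool (h \<in> Q)"
  by (auto simp: run_minus_def run_lengths_def)

lemma finite_run_pairs:
  assumes "0 < st" "p \<in> part_mults"
  shows "finite {h. run_pairs st p h \<noteq> 0}"
proof -
  have "{h. run_pairs st p h \<noteq> 0} \<subseteq> (\<lambda>a. st * Suc a) ` {a. p a \<noteq> 0}"
  proof
    fix h assume "h \<in> {h. run_pairs st p h \<noteq> 0}"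
    then have h: "1 \<le> h" "st dvd h" "p (h div st - 1) \<noteq> 0"
      by (auto simp: run_pairs_def split: if_splits)
    then obtain b where b: "h = st * b" by blast
    with h(1) obtain a where "b = Suc a" by (cases b) auto
    then show "h \<in> (\<lambda>a. st * Suc a) ` {a. p a \<noteq> 0}" using h(3) b assms(1) by auto
  qed
  then show ?thesis using assms(2) by (auto simp: part_mults_def intro: finite_subset)
qed

lemma run_pairs_node: "0 < st \<Longrightarrow> run_pairs st p (st * Suc a) = p a"
  by (simp add: run_pairs_def del: mult_Suc_right)

definition node_data :: "nat set \<Rightarrow> (nat set \<times> (nat \<Rightarrow> nat) \<times> nat set) set" where
  "node_data N = {(F, r, Q). finite F \<and> finite {h. r h \<noteq> 0} \<and> (\<forall>h. r h \<noteq> 0 \<longrightarrow> h \<in> N) \<and> Q \<subseteq> {h. r h \<noteq> 0}}"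

text \<open>
  \<open>N\<close> is the set of split floors above the bottom. They are the multiples of the
  period if the middle floor is a cube and of half the period if it is split; \<open>d\<close> is
  the energy of a pair on the lowest of them.
\<close>

locale run_assembly =
  fixes g st d :: nat and N :: "nat set"
  assumes g: "2 \<le> g" and st: "st = 2 * g \<and> d = 2 \<or> st = g \<and> d = 1"
    and N_def: "N = {h. 1 \<le> h \<and> st dvd h}"
begin

lemma st_pos: "0 < st" using g st by auto

lemma node_mod: "st dvd h \<Longrightarrow> h mod (2 * g) = 0 \<or> h mod (2 * g) = g"
proof -
  assume "st dvd h"
  then have "g dvd h" using st by (auto intro: dvd_trans[of g "2 * g"])
  then obtain b where b: "h = g * b" by blast
  have "g * b mod (g * 2) = g * (b mod 2)" by (rule mult_mod_right [symmetric])
  then have "h mod (2 * g) = g * (b mod 2)" unfolding b by (simp only: mult.commute[of g 2])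
  then show ?thesis by (cases "b mod 2 = 0") auto
qed

lemma shifted_div:
  assumes "h mod (2 * g) = 0 \<or> h mod (2 * g) = g"
  shows "(h + g) div (2 * g) = h div (2 * g) + of_bool (h mod (2 * g) = g)"
proof -
  define b where "b = h div (2 * g)"
  have h: "h = 2 * g * b + h mod (2 * g)" by (simp add: b_def)
  from assms show ?thesis
  proof
    assume m: "h mod (2 * g) = 0"
    then have "(h + g) div (2 * g) = (g + b * (2 * g)) div (2 * g)" using h by (simp add: mult.commute add.commute)
    also have "\<dots> = b" using g by simp
    finally show ?thesis using m g by (simp add: b_def)
  next
    assume m: "h mod (2 * g) = g"
    have "h + g = Suc b * (2 * g)" using h unfolding m by (simp add: mult.commute)
    then have "(h + g) div (2 * g) = Suc b" using g by simp
    then show ?thesis using m by (simp add: b_def)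
  qed
qed

lemma bottom_node: "h mod (2 * g) = 0 \<Longrightarrow> st dvd h"
  using st by (auto simp: mod_eq_0_iff_dvd intro: dvd_trans[of g "2 * g"])

text \<open>
  At the bottom residue both half blocks of a pair carry the number of full periods below them; at
  the middle residue one of them carries one more, since it adds a block to the middle floor. In
  terms of the index of the split floor both cases are the same linear function.
\<close>

lemma part_weight_run_pairs:
  assumes p: "p \<in> part_mults" and S: "finite S" "{h. run_pairs st p h \<noteq> 0} \<subseteq> S"
  shows "(\<Sum>h\<in>S. run_pairs st p h * (2 * (h div (2 * g)) + of_bool (h mod (2 * g) = g))) = part_weight d p"
proof -
  let ?f = "\<lambda>h. run_pairs st p h * (2 * (h div (2 * g)) + of_bool (h mod (2 * g) = g))"
  have val: "2 * ((st * Suc a) div (2 * g)) + of_bool ((st * Suc a) mod (2 * g) = g) = d * Suc a" for a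
  proof (cases "st = 2 * g")
    case True
    then have "d = 2" using st g by auto
    then show ?thesis unfolding True using g by simp
  next
    case False
    then have sd: "st = g" "d = 1" using st by auto
    have "g * Suc a div (g * 2) = Suc a div 2" using g by (intro div_mult_mult1) simp
    moreover have "g * Suc a mod (g * 2) = g * (Suc a mod 2)" by (rule mult_mod_right [symmetric])
    moreover have "of_bool (g * (Suc a mod 2) = g) = Suc a mod 2"
      using g by (cases "Suc a mod 2 = 0") simp_all
    ultimately have "2 * (g * Suc a div (g * 2)) + of_bool (g * Suc a mod (g * 2) = g) = Suc a"
      by (simp only: mult_div_mod_eq)
    then show ?thesis unfolding sd by (simp only: mult.commute[of g 2] mult_1)
  qed
  have inj: "inj_on (\<lambda>a. st * Suc a) {a. p a \<noteq> 0}" using st_pos by (auto simp: inj_on_def)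
  have sub: "(\<lambda>a. st * Suc a) ` {a. p a \<noteq> 0} \<subseteq> S"
    using S(2) run_pairs_node[OF st_pos, of p] by auto
  have "sum ?f S = sum ?f ((\<lambda>a. st * Suc a) ` {a. p a \<noteq> 0})"
  proof (rule sum.mono_neutral_right[OF S(1) sub])
    show "\<forall>h\<in>S - (\<lambda>a. st * Suc a) ` {a. p a \<noteq> 0}. ?f h = 0"
    proof
      fix h assume h: "h \<in> S - (\<lambda>a. st * Suc a) ` {a. p a \<noteq> 0}"
      have "run_pairs st p h = 0"
      proof (rule ccontr)
        assume nz: "run_pairs st p h \<noteq> 0"
        then have "1 \<le> h" "st dvd h" by (auto simp: run_pairs_def split: if_splits)
        then obtain a where a: "h = st * Suc a" by (metis dvdE mult_0_right not0_implies_Suc not_one_le_zero)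
        then have "p a \<noteq> 0" using nz run_pairs_node[OF st_pos, of p a] by simp
        then show False using h a by blast
      qed
      then show "?f h = 0" by simp
    qed
  qed
  also have "\<dots> = (\<Sum>a | p a \<noteq> 0. p a * (d * Suc a))"
    unfolding sum.reindex[OF inj] o_def by (simp only: val run_pairs_node[OF st_pos])
  also have "\<dots> = part_weight d p" unfolding part_weight_def by (simp only: mult.commute)
  finally show ?thesis .
qed

text \<open>
  The residue conditions on split floors thus become membership in one of two disjoint sets.
\<close>

lemma node_iff: "h \<in> N \<longleftrightarrow> h \<in> bottom_nodes g \<or> h \<in> middle_nodes st g"
proof -
  have "h \<noteq> 0" if "h mod (2 * g) = g" using that g by (cases "h = 0") auto
  then show ?thesis using bottom_node[of h] node_mod[of h]
    unfolding N_def bottom_nodes_def middle_nodes_def mem_Collect_eq by (metis less_one not_le)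
qed

lemma node_residue:
  assumes "h \<in> N"
  shows "h mod (2 * g) = 0 \<longleftrightarrow> h \<in> bottom_nodes g" and "h mod (2 * g) = g \<longleftrightarrow> h \<in> middle_nodes st g"
  using assms unfolding N_def bottom_nodes_def middle_nodes_def by (simp_all only: mem_Collect_eq simp_thms)

lemma nodes_disjoint: "bottom_nodes g \<inter> middle_nodes st g = {}"
proof -
  have "g \<noteq> 0" using g by linarith
  have "\<not> (h \<in> bottom_nodes g \<and> h \<in> middle_nodes st g)" for h
  proof
    assume "h \<in> bottom_nodes g \<and> h \<in> middle_nodes st g"
    then have *: "(1 \<le> h \<and> h mod (2 * g) = 0) \<and> st dvd h \<and> h mod (2 * g) = g"
      unfolding bottom_nodes_def middle_nodes_def mem_Collect_eq .
    have "g = h mod (2 * g)" by (rule *[THEN conjunct2, THEN conjunct2, symmetric])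
    also have "\<dots> = 0" by (rule *[THEN conjunct1, THEN conjunct2])
    finally show False using \<open>g \<noteq> 0\<close> by contradiction
  qed
  then show ?thesis by blast
qed

context
  fixes F P Q P' Q' :: "nat set" and p :: "nat \<Rightarrow> nat"
  assumes parts_finite: "finite F" "finite P" "finite Q" "finite P'" "finite Q'"
    and bottom: "P \<union> Q \<subseteq> bottom_nodes g"
    and middle: "P' \<union> Q' \<subseteq> middle_nodes st g"
    and p: "p \<in> part_mults"
begin

abbreviation "runs \<equiv> run_lengths st (P \<union> P') (Q \<union> Q') p"

lemma parts_node: "P \<union> P' \<union> Q \<union> Q' \<subseteq> N"
  using bottom middle node_iff by blast

lemma support_node: "runs h \<noteq> 0 \<Longrightarrow> h \<in> N"
  using parts_node by (auto simp: run_lengths_def run_pairs_def N_def split: if_splits)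

lemma support_finite: "finite {h. runs h \<noteq> 0}"
proof -
  have "{h. runs h \<noteq> 0} \<subseteq> {h. run_pairs st p h \<noteq> 0} \<union> P \<union> P' \<union> Q \<union> Q'"
    by (auto simp: run_lengths_def)
  then show ?thesis
    by (rule finite_subset) (use finite_run_pairs[OF st_pos p] parts_finite in simp)
qed

lemma sum_of_bool_mem: "finite S \<Longrightarrow> (\<Sum>h\<in>S. of_bool (h \<in> A)) = card (S \<inter> A)"
  unfolding card_eq_sum by (intro sum.mono_neutral_cong_right) auto

lemma parts_support: "P \<union> P' \<union> Q \<union> Q' \<subseteq> {h. runs h \<noteq> 0}"
  by (auto simp: run_lengths_def)

lemma parts_disjoint: "P \<inter> P' = {}" "Q \<inter> Q' = {}"
  using bottom middle nodes_disjoint by blast+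

lemma parts_by_residue:
  "(P \<union> P') \<inter> bottom_nodes g = P" "(Q \<union> Q') \<inter> bottom_nodes g = Q"
  "(P \<union> P') \<inter> middle_nodes st g = P'" "(Q \<union> Q') \<inter> middle_nodes st g = Q'"
  using bottom middle nodes_disjoint by blast+

lemma support_by_residue:
  "{h. runs h \<noteq> 0 \<and> h mod (2 * g) = 0} = {h. runs h \<noteq> 0} \<inter> bottom_nodes g"
  "{h. runs h \<noteq> 0 \<and> h mod (2 * g) = g} = {h. runs h \<noteq> 0} \<inter> middle_nodes st g"
proof -
  have "runs h \<noteq> 0 \<and> h mod (2 * g) = 0 \<longleftrightarrow> runs h \<noteq> 0 \<and> h \<in> bottom_nodes g"
    "runs h \<noteq> 0 \<and> h mod (2 * g) = g \<longleftrightarrow> runs h \<noteq> 0 \<and> h \<in> middle_nodes st g" for h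
    by (rule conj_cong[OF refl], rule node_residue[OF support_node], assumption)+
  then show "{h. runs h \<noteq> 0 \<and> h mod (2 * g) = 0} = {h. runs h \<noteq> 0} \<inter> bottom_nodes g"
    "{h. runs h \<noteq> 0 \<and> h mod (2 * g) = g} = {h. runs h \<noteq> 0} \<inter> middle_nodes st g"
    by (simp_all only: set_eq_iff Int_iff mem_Collect_eq simp_thms)
qed

lemma card_parts:
  "card ({h. runs h \<noteq> 0} \<inter> bottom_nodes g \<inter> (P \<union> P')) = card P"
  "card ({h. runs h \<noteq> 0} \<inter> bottom_nodes g \<inter> (Q \<union> Q')) = card Q"
  "card ({h. runs h \<noteq> 0} \<inter> middle_nodes st g \<inter> (P \<union> P')) = card P'"
  "card ({h. runs h \<noteq> 0} \<inter> middle_nodes st g \<inter> (Q \<union> Q')) = card Q'"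
  by (rule arg_cong[where f = card], use parts_support parts_by_residue in blast)+

lemma card_unions: "card (P \<union> P') = card P + card P'" "card (Q \<union> Q') = card Q + card Q'"
  using parts_finite parts_disjoint by (simp_all add: card_Un_disjoint)

text \<open>
  Full tops come in mirrored classes of equal size and pairs have even length, so only the extra
  half blocks matter.
\<close>

lemma filled_cols_mod_2:
  assumes "F \<in> full_tops g" "card P' = card Q'"
  shows "filled_cols F runs 0 mod 2 = (card P + card Q) mod 2"
proof -
  let ?x = "\<lambda>\<rho>. card {h \<in> F. h mod (2 * g) = \<rho>}"
  have "(\<Sum>\<rho><2 * g. \<Sum>h\<in>{h \<in> F. h mod (2 * g) = \<rho>}. 1) = (\<Sum>h\<in>F. 1 :: nat)"
    by (rule sum.group) (use parts_finite g in auto)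
  then have "card F = (\<Sum>\<rho><2 * g. ?x \<rho>)" by simp
  also have "\<dots> = (\<Sum>\<rho><g. ?x \<rho>) + (\<Sum>\<rho>\<in>{g..<2 * g}. ?x \<rho>)"
    using sum.atLeastLessThan_concat[of 0 g "2 * g" ?x] by (simp add: atLeast0LessThan)
  also have "(\<Sum>\<rho>\<in>{g..<2 * g}. ?x \<rho>) = (\<Sum>\<rho><g. ?x (2 * g - 1 - \<rho>))"
    by (rule sum.reindex_bij_witness[of _ "\<lambda>\<rho>. 2 * g - 1 - \<rho>" "\<lambda>\<rho>. 2 * g - 1 - \<rho>"]) auto
  also have "\<dots> = (\<Sum>\<rho><g. ?x \<rho>)"
    using assms(1) by (intro sum.cong refl) (simp add: full_tops_def)
  finally have F: "card F = 2 * (\<Sum>\<rho><g. ?x \<rho>)" by simp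
  have "{h. 0 < h \<and> runs h \<noteq> 0} = {h. runs h \<noteq> 0}" using support_node by (auto simp: N_def Suc_le_eq)
  then have "filled_cols F runs 0 = card F + (\<Sum>h | runs h \<noteq> 0. runs h)" by (simp add: filled_cols_def)
  moreover have "(\<Sum>h | runs h \<noteq> 0. runs h) = 2 * (\<Sum>h | runs h \<noteq> 0. run_pairs st p h)
      + (\<Sum>h | runs h \<noteq> 0. of_bool (h \<in> P \<union> P')) + (\<Sum>h | runs h \<noteq> 0. of_bool (h \<in> Q \<union> Q'))"
    unfolding sum_distrib_left sum.distrib [symmetric] by (rule sum.cong) (simp_all only: run_lengths_def)
  moreover have "{h. runs h \<noteq> 0} \<inter> (P \<union> P') = P \<union> P'" "{h. runs h \<noteq> 0} \<inter> (Q \<union> Q') = Q \<union> Q'"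
    using parts_support by blast+
  ultimately have "filled_cols F runs 0 = 2 * (\<Sum>\<rho><g. ?x \<rho>) + 2 * (\<Sum>h | runs h \<noteq> 0. run_pairs st p h)
      + (card P + card P') + (card Q + card Q')"
    by (simp only: F sum_of_bool_mem[OF support_finite] card_unions)
  also have "\<dots> = (card P + card Q) + 2 * ((\<Sum>\<rho><g. ?x \<rho>) + (\<Sum>h | runs h \<noteq> 0. run_pairs st p h) + card P')"
    using assms(2) by simp
  finally show ?thesis by (simp only: mod_mult_self2)
qed

lemma balanced_iff:
  "balanced g (F, runs, Q \<union> Q') \<longleftrightarrow>
     F \<in> full_tops g \<and> (card P = card Q \<or> card P = card Q + 1) \<and> card P' = card Q'"
proof -
  have fin: "finite ({h. runs h \<noteq> 0} \<inter> A)" for A using support_finite by blast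
  let ?p = "\<lambda>A. \<Sum>h\<in>{h. runs h \<noteq> 0} \<inter> A. run_pairs st p h"
  have rp: "run_plus runs (Q \<union> Q') = (\<lambda>h. run_pairs st p h + of_bool (h \<in> P \<union> P'))"
    "run_minus runs (Q \<union> Q') = (\<lambda>h. run_pairs st p h + of_bool (h \<in> Q \<union> Q'))"
    by (intro ext run_plus_lengths run_minus_lengths)+
  have "balanced g (F, runs, Q \<union> Q') \<longleftrightarrow> F \<in> full_tops g \<and>
      ?p (bottom_nodes g) + card P = ?p (bottom_nodes g) + card Q + filled_cols F runs 0 mod 2 \<and>
      ?p (middle_nodes st g) + card P' = ?p (middle_nodes st g) + card Q'"
    unfolding balanced_def split rp support_by_residue sum.distrib
      sum_of_bool_mem[OF fin] card_parts full_tops_def mem_Collect_eq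
    using parts_finite(1) by blast
  also have "\<dots> \<longleftrightarrow> F \<in> full_tops g \<and> card P = card Q + filled_cols F runs 0 mod 2 \<and> card P' = card Q'"
    by simp
  also have "\<dots> \<longleftrightarrow> F \<in> full_tops g \<and> card P = card Q + (card P + card Q) mod 2 \<and> card P' = card Q'"
    using filled_cols_mod_2 by metis
  finally show ?thesis unfolding even_offset_cases by blast
qed

lemma energy_eq:
  "energy g (F, runs, Q \<union> Q') = full_weight g F + (run_weight g (P, Q) + (run_weight g (P', Q') + part_weight d p))"
proof -
  let ?S = "{h. runs h \<noteq> 0}" and ?c = "\<lambda>h. h div (2 * g)" and ?m = "\<lambda>h. of_bool (h mod (2 * g) = g) :: nat"
  have part: "(\<Sum>h\<in>?S. of_bool (h \<in> A) * f h) = (\<Sum>h\<in>A. f h)" if "A \<subseteq> ?S" for A and f :: "nat \<Rightarrow> nat"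
    using that support_finite by (intro sum.mono_neutral_cong_right) auto
  have "energy g (F, runs, Q \<union> Q') = full_weight g F + (\<Sum>h\<in>?S. runs h * ?c h)
      + (\<Sum>h\<in>?S. ?m h * (run_pairs st p h + of_bool (h \<in> P \<union> P')))"
  proof -
    have "(\<Sum>h | runs h \<noteq> 0 \<and> h mod (2 * g) = g. run_plus runs (Q \<union> Q') h)
        = (\<Sum>h\<in>?S. ?m h * (run_pairs st p h + of_bool (h \<in> P \<union> P')))"
    proof -
      have "{h. runs h \<noteq> 0 \<and> h mod (2 * g) = g} = {h \<in> ?S. h mod (2 * g) = g}"
        by (simp only: mem_Collect_eq)
      moreover have "(if c then x else 0) = of_bool c * x" for c and x :: nat by simp
      ultimately show ?thesis
        by (simp only: run_plus_lengths sum.inter_filter[OF support_finite])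
    qed
    then show ?thesis by (simp only: energy_def split full_weight_def)
  qed
  also have "\<dots> = full_weight g F + (\<Sum>h\<in>?S. run_pairs st p h * (2 * ?c h + ?m h))
      + (\<Sum>h\<in>?S. of_bool (h \<in> P \<union> P') * (?c h + ?m h)) + (\<Sum>h\<in>?S. of_bool (h \<in> Q \<union> Q') * ?c h)"
  proof -
    have "runs h * ?c h + ?m h * (run_pairs st p h + of_bool (h \<in> P \<union> P'))
        = run_pairs st p h * (2 * ?c h + ?m h) + of_bool (h \<in> P \<union> P') * (?c h + ?m h)
          + of_bool (h \<in> Q \<union> Q') * ?c h" for h
      unfolding run_lengths_def by (simp only: algebra_simps)
    then show ?thesis unfolding add.assoc sum.distrib [symmetric] by (simp only: add.assoc)
  qed
  also have "(\<Sum>h\<in>?S. run_pairs st p h * (2 * ?c h + ?m h)) = part_weight d p"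
    by (rule part_weight_run_pairs[OF p support_finite]) (auto simp: run_lengths_def)
  also have "(\<Sum>h\<in>?S. of_bool (h \<in> P \<union> P') * (?c h + ?m h)) = (\<Sum>h\<in>P \<union> P'. ?c h + ?m h)"
    by (rule part) (use parts_support in blast)
  also have "\<dots> = (\<Sum>h\<in>P \<union> P'. (h + g) div (2 * g))"
  proof (rule sum.cong)
    fix h assume "h \<in> P \<union> P'"
    then have "h \<in> N" using parts_node by blast
    then have "h mod (2 * g) = 0 \<or> h mod (2 * g) = g" unfolding N_def mem_Collect_eq by (intro node_mod) (rule conjunct2)
    then show "?c h + ?m h = (h + g) div (2 * g)" by (rule shifted_div [symmetric])
  qed simp
  also have "\<dots> = (\<Sum>h\<in>P. (h + g) div (2 * g)) + (\<Sum>h\<in>P'. (h + g) div (2 * g))"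
    by (rule sum.union_disjoint) (use parts_finite parts_disjoint in blast)+
  also have "(\<Sum>h\<in>?S. of_bool (h \<in> Q \<union> Q') * ?c h) = (\<Sum>h\<in>Q \<union> Q'. ?c h)"
    by (rule part) (use parts_support in blast)
  also have "\<dots> = (\<Sum>h\<in>Q. ?c h) + (\<Sum>h\<in>Q'. ?c h)"
    by (rule sum.union_disjoint) (use parts_finite parts_disjoint in blast)+
  finally show ?thesis by (simp only: run_weight_def split)
qed

lemma disassemble_assemble:
  "disassemble st g (assemble st (F, (P, Q), (P', Q'), p)) = (F, (P, Q), (P', Q'), p)"
proof -
  have "odd_part runs (Q \<union> Q') = P \<union> P'"
    by (rule set_eqI) (simp add: odd_part_def run_lengths_def)
  moreover have "(runs (st * Suc a) - of_bool (st * Suc a \<in> Q \<union> Q')) div 2 = p a" for a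
    unfolding run_lengths_def run_pairs_node[OF st_pos] by simp
  moreover note parts_by_residue
  ultimately show ?thesis by (simp only: assemble_def disassemble_def split)
qed

end

lemma disassemble_parts:
  assumes "(F, r, Q) \<in> node_data N"
  obtains P\<^sub>0 Q\<^sub>0 P\<^sub>1 Q\<^sub>1 p where "disassemble st g (F, r, Q) = (F, (P\<^sub>0, Q\<^sub>0), (P\<^sub>1, Q\<^sub>1), p)"
    "assemble st (F, (P\<^sub>0, Q\<^sub>0), (P\<^sub>1, Q\<^sub>1), p) = (F, r, Q)"
    "finite F" "finite P\<^sub>0" "finite Q\<^sub>0" "finite P\<^sub>1" "finite Q\<^sub>1"
    "P\<^sub>0 \<union> Q\<^sub>0 \<subseteq> bottom_nodes g"
    "P\<^sub>1 \<union> Q\<^sub>1 \<subseteq> middle_nodes st g" "p \<in> part_mults"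
proof -
  let ?O = "odd_part r Q"
  let ?P0 = "?O \<inter> bottom_nodes g" and ?Q0 = "Q \<inter> bottom_nodes g"
    and ?P1 = "?O \<inter> middle_nodes st g" and ?Q1 = "Q \<inter> middle_nodes st g"
  let ?p = "\<lambda>a. (r (st * Suc a) - of_bool (st * Suc a \<in> Q)) div 2"
  have fin: "finite F" "finite {h. r h \<noteq> 0}" and rN: "\<And>h. r h \<noteq> 0 \<Longrightarrow> h \<in> N"
    and Q: "Q \<subseteq> {h. r h \<noteq> 0}"
    using assms unfolding node_data_def by blast+
  have O: "?O \<subseteq> {h. r h \<noteq> 0}" by (auto simp: odd_part_def intro: odd_pos)
  have supp: "h \<in> N" if "h \<in> ?O \<union> Q" for h using that O Q rN by blast
  have un: "?P0 \<union> ?P1 = ?O" "?Q0 \<union> ?Q1 = Q" using supp node_iff by blast+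
  have r: "run_lengths st ?O Q ?p h = r h" for h
  proof (cases "h \<in> N")
    case False
    then have "r h = 0" "h \<notin> Q" "h \<notin> ?O" using rN supp by blast+
    then show ?thesis using False by (auto simp: run_lengths_def run_pairs_def N_def)
  next
    case True
    then obtain b where b: "h = st * b" "b \<noteq> 0" by (auto simp: N_def)
    then obtain a where h: "h = st * Suc a" by (metis not0_implies_Suc)
    let ?x = "r h - of_bool (h \<in> Q)"
    have "run_lengths st ?O Q ?p h = 2 * (?x div 2) + of_bool (odd ?x) + of_bool (h \<in> Q)"
      unfolding run_lengths_def h run_pairs_node[OF st_pos] by (simp only: odd_part_def mem_Collect_eq)
    moreover have "2 * (?x div 2) + of_bool (odd ?x) = ?x" by (cases "even ?x") auto
    moreover have "of_bool (h \<in> Q) \<le> r h" using Q by (auto simp: Suc_le_eq)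
    ultimately show ?thesis by linarith
  qed
  have "?p \<in> part_mults"
  proof -
    have "(\<lambda>a. st * Suc a) ` {a. ?p a \<noteq> 0} \<subseteq> {h. r h \<noteq> 0}" by (auto simp del: mult_Suc_right)
    then have "finite ((\<lambda>a. st * Suc a) ` {a. ?p a \<noteq> 0})" using fin(2) by (rule finite_subset)
    moreover have "inj_on (\<lambda>a. st * Suc a) {a. ?p a \<noteq> 0}" using st_pos by (auto simp: inj_on_def)
    ultimately show ?thesis unfolding part_mults_def mem_Collect_eq by (rule finite_imageD)
  qed
  moreover have "finite ?P0" "finite ?Q0" "finite ?P1" "finite ?Q1"
    using O Q by (auto intro!: finite_subset[OF _ fin(2)])
  moreover have "?P0 \<union> ?Q0 \<subseteq> bottom_nodes g"
    "?P1 \<union> ?Q1 \<subseteq> middle_nodes st g"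
    by blast+
  moreover have "assemble st (F, (?P0, ?Q0), (?P1, ?Q1), ?p) = (F, r, Q)"
    unfolding assemble_def split un using r by (simp add: fun_eq_iff)
  moreover have "disassemble st g (F, r, Q) = (F, (?P0, ?Q0), (?P1, ?Q1), ?p)"
    by (simp only: disassemble_def split)
  ultimately show ?thesis using fin(1) that by blast
qed

lemma bij_betw_assemble:
  "bij_betw (assemble st) (full_tops g \<times> bottom_runs g \<times> middle_runs st g \<times> part_mults)
     {x \<in> node_data N. balanced g x}"
proof (rule bij_betw_byWitness[where f' = "disassemble st g"])
  let ?A = "full_tops g \<times> bottom_runs g \<times> middle_runs st g \<times> part_mults"
  have parts: "finite F \<and> finite P \<and> finite Q \<and> finite P' \<and> finite Q' \<and>
      P \<union> Q \<subseteq> bottom_nodes g \<and> P' \<union> Q' \<subseteq> middle_nodes st g \<and> p \<in> part_mults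
      \<and> (card P = card Q \<or> card P = card Q + 1) \<and> card P' = card Q' \<and> F \<in> full_tops g"
    if "(F, (P, Q), (P', Q'), p) \<in> ?A" for F P Q P' Q' p
    using that unfolding full_tops_def bottom_runs_def middle_runs_def by blast
  show "\<forall>x\<in>?A. disassemble st g (assemble st x) = x"
  proof
    fix x assume x: "x \<in> ?A"
    obtain F P Q P' Q' p where xx: "x = (F, (P, Q), (P', Q'), p)" by (cases x) auto
    from parts[OF x[unfolded xx]] show "disassemble st g (assemble st x) = x"
      unfolding xx by (intro disassemble_assemble) blast+
  qed
  show "assemble st ` ?A \<subseteq> {x \<in> node_data N. balanced g x}"
  proof
    fix y assume "y \<in> assemble st ` ?A"
    then obtain x where y: "y = assemble st x" and x: "x \<in> ?A" by blast
    obtain F P Q P' Q' p where xx: "x = (F, (P, Q), (P', Q'), p)" by (cases x) auto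
    note pt = parts[OF x[unfolded xx]]
    have pt': "finite F" "finite P" "finite Q" "finite P'" "finite Q'" "P \<union> Q \<subseteq> bottom_nodes g"
      "P' \<union> Q' \<subseteq> middle_nodes st g" "p \<in> part_mults"
      using pt by blast+
    let ?r = "run_lengths st (P \<union> P') (Q \<union> Q') p"
    have y': "y = (F, ?r, Q \<union> Q')" unfolding y xx assemble_def by simp
    have "finite {h. ?r h \<noteq> 0}" by (rule support_finite[OF pt'])
    moreover have "h \<in> N" if "?r h \<noteq> 0" for h using that by (rule support_node[OF pt'])
    moreover have "P \<union> P' \<union> Q \<union> Q' \<subseteq> {h. ?r h \<noteq> 0}" by (auto simp: run_lengths_def)
    ultimately have "y \<in> node_data N" unfolding y' node_data_def using pt by blast
    moreover have "balanced g y" unfolding y' balanced_iff[OF pt'] using pt by blast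
    ultimately show "y \<in> {x \<in> node_data N. balanced g x}" by blast
  qed
  have inv: "disassemble st g y \<in> ?A \<and> assemble st (disassemble st g y) = y"
    if y: "y \<in> {x \<in> node_data N. balanced g x}" for y
  proof -
    obtain F r Q where yy: "y = (F, r, Q)" by (cases y) auto
    have "(F, r, Q) \<in> node_data N" using y yy by blast
    then obtain P\<^sub>0 Q\<^sub>0 P\<^sub>1 Q\<^sub>1 p where d: "disassemble st g (F, r, Q) = (F, (P\<^sub>0, Q\<^sub>0), (P\<^sub>1, Q\<^sub>1), p)"
      and a: "assemble st (F, (P\<^sub>0, Q\<^sub>0), (P\<^sub>1, Q\<^sub>1), p) = (F, r, Q)"
      and pt: "finite F" "finite P\<^sub>0" "finite Q\<^sub>0" "finite P\<^sub>1" "finite Q\<^sub>1"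
        "P\<^sub>0 \<union> Q\<^sub>0 \<subseteq> bottom_nodes g"
        "P\<^sub>1 \<union> Q\<^sub>1 \<subseteq> middle_nodes st g" "p \<in> part_mults"
      by (rule disassemble_parts)
    have "balanced g (assemble st (F, (P\<^sub>0, Q\<^sub>0), (P\<^sub>1, Q\<^sub>1), p))" using y unfolding a yy by blast
    then have "balanced g (F, run_lengths st (P\<^sub>0 \<union> P\<^sub>1) (Q\<^sub>0 \<union> Q\<^sub>1) p, Q\<^sub>0 \<union> Q\<^sub>1)"
      unfolding assemble_def by simp
    from this[unfolded balanced_iff[OF pt]]
    have "disassemble st g y \<in> ?A"
      unfolding yy d bottom_runs_def middle_runs_def using pt by simp
    then show ?thesis using a d yy by simp
  qed
  show "\<forall>y\<in>{x \<in> node_data N. balanced g x}. assemble st (disassemble st g y) = y" using inv by blast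
  show "disassemble st g ` {x \<in> node_data N. balanced g x} \<subseteq> ?A" using inv by blast
qed

lemma has_gf_balanced:
  assumes "has_gf (full_tops g) (full_weight g) a" "has_gf (bottom_runs g) (run_weight g) b"
    "has_gf (middle_runs st g) (run_weight g) c" "has_gf part_mults (part_weight d) e"
  shows "has_gf {x \<in> node_data N. balanced g x} (energy g) (a * (b * (c * e)))"
proof (rule has_gf_bij[OF has_gf_Times[OF assms(1) has_gf_Times[OF assms(2) has_gf_Times[OF assms(3,4)]]]
    bij_betw_assemble])
  fix x assume "x \<in> full_tops g \<times> bottom_runs g \<times> middle_runs st g \<times> part_mults"
  then obtain F P Q P' Q' p where xx: "x = (F, (P, Q), (P', Q'), p)"
    and x: "F \<in> full_tops g" "(P, Q) \<in> bottom_runs g" "(P', Q') \<in> middle_runs st g" "p \<in> part_mults"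
    by (cases x) auto
  have "energy g (F, run_lengths st (P \<union> P') (Q \<union> Q') p, Q \<union> Q')
      = full_weight g F + (run_weight g (P, Q) + (run_weight g (P', Q') + part_weight d p))"
    by (rule energy_eq) (use x in \<open>auto simp: full_tops_def bottom_runs_def middle_runs_def\<close>)
  then show "energy g (assemble st x) = (case x of (a, b) \<Rightarrow> full_weight g a +
      (case b of (a, b) \<Rightarrow> run_weight g a + (case b of (a, b) \<Rightarrow> run_weight g a + part_weight d b)))"
    unfolding xx assemble_def by simp
qed

end

section \<open>Generating functions of the parts\<close>

lemma run_weight_images:
  assumes "inj_on e S" "inj_on z T" "\<And>a. a \<in> S \<Longrightarrow> (e a + g) div (2 * g) = Suc a" "\<And>a. a \<in> T \<Longrightarrow> z a div (2 * g) = a"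
  shows "run_weight g (e ` S, z ` T) = (\<Sum>a\<in>S. Suc a) + \<Sum>T"
  unfolding run_weight_def split using assms by (simp add: sum.reindex del: sum_Suc sum.distrib)

text \<open>
  The bottom floor itself lies outside the runs, so \<open>0\<close> is never the index of a floor
  in \<open>Q\<close>. It is put into \<open>T\<close> exactly when the excess is one, which makes
  the cardinalities equal and does not change the weight; it stands for the half block of the
  ground state in the first empty column.
\<close>

lemma has_gf_bottom_runs:
  assumes g: "2 \<le> g"
  shows "has_gf (bottom_runs g) (run_weight g) (inverse (qinf 1))"
proof -
  let ?e = "\<lambda>a. 2 * g * Suc a" and ?z = "\<lambda>a. 2 * g * a"
  let ?f = "\<lambda>(S, T). (?e ` S, ?z ` (T - {0}))"
  let ?h = "\<lambda>(P, Q). (?e -` P, ?z -` Q \<union> (if card P = card Q then {} else {0}))"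
  have inj: "inj ?e" "inj ?z" using g by (auto simp: inj_on_def)
  have rng: "bottom_nodes g = range ?e" "bottom_nodes g \<subseteq> range ?z" "0 \<notin> bottom_nodes g"
  proof -
    have "h \<in> range ?e" if h: "h \<in> bottom_nodes g" for h
    proof -
      have "h mod (2 * g) = 0" "h \<noteq> 0" using h by (auto simp: bottom_nodes_def)
      then obtain b where b: "h = 2 * g * b" by blast
      with \<open>h \<noteq> 0\<close> obtain a where "b = Suc a" by (cases b) auto
      then show ?thesis using b by blast
    qed
    moreover have "?e a \<in> bottom_nodes g" for a using g by (simp add: bottom_nodes_def)
    ultimately show "bottom_nodes g = range ?e" by blast
    then show "bottom_nodes g \<subseteq> range ?z" by blast
    show "0 \<notin> bottom_nodes g" by (simp add: bottom_nodes_def)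
  qed
  have zb: "?z ` (T - {0}) \<subseteq> bottom_nodes g" for T
  proof
    fix h assume "h \<in> ?z ` (T - {0})"
    then obtain a where "h = 2 * g * a" "a \<noteq> 0" by blast
    then obtain b where "h = ?e b" by (metis not0_implies_Suc)
    then show "h \<in> bottom_nodes g" unfolding rng(1) by blast
  qed
  have "bij_betw ?f frob_pairs (bottom_runs g)"
  proof (rule bij_betw_byWitness[where f' = ?h])
    show "\<forall>x\<in>frob_pairs. ?h (?f x) = x"
    proof
      fix x assume "x \<in> frob_pairs"
      then obtain S T where x: "x = (S, T)" "finite S" "finite T" "card S = card T"
        by (auto simp: frob_pairs_def)
      have c: "card (?e ` S) = card S" "card (?z ` (T - {0})) = card (T - {0})"
        using inj by (auto intro!: card_image inj_on_subset[OF _ subset_UNIV] simp del: mult_Suc_right)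
      have "(if card S = card (T - {0}) then {} else {0}) = T \<inter> {0}"
      proof (cases "0 \<in> T")
        case True
        then have "card T = Suc (card (T - {0}))" using x(3) by (intro card.remove)
        then show ?thesis using x(4) True by simp
      next
        case False
        then show ?thesis using x(4) by simp
      qed
      then have "?h (?f x) = (S, (T - {0}) \<union> (T \<inter> {0}))"
        unfolding x(1) split c inj_vimage_image_eq[OF inj(1)] inj_vimage_image_eq[OF inj(2)] by simp
      moreover have "(T - {0}) \<union> (T \<inter> {0}) = T" by blast
      ultimately show "?h (?f x) = x" unfolding x(1) by (simp only:)
    qed
    show "\<forall>y\<in>bottom_runs g. ?f (?h y) = y"
    proof
      fix y assume "y \<in> bottom_runs g"
      then obtain P Q where y: "y = (P, Q)" "P \<subseteq> bottom_nodes g" "Q \<subseteq> bottom_nodes g"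
        by (auto simp: bottom_runs_def)
      have "0 \<notin> Q" using y(3) rng(3) by blast
      then have "0 \<notin> ?z -` Q" by simp
      moreover have "(if card P = card Q then {} else {0}) \<subseteq> {0 :: nat}" by simp
      ultimately have "(?z -` Q \<union> (if card P = card Q then {} else {0})) - {0} = ?z -` Q" by blast
      then have "?f (?h y) = (P \<inter> range ?e, Q \<inter> range ?z)" unfolding y(1) split by (simp only: image_vimage_eq)
      moreover have "P \<inter> range ?e = P" using y(2) unfolding rng(1) by (rule Int_absorb2)
      moreover have "Q \<inter> range ?z = Q" using y(3) rng(2) by blast
      ultimately show "?f (?h y) = y" unfolding y(1) by (simp only:)
    qed
    show "?f ` frob_pairs \<subseteq> bottom_runs g"
    proof
      fix y assume "y \<in> ?f ` frob_pairs"
      then obtain S T where y: "y = (?e ` S, ?z ` (T - {0}))" "finite S" "finite T" "card S = card T"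
        by (auto simp: frob_pairs_def)
      have c: "card (?e ` S) = card S" "card (?z ` (T - {0})) = card (T - {0})"
        using inj by (auto intro!: card_image inj_on_subset[OF _ subset_UNIV] simp del: mult_Suc_right)
      have "card T = card (T - {0}) \<or> card T = card (T - {0}) + 1"
        using y(3) card.remove[of T 0] by (cases "0 \<in> T") auto
      moreover have "?e ` S \<subseteq> bottom_nodes g" unfolding rng(1) by blast
      ultimately show "y \<in> bottom_runs g" unfolding y(1) bottom_runs_def mem_Collect_eq split c
        using y(2-4) zb[of T] by simp
    qed
    show "?h ` bottom_runs g \<subseteq> frob_pairs"
    proof
      fix x assume "x \<in> ?h ` bottom_runs g"
      then obtain P Q where x: "x = ?h (P, Q)" and PQ: "finite P" "finite Q" "P \<subseteq> bottom_nodes g"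
        "Q \<subseteq> bottom_nodes g" "card P = card Q \<or> card P = card Q + 1"
        by (auto simp: bottom_runs_def)
      have c: "card (?e -` P) = card P" "card (?z -` Q) = card Q"
        using PQ(3,4) rng inj by (auto intro!: card_vimage_inj simp del: mult_Suc_right)
      have f: "finite (?e -` P)" "finite (?z -` Q)" using PQ(1,2) inj by (auto intro: finite_vimageI simp del: mult_Suc_right)
      have "0 \<notin> ?z -` Q" using PQ(4) rng(3) by auto
      then show "x \<in> frob_pairs" unfolding x split frob_pairs_def mem_Collect_eq using c f PQ(5) by auto
    qed
  qed
  then show ?thesis
  proof (rule has_gf_bij[OF has_gf_frob_pairs])
    fix x assume "x \<in> frob_pairs"
    then obtain S T where x: "x = (S, T)" "finite T" by (auto simp: frob_pairs_def)
    have "run_weight g (?e ` S, ?z ` (T - {0})) = (\<Sum>a\<in>S. Suc a) + \<Sum>(T - {0})"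
    proof (rule run_weight_images)
      show "inj_on ?e S" "inj_on ?z (T - {0})" using inj by (auto intro: inj_on_subset simp del: mult_Suc_right)
      show "(?e a + g) div (2 * g) = Suc a" for a
      proof -
        have "(g + 2 * g * Suc a) div (2 * g) = Suc a + g div (2 * g)"
          using g by (intro div_mult_self2) simp
        moreover have "g div (2 * g) = 0" using g by simp
        ultimately show ?thesis by (simp only: add.commute[of _ g] add_0_right)
      qed
      show "?z a div (2 * g) = a" for a using g by simp
    qed
    moreover have "\<Sum>(T - {0}) = \<Sum>T" using x(2) by (intro sum.mono_neutral_left) auto
    ultimately show "run_weight g (?f x) = frob_weight x" unfolding x(1) frob_weight_def by simp
  qed
qed

lemma has_gf_middle_runs:
  assumes g: "2 \<le> g"
  shows "has_gf (middle_runs g g) (run_weight g) (inverse (qinf 1))"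
proof -
  let ?z = "\<lambda>a. 2 * g * a + g"
  let ?f = "\<lambda>(S, T). (?z ` S, ?z ` T)"
  let ?h = "\<lambda>(P, Q). (?z -` P, ?z -` Q)"
  have inj: "inj ?z" using g by (auto simp: inj_on_def)
  have rng: "middle_nodes g g = range ?z"
  proof (intro set_eqI iffI)
    fix h assume "h \<in> middle_nodes g g"
    then have "h mod (2 * g) = g" unfolding middle_nodes_def by blast
    then have "h = 2 * g * (h div (2 * g)) + g" using mult_div_mod_eq[of "2 * g" h] by linarith
    then show "h \<in> range ?z" by (rule range_eqI)
  next
    fix h assume "h \<in> range ?z"
    then obtain a where h: "h = 2 * g * a + g" by blast
    have "h mod (2 * g) = g" unfolding h using g by simp
    moreover have "g dvd h" unfolding h by simp
    ultimately show "h \<in> middle_nodes g g" unfolding middle_nodes_def by blast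
  qed
  have "bij_betw ?f frob_pairs (middle_runs g g)"
  proof (rule bij_betw_byWitness[where f' = ?h])
    show "\<forall>x\<in>frob_pairs. ?h (?f x) = x" using inj_vimage_image_eq[OF inj] by auto
    have "?z ` ?z -` P = P" if "P \<subseteq> middle_nodes g g" for P
      unfolding image_vimage_eq using that rng by blast
    then show "\<forall>y\<in>middle_runs g g. ?f (?h y) = y" unfolding middle_runs_def by auto
    have "card (?z ` S) = card S" for S using inj by (auto intro!: card_image inj_on_subset[OF _ subset_UNIV])
    then show "?f ` frob_pairs \<subseteq> middle_runs g g" unfolding middle_runs_def frob_pairs_def rng by auto
    have "card (?z -` P) = card P" "finite P \<Longrightarrow> finite (?z -` P)" if "P \<subseteq> middle_nodes g g" for P
      using that rng inj by (auto intro!: card_vimage_inj finite_vimageI)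
    then show "?h ` middle_runs g g \<subseteq> frob_pairs" unfolding middle_runs_def frob_pairs_def by auto
  qed
  then show ?thesis
  proof (rule has_gf_bij[OF has_gf_frob_pairs])
    fix x assume "x \<in> frob_pairs"
    obtain S T where x: "x = (S, T)" by (cases x)
    have "run_weight g (?z ` S, ?z ` T) = (\<Sum>a\<in>S. Suc a) + \<Sum>T"
    proof (rule run_weight_images)
      show "inj_on ?z S" "inj_on ?z T" using inj by (auto intro: inj_on_subset)
      have "?z a + g = Suc a * (2 * g)" for a by simp
      then show "(?z a + g) div (2 * g) = Suc a" for a using g by simp
      show "?z a div (2 * g) = a" for a using g by simp
    qed
    then show "run_weight g (?f x) = frob_weight x" unfolding x frob_weight_def by simp
  qed
qed

lemma has_gf_middle_runs_trivial:
  assumes g: "2 \<le> g"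
  shows "has_gf (middle_runs (2 * g) g) (run_weight g) 1"
proof -
  have "h \<notin> middle_nodes (2 * g) g" for h
  proof
    assume "h \<in> middle_nodes (2 * g) g"
    then have "2 * g dvd h" "h mod (2 * g) = g" unfolding middle_nodes_def by blast+
    then have "g = 0" by (metis dvd_imp_mod_0)
    then show False using g by simp
  qed
  then have "middle_nodes (2 * g) g = {}" by blast
  then have "middle_runs (2 * g) g = {({}, {})}" by (auto simp: middle_runs_def)
  moreover have "has_gf {({}, {})} (run_weight g) 1"
    by (rule has_gf_bij[OF has_gf_singleton[of "({}, {})"], where h = id]) (auto simp: run_weight_def)
  ultimately show ?thesis by simp
qed

text \<open>
  The residues \<open>\<rho>\<close> and \<open>2 * g - 1 - \<rho>\<close> form one Frobenius pair
  for each \<open>\<rho> < g\<close>; the element of the upper residue has weight one more than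
  its period because it includes the middle floor.
\<close>

lemma has_gf_full_tops:
  assumes g: "2 \<le> g"
  shows "has_gf (full_tops g) (full_weight g) (inverse (qinf 1) ^ g)"
proof -
  let ?L = "2 * g"
  define R where "R \<rho> F = {a. ?L * a + \<rho> \<in> F}" for \<rho> F
  define y where "y x \<rho> = (if \<rho> < g then snd (x \<rho>) else fst (x (?L - 1 - \<rho>)))"
    for x :: "nat \<Rightarrow> nat set \<times> nat set" and \<rho>
  let ?f = "\<lambda>x. {h. h div ?L \<in> y x (h mod ?L)}"
  let ?h = "\<lambda>F. \<lambda>i\<in>{..<g}. (R (?L - 1 - i) F, R i F)"
  have L: "0 < ?L" using g by simp
  have R_f: "R \<rho> (?f x) = y x \<rho>" if "\<rho> < ?L" for \<rho> x
    using that by (simp add: R_def)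
  have R_img: "{h \<in> F. h mod ?L = \<rho>} = (\<lambda>a. ?L * a + \<rho>) ` R \<rho> F" if "\<rho> < ?L" for \<rho> F
  proof (intro set_eqI iffI)
    fix h assume h: "h \<in> {h \<in> F. h mod ?L = \<rho>}"
    then have e: "h = ?L * (h div ?L) + \<rho>" using mult_div_mod_eq[of ?L h] by simp
    have "h \<in> F" using h by blast
    then have "h div ?L \<in> R \<rho> F" unfolding R_def mem_Collect_eq by (simp only: e [symmetric])
    then show "h \<in> (\<lambda>a. ?L * a + \<rho>) ` R \<rho> F" using e by (rule image_eqI[rotated])
  next
    fix h assume "h \<in> (\<lambda>a. ?L * a + \<rho>) ` R \<rho> F"
    then show "h \<in> {h \<in> F. h mod ?L = \<rho>}" using that by (auto simp: R_def)
  qed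
  have inj: "inj_on (\<lambda>a. ?L * a + \<rho>) A" for \<rho> A using L by (auto simp: inj_on_def)
  have R_card: "card {h \<in> F. h mod ?L = \<rho>} = card (R \<rho> F)" if "\<rho> < ?L" for \<rho> F
    unfolding R_img[OF that] by (rule card_image[OF inj])
  have R_fin: "finite (R \<rho> F)" if "finite F" for \<rho> F
  proof -
    have "(\<lambda>a. ?L * a + \<rho>) ` R \<rho> F \<subseteq> F" by (auto simp: R_def)
    then show ?thesis using finite_imageD[OF finite_subset[OF _ that] inj] by blast
  qed
  have fin_R: "finite F" if "\<And>\<rho>. \<rho> < ?L \<Longrightarrow> finite (R \<rho> F)" for F
  proof -
    have "F \<subseteq> (\<Union>\<rho>\<in>{..<?L}. {h \<in> F. h mod ?L = \<rho>})" using L by auto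
    moreover have "finite (\<Union>\<rho>\<in>{..<?L}. {h \<in> F. h mod ?L = \<rho>})"
      using that R_img by auto
    ultimately show ?thesis by (rule finite_subset)
  qed
  have y_simps: "y x i = snd (x i)" "y x (?L - 1 - i) = fst (x i)" if "i < g" for x i
    using that by (auto simp: y_def)
  have low: "i < ?L" "?L - 1 - i < ?L" if "i < g" for i using that by auto
  have mirror: "\<exists>i<g. \<rho> = i \<or> \<rho> = ?L - 1 - i" if "\<rho> < ?L" for \<rho>
  proof (cases "\<rho> < g")
    case False
    then have "?L - 1 - \<rho> < g" "\<rho> = ?L - 1 - (?L - 1 - \<rho>)" using that by auto
    then show ?thesis by blast
  qed blast
  have full: "F \<in> full_tops g \<longleftrightarrow> (\<forall>i<g. (R (?L - 1 - i) F, R i F) \<in> frob_pairs)" for F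
  proof
    assume F: "F \<in> full_tops g"
    show "\<forall>i<g. (R (?L - 1 - i) F, R i F) \<in> frob_pairs"
      using F R_fin R_card low unfolding full_tops_def frob_pairs_def by auto
  next
    assume a: "\<forall>i<g. (R (?L - 1 - i) F, R i F) \<in> frob_pairs"
    have "finite F"
    proof (rule fin_R)
      fix \<rho> assume "\<rho> < ?L"
      then show "finite (R \<rho> F)" using mirror[of \<rho>] a unfolding frob_pairs_def by auto
    qed
    then show "F \<in> full_tops g" using a R_card low unfolding full_tops_def frob_pairs_def by auto
  qed
  have "bij_betw ?f (PiE {..<g} (\<lambda>_. frob_pairs)) (full_tops g)"
  proof (rule bij_betw_byWitness[where f' = ?h])
    have hf: "?h (?f x) i = x i" if "i < g" for x i
      using that R_f[OF low(1)[OF that]] R_f[OF low(2)[OF that]] y_simps[OF that] by simp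
    show "\<forall>x\<in>PiE {..<g} (\<lambda>_. frob_pairs). ?h (?f x) = x"
    proof
      fix x assume x: "x \<in> PiE {..<g} (\<lambda>_. frob_pairs)"
      show "?h (?f x) = x"
      proof
        fix i show "?h (?f x) i = x i"
          using hf[of i x] x by (cases "i < g") (auto simp: PiE_def extensional_def)
      qed
    qed
    show "?f ` PiE {..<g} (\<lambda>_. frob_pairs) \<subseteq> full_tops g"
    proof
      fix F assume "F \<in> ?f ` PiE {..<g} (\<lambda>_. frob_pairs)"
      then obtain x where x: "x \<in> PiE {..<g} (\<lambda>_. frob_pairs)" and F: "F = ?f x" by blast
      show "F \<in> full_tops g" unfolding full
      proof (intro allI impI)
        fix i assume i: "i < g"
        then have "(R (?L - 1 - i) F, R i F) = x i" using hf[OF i, of x] unfolding F by simp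
        then show "(R (?L - 1 - i) F, R i F) \<in> frob_pairs" using x i by auto
      qed
    qed
    show "?h ` full_tops g \<subseteq> PiE {..<g} (\<lambda>_. frob_pairs)"
    proof (rule image_subsetI, rule PiE_I)
      fix F i assume "F \<in> full_tops g" "i \<in> {..<g}"
      then show "?h F i \<in> frob_pairs" using full[of F] by simp
    qed simp
    show "\<forall>F\<in>full_tops g. ?f (?h F) = F"
    proof
      fix F assume "F \<in> full_tops g"
      have yR: "y (?h F) \<rho> = R \<rho> F" if "\<rho> < ?L" for \<rho>
      proof -
        obtain i where i: "i < g" "\<rho> = i \<or> \<rho> = ?L - 1 - i" using mirror[OF \<open>\<rho> < ?L\<close>] by blast
        from i(2) show ?thesis
        proof
          assume "\<rho> = i" then show ?thesis using y_simps(1)[OF i(1), of "?h F"] i(1) by simp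
        next
          assume "\<rho> = ?L - 1 - i" then show ?thesis using y_simps(2)[OF i(1), of "?h F"] i(1) by simp
        qed
      qed
      have "h \<in> ?f (?h F) \<longleftrightarrow> h \<in> F" for h
      proof -
        have "h \<in> ?f (?h F) \<longleftrightarrow> h div ?L \<in> R (h mod ?L) F"
          unfolding mem_Collect_eq using yR[of "h mod ?L"] L by simp
        then show ?thesis unfolding R_def mem_Collect_eq by (simp only: mult_div_mod_eq)
      qed
      then show "?f (?h F) = F" by blast
    qed
  qed
  then have "has_gf (full_tops g) (full_weight g) (\<Prod>i\<in>{..<g}. inverse (qinf 1))"
  proof (rule has_gf_bij[OF has_gf_PiE[OF finite_lessThan has_gf_frob_pairs]])
    fix x assume x: "x \<in> PiE {..<g} (\<lambda>_. frob_pairs)"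
    let ?F = "?f x" and ?w = "\<lambda>h. (h + g) div ?L"
    have finy: "finite (y x \<rho>)" if \<rho>: "\<rho> < ?L" for \<rho>
    proof -
      obtain i where i: "i < g" "\<rho> = i \<or> \<rho> = ?L - 1 - i" using mirror[OF \<rho>] by blast
      then have "x i \<in> frob_pairs" using x by auto
      then show ?thesis using i y_simps[OF i(1), of x] by (auto simp: frob_pairs_def)
    qed
    have "finite ?F" by (rule fin_R) (simp add: R_f finy)
    then have "full_weight g ?F = (\<Sum>\<rho><?L. \<Sum>h\<in>{h \<in> ?F. h mod ?L = \<rho>}. ?w h)"
      unfolding full_weight_def by (intro sum.group [symmetric]) (use L in auto)
    also have "\<dots> = (\<Sum>\<rho><?L. \<Sum>a\<in>y x \<rho>. a + (if \<rho> < g then 0 else 1))"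
    proof (rule sum.cong)
      fix \<rho> assume "\<rho> \<in> {..<?L}"
      then have \<rho>: "\<rho> < ?L" by simp
      have "?w (?L * a + \<rho>) = a + (if \<rho> < g then 0 else 1)" for a
      proof (cases "\<rho> < g")
        case True
        then have "(\<rho> + g) div ?L = 0" by simp
        then show ?thesis using True L by (simp add: add.assoc)
      next
        case False
        then have "?L * a + \<rho> + g = (\<rho> - g) + ?L * Suc a" by simp
        moreover have "(\<rho> - g) div ?L = 0" using \<rho> by simp
        ultimately have "?w (?L * a + \<rho>) = Suc a" using L by (simp only: div_mult_self2)
        then show ?thesis using False by simp
      qed
      then show "(\<Sum>h\<in>{h \<in> ?F. h mod ?L = \<rho>}. ?w h) = (\<Sum>a\<in>y x \<rho>. a + (if \<rho> < g then 0 else 1))"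
        unfolding R_img[OF \<rho>] sum.reindex[OF inj] o_def R_f[OF \<rho>] by (simp only:)
    qed simp
    also have "\<dots> = (\<Sum>i<g. \<Sum>a\<in>y x i. a) + (\<Sum>i<g. \<Sum>a\<in>y x (?L - 1 - i). Suc a)"
    proof -
      let ?t = "\<lambda>\<rho>. \<Sum>a\<in>y x \<rho>. a + (if \<rho> < g then 0 else 1)"
      have "(\<Sum>\<rho><?L. ?t \<rho>) = (\<Sum>\<rho><g. ?t \<rho>) + (\<Sum>\<rho>\<in>{g..<?L}. ?t \<rho>)"
        using sum.atLeastLessThan_concat[of 0 g ?L ?t] by (simp add: atLeast0LessThan)
      moreover have "(\<Sum>\<rho>\<in>{g..<?L}. ?t \<rho>) = (\<Sum>i<g. ?t (?L - 1 - i))"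
        by (rule sum.reindex_bij_witness[of _ "\<lambda>\<rho>. ?L - 1 - \<rho>" "\<lambda>\<rho>. ?L - 1 - \<rho>"]) auto
      moreover have "(\<Sum>i<g. ?t (?L - 1 - i)) = (\<Sum>i<g. \<Sum>a\<in>y x (?L - 1 - i). Suc a)"
        by (rule sum.cong) auto
      moreover have "(\<Sum>\<rho><g. ?t \<rho>) = (\<Sum>i<g. \<Sum>a\<in>y x i. a)"
        by (rule sum.cong) auto
      ultimately show ?thesis by (simp only:)
    qed
    also have "\<dots> = (\<Sum>i<g. frob_weight (x i))"
      unfolding sum.distrib [symmetric]
    proof (rule sum.cong)
      fix i assume "i \<in> {..<g}"
      then have i: "i < g" by simp
      show "(\<Sum>a\<in>y x i. a) + (\<Sum>a\<in>y x (?L - 1 - i). Suc a) = frob_weight (x i)"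
        unfolding y_simps[OF i] frob_weight_def case_prod_unfold by (rule add.commute)
    qed simp
    finally show "full_weight g ?F = (\<Sum>i\<in>{..<g}. frob_weight (x i))" .
  qed
  then show ?thesis by simp
qed

section \<open>Independence of the simple roots\<close>

text \<open>
  The coefficient of $\alpha_i$ in $\delta$.
\<close>

fun mark :: "affine_type \<Rightarrow> nat \<Rightarrow> nat" where
  "mark (A_tw n) i = (if i \<in> {2..n - 1} then 2 else 1)"
| "mark (D_aff n) i = (if i \<in> {2..n - 1} then 2 else 1)"

fun type_rank :: "affine_type \<Rightarrow> nat" where
  "type_rank (A_tw n) = n"
| "type_rank (D_aff n) = n"

lemma finite_colors: "finite (colors X)"
  by (cases X) auto

lemma null_root_eq_marks:
  assumes "type_rank X \<ge> 3"
  shows "null_root X = (\<Sum>i\<in>colors X. frag_cmul (int (mark X i)) (simple_root X i))"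
proof -
  have split: "(\<Sum>i\<in>A \<union> {2..n - 1} \<union> B. f i) = (\<Sum>i\<in>A. f i) + (\<Sum>i = 2..n - 1. f i) + (\<Sum>i\<in>B. f i)"
    if "A \<inter> {2..n - 1} = {}" "(A \<union> {2..n - 1}) \<inter> B = {}" "finite A" "finite B"
    for A B n and f :: "nat \<Rightarrow> weight"
    using that by (simp add: sum.union_disjoint)
  have middle: "(\<Sum>i = 2..n - 1. frag_cmul (int (mark X i)) (simple_root X i))
      = frag_cmul 2 (\<Sum>i = 2..n - 1. simple_root X i)" if "X = A_tw n \<or> X = D_aff n" for n
    unfolding frag_cmul_sum using that by (intro sum.cong) auto
  show ?thesis
  proof (cases X)
    case (A_tw n)
    then have n: "n \<ge> 3" using assms by simp
    then have c: "colors X = {0, 1} \<union> {2..n - 1} \<union> {n}" using A_tw by auto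
    have "(\<Sum>i\<in>colors X. frag_cmul (int (mark X i)) (simple_root X i))
        = (\<Sum>i\<in>{0, 1}. frag_cmul (int (mark X i)) (simple_root X i))
          + (\<Sum>i = 2..n - 1. frag_cmul (int (mark X i)) (simple_root X i))
          + (\<Sum>i\<in>{n}. frag_cmul (int (mark X i)) (simple_root X i))"
      unfolding c by (rule split) (use n in auto)
    moreover have "\<not> n \<le> n - 1" using n by simp
    ultimately show ?thesis using middle[of n] n A_tw by simp
  next
    case (D_aff n)
    then have n: "n \<ge> 3" using assms by simp
    then have c: "colors X = {0, 1} \<union> {2..n - 1} \<union> {n, n + 1}" using D_aff by auto
    have "(\<Sum>i\<in>colors X. frag_cmul (int (mark X i)) (simple_root X i))
        = (\<Sum>i\<in>{0, 1}. frag_cmul (int (mark X i)) (simple_root X i))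
          + (\<Sum>i = 2..n - 1. frag_cmul (int (mark X i)) (simple_root X i))
          + (\<Sum>i\<in>{n, n + 1}. frag_cmul (int (mark X i)) (simple_root X i))"
      unfolding c by (rule split) (use n in auto)
    moreover have "\<not> n \<le> n - 1" using n by simp
    ultimately show ?thesis using middle[of n] n D_aff by (simp add: add.assoc)
  qed
qed

lemma lookup_simple_root_Fund:
  assumes "i \<in> colors X"
  shows "Poly_Mapping.lookup (simple_root X j) (Fund i) = cartan X i j"
proof -
  have "Poly_Mapping.lookup (simple_root X j) (Fund i) = (\<Sum>k\<in>colors X. if i = k then cartan X k j else 0)"
    unfolding simple_root_def lookup_add lookup_sum fund_def
    by (auto intro!: sum.cong)
  then show ?thesis using assms finite_colors by simp
qed

lemma lookup_simple_root_Imag: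
  "Poly_Mapping.lookup (simple_root X j) Imag = (if j = 0 then 1 else 0)"
  unfolding simple_root_def lookup_add lookup_sum fund_def by simp

lemma cartan_row_pivot:
  fixes z :: "nat \<Rightarrow> int"
  assumes "(\<Sum>j\<in>colors X. z j * cartan X i j) = 0" "j0 \<in> colors X" "cartan X i j0 \<noteq> 0"
    "\<And>j. j \<in> colors X \<Longrightarrow> j \<noteq> j0 \<Longrightarrow> z j = 0 \<or> cartan X i j = 0"
  shows "z j0 = 0"
proof -
  have "(\<Sum>j\<in>colors X. z j * cartan X i j) = (\<Sum>j\<in>{j0}. z j * cartan X i j)"
    using assms(2,4) finite_colors by (intro sum.mono_neutral_right) auto
  then show ?thesis using assms(1,3) by simp
qed

text \<open>
  The \<open>\<delta>\<close>-component gives the coefficient of $\alpha_0$. Then the rows of the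
  Cartan matrix, taken in the order $0, 1, 2, \ldots$, each contain a single unknown whose
  coefficient is not yet known to vanish.
\<close>

lemma simple_roots_independent:
  fixes z :: "nat \<Rightarrow> int"
  assumes "type_rank X \<ge> 3" and zero: "(\<Sum>j\<in>colors X. frag_cmul (z j) (simple_root X j)) = 0"
    and "i \<in> colors X"
  shows "z i = 0"
proof -
  have row: "(\<Sum>j\<in>colors X. z j * cartan X k j) = 0" if "k \<in> colors X" for k
  proof -
    have "Poly_Mapping.lookup (\<Sum>j\<in>colors X. frag_cmul (z j) (simple_root X j)) (Fund k) = 0"
      unfolding zero by simp
    then show ?thesis by (simp add: lookup_sum lookup_simple_root_Fund[OF that])
  qed
  have z0: "z 0 = 0"
  proof -
    have "Poly_Mapping.lookup (\<Sum>j\<in>colors X. frag_cmul (z j) (simple_root X j)) Imag = 0"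
      unfolding zero by simp
    then have "(\<Sum>j\<in>colors X. if j = 0 then z j else 0) = 0"
      by (simp add: lookup_sum lookup_simple_root_Imag if_distrib cong: if_cong)
    moreover have "0 \<in> colors X" by (cases X) auto
    ultimately show ?thesis using finite_colors[of X] by (simp add: sum.delta)
  qed
  obtain n where X: "X = A_tw n \<or> X = D_aff n" by (cases X) auto
  then have n: "n \<ge> 3" using assms(1) by auto
  have z2: "z 2 = 0"
    by (rule cartan_row_pivot[OF row[of 0]]) (use X n z0 in \<open>auto simp: doubleton_eq_iff split: if_splits\<close>)
  have z1: "z 1 = 0"
    by (rule cartan_row_pivot[OF row[of 1]])
      (use X n z0 z2 in \<open>auto simp: doubleton_eq_iff numeral_2_eq_2 split: if_splits\<close>)
  have chain: "\<forall>j\<le>k. z j = 0" if "2 \<le> k" "k \<le> N" and N: "X = A_tw N \<or> X = D_aff (Suc N)" for k N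
    using that(1,2)
  proof (induction k rule: dec_induct)
    case base
    have "j = 0 \<or> j = 1 \<or> j = 2" if "j \<le> 2" for j :: nat using that by linarith
    then show ?case using z0 z1 z2 by blast
  next
    case (step k)
    then have IH: "z j = 0" if "j \<le> k" for j using that by simp
    have "z (Suc k) = 0"
    proof (rule cartan_row_pivot[OF row[of k]])
      show "z j = 0 \<or> cartan X k j = 0" if "j \<in> colors X" "j \<noteq> Suc k" for j
      proof (cases "j \<le> k")
        case False
        then have "cartan X k j = 0" using that step N by (auto simp: doubleton_eq_iff split: if_splits)
        then show ?thesis ..
      qed (use IH in blast)
      have edge: "\<exists>i\<in>{1..<M}. {k, Suc k} = {i, i + 1}" if "k < M" for M
        using step(1) that by (intro bexI[of _ k]) auto
      have nonzero: "(if a then 2 else if b then -2 else if p \<or> q then -1 else 0) \<noteq> (0 :: int)"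
        "(if a then 2 else if p \<or> b \<or> q then -1 else 0) \<noteq> (0 :: int)" if q for a b p q
        using that by simp_all
      from N show "cartan X k (Suc k) \<noteq> 0"
      proof
        assume A: "X = A_tw N"
        show ?thesis unfolding A cartan.simps by (rule nonzero(1), rule edge) (use step in simp)
      next
        assume D: "X = D_aff (Suc N)"
        show ?thesis unfolding D cartan.simps by (rule nonzero(2), rule edge) (use step in simp)
      qed
    qed (use N step in auto)
    then show ?case using IH by (metis le_SucE)
  qed
  from X show ?thesis
  proof
    assume A: "X = A_tw n"
    then have "\<forall>j\<le>n. z j = 0" using n by (intro chain) auto
    then show ?thesis using assms(3) A by simp
  next
    assume D_aff: "X = D_aff n"
    then have "\<forall>j\<le>n - 1. z j = 0" using n by (intro chain) auto
    then have below: "z j = 0" if "j < n" for j using n that by simp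
    have zn: "z n = 0"
    proof (rule cartan_row_pivot[OF row[of n]])
      show "z j = 0 \<or> cartan X n j = 0" if "j \<in> colors X" "j \<noteq> n" for j
      proof (cases "j < n")
        case False
        then have "j = n + 1" using that D_aff by auto
        then show ?thesis using D_aff n by (auto simp: doubleton_eq_iff)
      qed (use below in blast)
    qed (use D_aff in auto)
    have "z (n + 1) = 0"
    proof (rule cartan_row_pivot[OF row[of "n + 1"]])
      show "z j = 0 \<or> cartan X (n + 1) j = 0" if "j \<in> colors X" "j \<noteq> n + 1" for j
      proof -
        have "j < n \<or> j = n" using that D_aff by auto
        then show ?thesis using below zn by blast
      qed
    qed (use D_aff in auto)
    moreover have "i < n \<or> i = n \<or> i = n + 1" using assms(3) D_aff by auto
    ultimately show ?thesis using below zn by blast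
  qed
qed

lemma wall_weight_eq_iff:
  assumes "type_rank X \<ge> 3"
  shows "wall_weight X \<Lambda> Y = fund \<Lambda> - frag_cmul (int m) (null_root X)
    \<longleftrightarrow> (\<forall>i\<in>colors X. added X \<Lambda> Y i = m * mark X i)"
proof -
  let ?z = "\<lambda>i. int (added X \<Lambda> Y i) - int (m * mark X i)"
  have "wall_weight X \<Lambda> Y = fund \<Lambda> - frag_cmul (int m) (null_root X) \<longleftrightarrow>
      (\<Sum>i\<in>colors X. frag_cmul (int (added X \<Lambda> Y i)) (simple_root X i))
      - (\<Sum>i\<in>colors X. frag_cmul (int (m * mark X i)) (simple_root X i)) = 0"
    unfolding wall_weight_def null_root_eq_marks[OF assms] frag_cmul_sum by simp
  also have "\<dots> \<longleftrightarrow> (\<Sum>i\<in>colors X. frag_cmul (?z i) (simple_root X i)) = 0"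
    unfolding sum_subtractf [symmetric] frag_cmul_diff_distrib ..
  also have "\<dots> \<longleftrightarrow> (\<forall>i\<in>colors X. ?z i = 0)"
    using simple_roots_independent[OF assms, of ?z] by (auto intro!: sum.neutral)
  also have "\<dots> \<longleftrightarrow> (\<forall>i\<in>colors X. added X \<Lambda> Y i = m * mark X i)"
    by (simp only: right_minus_eq of_nat_eq_iff)
  finally show ?thesis .
qed

section \<open>The string functions\<close>

context wall_pattern
begin

definition node_step :: nat where
  "node_step = (if mid = Cube c then 2 * g else g)"

definition nodes :: "nat set" where
  "nodes = {h. 1 \<le> h \<and> node_step dvd h}"

lemma run_assembly_nodes:
  "run_assembly g node_step (if mid = Cube c then 2 else 1) nodes"
  using g by unfold_locales (auto simp: node_step_def nodes_def)

lemma split_floor_iff_node: "1 \<le> h \<Longrightarrow> split_floor X \<Lambda> h \<longleftrightarrow> h \<in> nodes"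
proof -
  assume h: "1 \<le> h"
  interpret run_assembly g node_step "if mid = Cube c then 2 else 1" nodes by (rule run_assembly_nodes)
  show ?thesis
  proof (cases "mid = Cube c")
    case True
    then have st: "node_step = 2 * g" and nc: "(mid \<noteq> Cube c) = False"
      unfolding node_step_def using True by simp_all
    show ?thesis unfolding split_floor_iff nodes_def st nc mem_Collect_eq
      by (simp only: h simp_thms mod_eq_0_iff_dvd)
  next
    case False
    then have st: "node_step = g" by (simp add: node_step_def)
    have "g dvd h" if "h mod (2 * g) = g"
    proof -
      have "h = 2 * g * (h div (2 * g)) + g" using that mult_div_mod_eq[of "2 * g" h] by linarith
      then show ?thesis by (metis dvd_add dvd_refl dvd_triv_left dvd_mult2 mult.commute mult.assoc)
    qed
    then have "(h mod (2 * g) = 0 \<or> h mod (2 * g) = g) \<longleftrightarrow> g dvd h"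
      using node_mod[of h] bottom_node[of h] unfolding st by metis
    then show ?thesis using h False by (simp only: split_floor_iff nodes_def st mem_Collect_eq simp_thms)
  qed
qed

lemma wall_data_eq: "wall_data X \<Lambda> = node_data nodes"
proof -
  have "(1 \<le> h \<and> split_floor X \<Lambda> h) \<longleftrightarrow> h \<in> nodes" for h
    using split_floor_iff_node[of h] by (auto simp: nodes_def)
  then show ?thesis unfolding wall_data_def node_data_def by (simp only:)
qed

text \<open>
  One factor for each of the independent parts: \<open>g\<close> pairs of residues of full tops,
  the bottom runs, the middle runs and the pairs of half blocks.
\<close>

lemma has_gf_balanced_wall_data:
  "has_gf {x \<in> wall_data X \<Lambda>. balanced g x} (energy g)
     (inverse (qinf 1) ^ g * (inverse (qinf 1) *
       (if mid = Cube c then 1 * inverse (qinf 2) else inverse (qinf 1) * inverse (qinf 1))))"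
proof -
  interpret run_assembly g node_step "if mid = Cube c then 2 else 1" nodes by (rule run_assembly_nodes)
  have "has_gf (middle_runs node_step g) (run_weight g) (if mid = Cube c then 1 else inverse (qinf 1))"
    using has_gf_middle_runs[OF g] has_gf_middle_runs_trivial[OF g] by (simp add: node_step_def)
  moreover have "has_gf part_mults (part_weight (if mid = Cube c then 2 else 1)) (inverse (qinf (if mid = Cube c then 2 else 1)))"
    by (rule has_gf_part_mults) simp
  ultimately have "has_gf {x \<in> node_data nodes. balanced g x} (energy g)
      (inverse (qinf 1) ^ g * (inverse (qinf 1) * ((if mid = Cube c then 1 else inverse (qinf 1)) *
        inverse (qinf (if mid = Cube c then 2 else 1)))))"
    by (rule has_gf_balanced[OF has_gf_full_tops[OF g] has_gf_bottom_runs[OF g]])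
  then show ?thesis unfolding wall_data_eq by (cases "mid = Cube c") simp_all
qed

lemma string_function_eq:
  assumes type_rank: "type_rank X \<ge> 3"
    and colors: "colors X = {bot, Suc bot} \<union> \<kappa> ` {1..<g} \<union> (if mid = Cube c then {c} else {c, Suc c})"
    and marks: "\<And>i. i \<in> colors X \<Longrightarrow> mark X i = (if i \<in> \<kappa> ` {1..<g} then 2 else 1)"
    and f: "has_gf {x \<in> wall_data X \<Lambda>. balanced g x} (energy g) f"
  shows "string_function X \<Lambda> (fund \<Lambda>) = f"
proof (rule fps_ext)
  fix m
  let ?a = "\<lambda>x. added X \<Lambda> (wall_of X \<Lambda> x)"
  have not_chain: "i \<notin> \<kappa> ` {1..<g}" if "i \<in> {bot, Suc bot, c, Suc c}" for i
    using \<kappa>_fresh that by blast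
  have key: "(\<forall>i\<in>colors X. ?a x i = m * mark X i) \<longleftrightarrow> balanced g x \<and> energy g x = m"
    if "x \<in> wall_data X \<Lambda>" for x
  proof -
    obtain F r Q where x: "x = (F, r, Q)" by (cases x) auto
    have "(\<forall>i\<in>colors X. ?a x i = m * mark X i) \<longleftrightarrow>
        (\<forall>i\<in>{bot, Suc bot}. ?a x i = m * mark X i) \<and> (\<forall>i\<in>\<kappa> ` {1..<g}. ?a x i = m * mark X i) \<and>
        (\<forall>i\<in>(if mid = Cube c then {c} else {c, Suc c}). ?a x i = m * mark X i)"
      unfolding colors by blast
    also have "(\<forall>i\<in>{bot, Suc bot}. ?a x i = m * mark X i) \<longleftrightarrow>
        (\<forall>i\<in>{plus_color X \<Lambda> 0, minus_color X \<Lambda> 0}. ?a x i = m)"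
      unfolding plus_minus_bot(1)
    proof (rule ball_cong[OF refl])
      fix i assume i: "i \<in> {bot, Suc bot}"
      then have "mark X i = 1" using marks[of i] not_chain[of i] colors by auto
      then show "?a x i = m * mark X i \<longleftrightarrow> ?a x i = m" by simp
    qed
    also have "(\<forall>i\<in>(if mid = Cube c then {c} else {c, Suc c}). ?a x i = m * mark X i) \<longleftrightarrow>
        (\<forall>i\<in>{plus_color X \<Lambda> g, minus_color X \<Lambda> g}. ?a x i = m)"
      unfolding plus_minus_mid
    proof (rule ball_cong[OF refl])
      fix i assume i: "i \<in> (if mid = Cube c then {c} else {c, Suc c})"
      then have "i \<in> {c, Suc c}" by (auto split: if_splits)
      then have "mark X i = 1" using marks[of i] not_chain[of i] colors i by auto
      then show "?a x i = m * mark X i \<longleftrightarrow> ?a x i = m" by simp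
    qed
    also have "(\<forall>i\<in>\<kappa> ` {1..<g}. ?a x i = m * mark X i) \<longleftrightarrow> (\<forall>\<rho>\<in>{1..<g}. ?a x (\<kappa> \<rho>) = 2 * m)"
      unfolding ball_simps
    proof (rule ball_cong[OF refl])
      fix \<rho> assume "\<rho> \<in> {1..<g}"
      then have "mark X (\<kappa> \<rho>) = 2" using marks[of "\<kappa> \<rho>"] colors by auto
      then show "?a x (\<kappa> \<rho>) = m * mark X (\<kappa> \<rho>) \<longleftrightarrow> ?a x (\<kappa> \<rho>) = 2 * m" by (simp add: mult.commute)
    qed
    also have "(\<forall>i\<in>{plus_color X \<Lambda> 0, minus_color X \<Lambda> 0}. ?a x i = m) \<and>
        (\<forall>\<rho>\<in>{1..<g}. ?a x (\<kappa> \<rho>) = 2 * m) \<and> (\<forall>i\<in>{plus_color X \<Lambda> g, minus_color X \<Lambda> g}. ?a x i = m) \<longleftrightarrow>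
        balanced g x \<and> energy g x = m"
      using content_iff[OF that[unfolded x], of m] unfolding x by blast
    finally show ?thesis .
  qed
  let ?A = "{x \<in> {x \<in> wall_data X \<Lambda>. balanced g x}. energy g x = m}"
  let ?B = "proper_walls_of_weight X \<Lambda> (fund \<Lambda> - frag_cmul (int m) (null_root X))"
  have bij: "bij_betw (wall_of X \<Lambda>) (wall_data X \<Lambda>) (proper_walls X \<Lambda>)"
    by (rule bij_betw_wall_of[OF split_floor_0])
  have "?B = wall_of X \<Lambda> ` ?A"
  proof (rule set_eqI)
    fix Y
    have "Y \<in> ?B \<longleftrightarrow> Y \<in> proper_walls X \<Lambda> \<and> (\<forall>i\<in>colors X. added X \<Lambda> Y i = m * mark X i)"
      unfolding proper_walls_of_weight_def mem_Collect_eq wall_weight_eq_iff[OF type_rank] ..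
    also have "\<dots> \<longleftrightarrow> (\<exists>x\<in>wall_data X \<Lambda>. Y = wall_of X \<Lambda> x \<and> (\<forall>i\<in>colors X. ?a x i = m * mark X i))"
      unfolding bij_betw_imp_surj_on[OF bij, symmetric] by blast
    also have "\<dots> \<longleftrightarrow> (\<exists>x\<in>wall_data X \<Lambda>. Y = wall_of X \<Lambda> x \<and> balanced g x \<and> energy g x = m)"
      by (rule bex_cong[OF refl]) (simp only: key)
    also have "\<dots> \<longleftrightarrow> Y \<in> wall_of X \<Lambda> ` ?A" by blast
    finally show "Y \<in> ?B \<longleftrightarrow> Y \<in> wall_of X \<Lambda> ` ?A" .
  qed
  moreover have "inj_on (wall_of X \<Lambda>) ?A"
    using bij_betw_imp_inj_on[OF bij] by (rule inj_on_subset) blast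
  ultimately have "card ?B = card ?A" by (simp add: card_image)
  then show "fps_nth (string_function X \<Lambda> (fund \<Lambda>)) m = fps_nth f m"
    using f by (simp add: string_function_def has_gf_def)
qed

end

text \<open>
  In every case the second passage through the chain is the reverse of the first.
\<close>

lemma nth_palindromic_cycle:
  assumes "length xs = g - 1" "2 \<le> g" "\<rho> < 2 * g"
  shows "([a] @ xs @ [b] @ rev xs) ! \<rho> =
    (if \<rho> = 0 then a else if \<rho> = g then b else if \<rho> < g then xs ! (\<rho> - 1) else xs ! (2 * g - \<rho> - 1))"
proof -
  consider "\<rho> = 0" | "\<rho> = g" | "1 \<le> \<rho>" "\<rho> < g" | "g < \<rho>" by linarith
  then show ?thesis
  proof cases
    case 4
    have "([a] @ xs @ [b] @ rev xs) ! \<rho> = rev xs ! (\<rho> - (g + 1))"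
      using assms 4 by (auto simp: nth_append nth_Cons')
    also have "\<dots> = xs ! (length xs - Suc (\<rho> - (g + 1)))"
      by (rule rev_nth) (use assms 4 in auto)
    also have "length xs - Suc (\<rho> - (g + 1)) = 2 * g - \<rho> - 1" using assms 4 by auto
    finally show ?thesis using 4 by simp
  qed (use assms in \<open>auto simp: nth_append nth_Cons'\<close>)
qed

lemma floor_at_palindromic:
  assumes "floor_cycle X \<Lambda> = [a] @ xs @ [b] @ rev xs" "length xs = g - 1" "2 \<le> g"
  shows "floor_at X \<Lambda> h =
    (if h mod (2 * g) = 0 then a else if h mod (2 * g) = g then b
     else if h mod (2 * g) < g then xs ! (h mod (2 * g) - 1) else xs ! (2 * g - h mod (2 * g) - 1))"
proof -
  have "length (floor_cycle X \<Lambda>) = 2 * g" unfolding assms(1) using assms(2,3) by simp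
  moreover have "h mod (2 * g) < 2 * g" using assms(3) by simp
  ultimately show ?thesis
    unfolding floor_at_def assms(1) using nth_palindromic_cycle[OF assms(2,3)] by simp
qed

lemma wall_pattern_low:
  assumes "n \<ge> 3" and X: "X = A_tw n \<and> mid = Cube n \<or> X = D_aff n \<and> \<Lambda> \<in> {0, 1} \<and> mid = Split n (Suc n)"
  shows "wall_pattern X \<Lambda> (n - 1) 0 n Suc mid"
proof
  show "floor_at X \<Lambda> h =
      (if h mod (2 * (n - 1)) = 0 then Split 0 (Suc 0) else if h mod (2 * (n - 1)) = n - 1 then mid
       else if h mod (2 * (n - 1)) < n - 1 then Cube (Suc (h mod (2 * (n - 1))))
       else Cube (Suc (2 * (n - 1) - h mod (2 * (n - 1)))))" for h
  proof -
    define \<rho> where "\<rho> = h mod (2 * (n - 1))"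
    have \<rho>: "\<rho> < 2 * (n - 1)" using assms by (simp add: \<rho>_def)
    have len: "length (map Cube [2..<n]) = n - 1 - 1" by simp
    have "floor_at X \<Lambda> h = (if \<rho> = 0 then Split 0 1 else if \<rho> = n - 1 then mid
        else if \<rho> < n - 1 then map Cube [2..<n] ! (\<rho> - 1) else map Cube [2..<n] ! (2 * (n - 1) - \<rho> - 1))"
      unfolding \<rho>_def by (rule floor_at_palindromic[OF _ len]) (use assms in \<open>auto simp: rev_map\<close>)
    then show ?thesis unfolding \<rho>_def [symmetric] using \<rho> assms(1) by auto
  qed
qed (use assms in auto)

text \<open>
  The diagram automorphism $i \mapsto n + 1 - i$ exchanges the two ends of the diagram; it is
  visible in the chain of colors \<open>n - \<rho>\<close> and in the exchanged split floors.
\<close>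

lemma wall_pattern_D_aff_high:
  assumes "n \<ge> 3" "\<Lambda> \<in> {n, n + 1}"
  shows "wall_pattern (D_aff n) \<Lambda> (n - 1) n 0 (\<lambda>\<rho>. n - \<rho>) (Split 0 (Suc 0))"
proof
  show "floor_at (D_aff n) \<Lambda> h =
      (if h mod (2 * (n - 1)) = 0 then Split n (Suc n) else if h mod (2 * (n - 1)) = n - 1 then Split 0 (Suc 0)
       else if h mod (2 * (n - 1)) < n - 1 then Cube (n - h mod (2 * (n - 1)))
       else Cube (n - (2 * (n - 1) - h mod (2 * (n - 1)))))" for h
  proof -
    define \<rho> where "\<rho> = h mod (2 * (n - 1))"
    have \<rho>: "\<rho> < 2 * (n - 1)" using assms by (simp add: \<rho>_def)
    have len: "length (map Cube (rev [2..<n])) = n - 1 - 1" by simp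
    have fl: "floor_at (D_aff n) \<Lambda> h = (if \<rho> = 0 then Split n (Suc n) else if \<rho> = n - 1 then Split 0 (Suc 0)
        else if \<rho> < n - 1 then map Cube (rev [2..<n]) ! (\<rho> - 1) else map Cube (rev [2..<n]) ! (2 * (n - 1) - \<rho> - 1))"
      unfolding \<rho>_def by (rule floor_at_palindromic[OF _ len]) (use assms in \<open>auto simp: rev_map\<close>)
    have chain: "map Cube (rev [2..<n]) ! (k - 1) = Cube (n - k)" if "1 \<le> k" "k < n - 1" for k
      using that by (simp add: rev_nth)
    show ?thesis unfolding \<rho>_def [symmetric] fl
    proof (intro if_cong refl)
      assume "\<rho> \<noteq> 0" "\<rho> \<noteq> n - 1" "\<rho> < n - 1"
      then show "map Cube (rev [2..<n]) ! (\<rho> - 1) = Cube (n - \<rho>)" by (intro chain) simp_all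
    next
      assume "\<rho> \<noteq> 0" "\<rho> \<noteq> n - 1" "\<not> \<rho> < n - 1"
      then have "1 \<le> 2 * (n - 1) - \<rho>" "2 * (n - 1) - \<rho> < n - 1" using \<rho> by linarith+
      then show "map Cube (rev [2..<n]) ! (2 * (n - 1) - \<rho> - 1) = Cube (n - (2 * (n - 1) - \<rho>))" by (rule chain)
    qed
  qed
  show "inj_on (\<lambda>\<rho>. n - \<rho>) {1..<n - 1}" by (auto simp: inj_on_def)
qed (use assms in auto)

lemma image_Suc_chain: "Suc ` {1..<n - 1} = {2..n - 1}"
  by (auto simp: image_iff)

lemma image_diff_chain:
  fixes n :: nat
  shows "n \<ge> 3 \<Longrightarrow> (\<lambda>\<rho>. n - \<rho>) ` {1..<n - 1} = {2..n - 1}"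
proof (intro set_eqI iffI)
  fix i assume "n \<ge> 3" "i \<in> {2..n - 1}"
  then have "i = n - (n - i)" "n - i \<in> {1..<n - 1}" by auto
  then show "i \<in> (\<lambda>\<rho>. n - \<rho>) ` {1..<n - 1}" by (rule image_eqI)
qed auto

theorem corollary5p13:
  fixes n :: nat
  assumes "n \<ge> 3"
  shows "(\<forall>\<Lambda>\<in>level_one (A_tw n).
            string_function (A_tw n) \<Lambda> (fund \<Lambda>) = 1 / (qinf 1 ^ n * qinf 2))
       \<and> (\<forall>\<Lambda>\<in>level_one (D_aff n).
            string_function (D_aff n) \<Lambda> (fund \<Lambda>) = 1 / qinf 1 ^ (n + 2))"
proof (intro conjI ballI)
  have c1: "fps_nth (qinf 1) 0 = 1" "fps_nth (qinf 2) 0 = 1" by (simp_all add: qinf_nth_0)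
  have n: "Suc (n - 1) = n" using assms by simp
  fix \<Lambda> assume "\<Lambda> \<in> level_one (A_tw n)"
  interpret wall_pattern "A_tw n" \<Lambda> "n - 1" 0 n Suc "Cube n"
    by (rule wall_pattern_low) (use assms in simp_all)
  have "string_function (A_tw n) \<Lambda> (fund \<Lambda>)
      = inverse (qinf 1) ^ (n - 1) * (inverse (qinf 1) * (1 * inverse (qinf 2)))"
  proof (rule string_function_eq)
    show "colors (A_tw n) = {0, Suc 0} \<union> Suc ` {1..<n - 1} \<union> (if Cube n = Cube n then {n} else {n, Suc n})"
      unfolding image_Suc_chain using assms by auto
    show "mark (A_tw n) i = (if i \<in> Suc ` {1..<n - 1} then 2 else 1)" for i
      unfolding image_Suc_chain by simp
  qed (use has_gf_balanced_wall_data assms in simp_all)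
  also have "\<dots> = inverse (qinf 1) ^ Suc (n - 1) * inverse (qinf 2)"
    by (simp only: power_Suc2 mult.assoc mult_1)
  also have "\<dots> = 1 / (qinf 1 ^ n * qinf 2)"
  proof -
    have "fps_nth (qinf 1 ^ n * qinf 2) 0 \<noteq> 0" by (simp add: c1 del: One_nat_def)
    from fps_divide_unit[OF this] show ?thesis
      unfolding n by (simp only: fps_inverse_mult fps_inverse_power mult_1)
  qed
  finally show "string_function (A_tw n) \<Lambda> (fund \<Lambda>) = 1 / (qinf 1 ^ n * qinf 2)" .
next
  have c1: "fps_nth (qinf 1) 0 = 1" by (simp add: qinf_nth_0)
  have n: "n - 1 + 3 = n + 2" using assms by simp
  fix \<Lambda> assume \<Lambda>: "\<Lambda> \<in> level_one (D_aff n)"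
  have "string_function (D_aff n) \<Lambda> (fund \<Lambda>)
      = inverse (qinf 1) ^ (n - 1) * (inverse (qinf 1) * (inverse (qinf 1) * inverse (qinf 1)))"
  proof (cases "\<Lambda> \<in> {0, 1}")
    case True
    interpret wall_pattern "D_aff n" \<Lambda> "n - 1" 0 n Suc "Split n (Suc n)"
      by (rule wall_pattern_low) (use assms True in simp_all)
    show ?thesis
    proof (rule string_function_eq)
      show "colors (D_aff n) = {0, Suc 0} \<union> Suc ` {1..<n - 1} \<union>
          (if Split n (Suc n) = Cube n then {n} else {n, Suc n})"
        unfolding image_Suc_chain using assms by auto
      show "mark (D_aff n) i = (if i \<in> Suc ` {1..<n - 1} then 2 else 1)" for i
        unfolding image_Suc_chain by simp
    qed (use has_gf_balanced_wall_data assms in simp_all)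
  next
    case False
    then have "\<Lambda> \<in> {n, n + 1}" using \<Lambda> by auto
    then interpret wall_pattern "D_aff n" \<Lambda> "n - 1" n 0 "\<lambda>\<rho>. n - \<rho>" "Split 0 (Suc 0)"
      by (rule wall_pattern_D_aff_high[OF assms])
    show ?thesis
    proof (rule string_function_eq)
      show "colors (D_aff n) = {n, Suc n} \<union> (\<lambda>\<rho>. n - \<rho>) ` {1..<n - 1} \<union>
          (if Split 0 (Suc 0) = Cube 0 then {0} else {0, Suc 0})"
        unfolding image_diff_chain[OF assms] using assms by auto
      show "mark (D_aff n) i = (if i \<in> (\<lambda>\<rho>. n - \<rho>) ` {1..<n - 1} then 2 else 1)" for i
        unfolding image_diff_chain[OF assms] by simp
    qed (use has_gf_balanced_wall_data assms in simp_all)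
  qed
  also have "\<dots> = inverse (qinf 1) ^ (n - 1 + 3)"
    by (simp only: power_add power3_eq_cube mult.assoc)
  also have "\<dots> = 1 / qinf 1 ^ (n + 2)"
  proof -
    have "fps_nth (qinf 1 ^ (n + 2)) 0 \<noteq> 0" by (simp add: c1 del: One_nat_def)
    from fps_divide_unit[OF this] show ?thesis
      unfolding n by (simp only: fps_inverse_power mult_1)
  qed
  finally show "string_function (D_aff n) \<Lambda> (fund \<Lambda>) = 1 / qinf 1 ^ (n + 2)" .
qed

end
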